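(* (1) The assignment $\mathcal{V}$ taking a unital vector space $\mathfrak{v}$ to the vertex algebra $V(\mathfrak{v})=F(\mathfrak{v})/I(\mathfrak{v})$ with $N(u,v)\equiv0$, and taking a morphism $\phi:\mathfrak{v}\to\mathfrak{v}'$ of unital vector spaces to the map $\Phi:V(\mathfrak{v})\to V(\mathfrak{v}')$ defined by $\Phi(x)=\phi(x)+I(\mathfrak{v}')$ for $x\in\mathfrak{v}\subset F(\mathfrak{v})$ and $\Phi(x_ny)=\Phi(x)_n\Phi(y)$ for $x,y\in F(\mathfrak{v})$ (extended linearly), is a functor from the category $\mathbf{uVect}$ to the category $\mathbf{VA}$. (2) Suppose $N\ge0$ is a constant such that, for every souped-up Lie algebra $\mathfrak{s}$, $I(\mathfrak{s})\cap\mathfrak{s}=\{0\}$, where $I(\mathfrak{s})$ is formed with $N(s,t)\equiv N$. Then $\mathcal{V}$, defined analogously on the category $\mathbf{SLA}$ by $\mathfrak{s}\mapsto F(\mathfrak{s})/I(\mathfrak{s})$ with $N(s,t)\equiv N$ and on morphisms by the same formulas, is a functor from $\mathbf{SLA}$ to $\mathbf{VA}$.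
   Context: Conventions. Vector spaces are over a fixed field of characteristic $0$ and are $\mathbf{Z}/2$-graded, with parity $p$; "commutative", "Lie algebra", etc. are meant in the super sense; linear maps that are morphisms preserve parity. A unital vector space is a vector space $\mathfrak{v}$ with a distinguished even nonzero vector $\mathbf{1}$. $F(\mathfrak{v})$ is the free nonassociative algebra on the vector space $\mathfrak{v}$ with bilinear products $x\circ_n y=x_ny$, $n\in\mathbf{Z}$ (no relations other than bilinearity; $p(x_ny)=p(x)+p(y)$). A monomial is an iterated product of elements of $\mathfrak{v}$. Ideals are closed under left and right multiplication by all elements for all $\circ_n$. Put $Dx=x_{-2}\mathbf{1}$. Vertex algebra ideal. Given $N(u,v)\ge 0$ on $\mathfrak{v}\times\mathfrak{v}$, $I(\mathfrak{v})$ is the ideal of $F(\mathfrak{v})$ generated, for $u,v\in\mathfrak{v}$ and (parity-homogeneous) $x,y,z\in F(\mathfrak{v})$, by - $\mathbf{1}_nx-\delta_{n,-1}x$; - $u_nv$ for all $n\ge N(u,v)$; - $D(x_ny)-(Dx)_ny-x_n(Dy)$; - $(Dx)_ny+n\,x_{n-1}y$ for all $n\in\mathbf{Z}$; - $x_ny+(-1)^{p(x)p(y)}\sum_{k\ge0}\frac{(-1)^{n+k}}{k!}D^k(y_{n+k}x)$; - $(x_my)_nz-\sum_{k\ge0}\binom{m}{k}(-1)^k\big(x_{m-k}(y_{n+k}z)-(-1)^{m+p(x)p(y)}y_{m+n-k}(x_kz)\big)$; where, unless indicated otherwise, each of $m,n$ ranges over $-1$ and all sufficiently large integers (threshold independent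 of $x,y,z$). The infinite sums are read modulo the ideal: for each $x,y$ one has $x_ny\in I(\mathfrak{v})$ for all large $n$, and terms lying in the ideal for this reason are dropped, so that each sum is finite. A vertex algebra generated by $\mathfrak{v}$ is a quotient $F(\mathfrak{v})/J$ by a proper ideal $J\supset I(\mathfrak{v})$ (for some function $N(u,v)$); it carries the induced products and the vector $\mathbf{1}$. Souped-up Lie algebra $\mathfrak{s}=\mathfrak{s}(\mathfrak{g},\mathfrak{a})$: $\mathfrak{a}$ is an associative commutative unital algebra ($\mathbf{1}\ne0$), $\mathfrak{g}$ a Lie algebra which is a left $\mathfrak{a}$-module, $\mathfrak{a}$ is a $\mathfrak{g}$-module on which $\mathfrak{g}$ acts by derivations, written $[g,a]=-[a,g]$ (up to super signs), and $[g,ah]=[g,a]h+a[g,h]$. $\mathfrak{s}$ is the semidirect sum Lie algebra $\mathfrak{g}\oplus\mathfrak{a}$ ($\mathfrak{a}$ abelian) together with left multiplication by $\mathfrak{a}$; its distinguished vector is $\mathbf{1}\in\mathfrak{a}$. The ideal $I(\mathfrak{s})\subset F(\mathfrak{s})$ is generated by the generators above (for the unital vector space underlying $\mathfrak{s}$) and by $s_0t-[s,t]$, $a_{-1}s-as$, $(ab)_{-1}x-a_{-1}(b_{-1}x)$ for $a,b\in\mathfrak{a}$, $s,t\in\mathfrak{s}$, monomials $x\in F(\mathfrak{s})$. Categories. $\mathbf{uVect}$: unital vector spaces, with linear maps sending $\mathbf{1}$ to $\mathbf{1}$. $\mathbf{SLA}$: souped-up Lie algebras, with linear maps $\phi$ sending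 $\mathfrak{g}$ to $\mathfrak{g}'$ and $\mathfrak{a}$ to $\mathfrak{a}'$ such that $\phi(\mathbf{1})=\mathbf{1}$, $\phi[s,t]=[\phi(s),\phi(t)]$, $\phi(as)=\phi(a)\phi(s)$. $\mathbf{VA}$: vertex algebras, with linear maps $\Phi$ sending $\mathbf{1}$ to $\mathbf{1}$ and satisfying $\Phi(x_ny)=\Phi(x)_n\Phi(y)$ for all $n$. *)

theory Defs
  imports Complex_Main "HOL-Algebra.Module" "HOL-Algebra.QuotRing"
    "HOL-Library.Z2" "HOL-Library.FuncSet"
begin

section \<open>Super vector spaces\<close>

text \<open>
  The base field is a HOL-Algebra field \<open>K\<close>.  Parities are elements of the field \<open>bit\<close> with two
  elements, and \<open>part V p\<close> is the space of vectors of parity \<open>p\<close>.  The distinguished vector of a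
  unital vector space is the \<open>one\<close> component of the HOL-Algebra record.  The \<open>mult\<close> component is
  not constrained here; it is used only for souped-up Lie algebras.
\<close>

record ('k, 'a) svec = "('k, 'a) module" +
  part :: "bit \<Rightarrow> 'a set"

locale super_vector_space = K?: field K + V?: module K V
  for K :: "'k ring" (structure) and V :: "('k, 'a, 'm) svec_scheme" (structure) +
  assumes part_submodule: "submodule (part V p) K V"
    and part_disjoint: "part V 0 \<inter> part V 1 = {\<zero>\<^bsub>V\<^esub>}"
    and part_sum: "carrier V = part V 0 <+>\<^bsub>V\<^esub> part V 1"

locale unital_vector_space = super_vector_space +
  assumes one_even: "\<one>\<^bsub>V\<^esub> \<in> part V 0"
    and one_not_zero': "\<one>\<^bsub>V\<^esub> \<noteq> \<zero>\<^bsub>V\<^esub>"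

text \<open>The sign \<open>(-1)^p\<close>.\<close>

definition sgn_of :: "bit \<Rightarrow> int" where
  "sgn_of p = (if p = 0 then 1 else - 1)"

definition linear_map ::
  "'k ring \<Rightarrow> ('k, 'a, 'm) svec_scheme \<Rightarrow> ('k, 'b, 'n) svec_scheme \<Rightarrow> ('a \<Rightarrow> 'b) \<Rightarrow> bool" where
  "linear_map K V W f \<longleftrightarrow>
     f \<in> carrier V \<rightarrow> carrier W \<and>
     (\<forall>x \<in> carrier V. \<forall>y \<in> carrier V. f (x \<oplus>\<^bsub>V\<^esub> y) = f x \<oplus>\<^bsub>W\<^esub> f y) \<and>
     (\<forall>c \<in> carrier K. \<forall>x \<in> carrier V. f (c \<odot>\<^bsub>V\<^esub> x) = c \<odot>\<^bsub>W\<^esub> f x)"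

definition even_map ::
  "('k, 'a, 'm) svec_scheme \<Rightarrow> ('k, 'b, 'n) svec_scheme \<Rightarrow> ('a \<Rightarrow> 'b) \<Rightarrow> bool" where
  "even_map V W f \<longleftrightarrow> (\<forall>p. f ` part V p \<subseteq> part W p)"

definition bilinear_map ::
  "'k ring \<Rightarrow> ('k, 'a, 'm) svec_scheme \<Rightarrow> 'a set \<Rightarrow> 'a set \<Rightarrow> ('a \<Rightarrow> 'a \<Rightarrow> 'a) \<Rightarrow> bool" where
  "bilinear_map K V A B f \<longleftrightarrow>
     (\<forall>x \<in> A. \<forall>y \<in> B. f x y \<in> carrier V) \<and>
     (\<forall>x \<in> A. \<forall>x' \<in> A. \<forall>y \<in> B. f (x \<oplus>\<^bsub>V\<^esub> x') y = f x y \<oplus>\<^bsub>V\<^esub> f x' y) \<and>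
     (\<forall>x \<in> A. \<forall>y \<in> B. \<forall>y' \<in> B. f x (y \<oplus>\<^bsub>V\<^esub> y') = f x y \<oplus>\<^bsub>V\<^esub> f x y') \<and>
     (\<forall>c \<in> carrier K. \<forall>x \<in> A. \<forall>y \<in> B. f (c \<odot>\<^bsub>V\<^esub> x) y = c \<odot>\<^bsub>V\<^esub> f x y) \<and>
     (\<forall>c \<in> carrier K. \<forall>x \<in> A. \<forall>y \<in> B. f x (c \<odot>\<^bsub>V\<^esub> y) = c \<odot>\<^bsub>V\<^esub> f x y)"

definition graded_subspace ::
  "'k ring \<Rightarrow> ('k, 'a, 'm) svec_scheme \<Rightarrow> 'a set \<Rightarrow> bool" where
  "graded_subspace K V U \<longleftrightarrow>
     submodule U K V \<and> U = (U \<inter> part V 0) <+>\<^bsub>V\<^esub> (U \<inter> part V 1)"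


section \<open>Souped-up Lie algebras\<close>

text \<open>
  The semidirect sum is the internal one: \<open>\<gg>\<close> and \<open>\<aa>\<close> are complementary graded subspaces
  \<open>gpart S\<close> and \<open>apart S\<close> of \<open>S\<close>.  The \<open>mult\<close> component of the record is the left multiplication
  by \<open>\<aa>\<close>; only its values on \<open>apart S \<times> carrier S\<close> matter.  The bracket restricted to \<open>\<gg>\<close> is the
  Lie bracket of \<open>\<gg>\<close>, and restricted to \<open>\<gg> \<times> \<aa>\<close> the action of \<open>\<gg>\<close> on \<open>\<aa>\<close>; the Jacobi
  identity for two arguments in \<open>\<gg>\<close> and one in \<open>\<aa>\<close> says that \<open>\<aa>\<close> is a \<open>\<gg>\<close>-module.
\<close>

record ('k, 'a) slie = "('k, 'a) svec" +
  lie :: "'a \<Rightarrow> 'a \<Rightarrow> 'a"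
  gpart :: "'a set"
  apart :: "'a set"

locale lie_superalgebra = super_vector_space K S
  for K :: "'k ring" and S :: "('k, 'a, 'm) slie_scheme" +
  assumes lie_bilinear: "bilinear_map K S (carrier S) (carrier S) (lie S)"
    and lie_parity: "\<lbrakk> x \<in> part S p; y \<in> part S q \<rbrakk> \<Longrightarrow> lie S x y \<in> part S (p + q)"
    and lie_skew: "\<lbrakk> x \<in> part S p; y \<in> part S q \<rbrakk> \<Longrightarrow>
      lie S x y = \<ominus>\<^bsub>S\<^esub> ([sgn_of (p * q)] \<cdot>\<^bsub>S\<^esub> lie S y x)"
    and lie_jacobi: "\<lbrakk> x \<in> part S p; y \<in> part S q; z \<in> carrier S \<rbrakk> \<Longrightarrow>
      lie S x (lie S y z) =
        lie S (lie S x y) z \<oplus>\<^bsub>S\<^esub> [sgn_of (p * q)] \<cdot>\<^bsub>S\<^esub> lie S y (lie S x z)"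

locale souped_up_lie_algebra = unital_vector_space K S + lie_superalgebra K S
  for K :: "'k ring" and S :: "('k, 'a, 'm) slie_scheme" +
  assumes g_subspace: "graded_subspace K S (gpart S)"
    and a_subspace: "graded_subspace K S (apart S)"
    and g_a_disjoint: "gpart S \<inter> apart S = {\<zero>\<^bsub>S\<^esub>}"
    and g_a_sum: "carrier S = gpart S <+>\<^bsub>S\<^esub> apart S"
    and lie_g_g: "\<lbrakk> x \<in> gpart S; y \<in> gpart S \<rbrakk> \<Longrightarrow> lie S x y \<in> gpart S"
    and lie_g_a: "\<lbrakk> x \<in> gpart S; a \<in> apart S \<rbrakk> \<Longrightarrow> lie S x a \<in> apart S"
    and lie_a_a: "\<lbrakk> a \<in> apart S; b \<in> apart S \<rbrakk> \<Longrightarrow> lie S a b = \<zero>\<^bsub>S\<^esub>"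
    and one_in_a: "\<one>\<^bsub>S\<^esub> \<in> apart S"
    and mult_bilinear: "bilinear_map K S (apart S) (carrier S) (\<otimes>\<^bsub>S\<^esub>)"
    and mult_parity: "\<lbrakk> a \<in> apart S \<inter> part S p; s \<in> part S q \<rbrakk> \<Longrightarrow>
      a \<otimes>\<^bsub>S\<^esub> s \<in> part S (p + q)"
    and mult_a_a: "\<lbrakk> a \<in> apart S; b \<in> apart S \<rbrakk> \<Longrightarrow> a \<otimes>\<^bsub>S\<^esub> b \<in> apart S"
    and mult_a_g: "\<lbrakk> a \<in> apart S; x \<in> gpart S \<rbrakk> \<Longrightarrow> a \<otimes>\<^bsub>S\<^esub> x \<in> gpart S"
    and mult_comm: "\<lbrakk> a \<in> apart S \<inter> part S p; b \<in> apart S \<inter> part S q \<rbrakk> \<Longrightarrow>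
      a \<otimes>\<^bsub>S\<^esub> b = [sgn_of (p * q)] \<cdot>\<^bsub>S\<^esub> (b \<otimes>\<^bsub>S\<^esub> a)"
    and mult_assoc: "\<lbrakk> a \<in> apart S; b \<in> apart S; s \<in> carrier S \<rbrakk> \<Longrightarrow>
      (a \<otimes>\<^bsub>S\<^esub> b) \<otimes>\<^bsub>S\<^esub> s = a \<otimes>\<^bsub>S\<^esub> (b \<otimes>\<^bsub>S\<^esub> s)"
    and mult_one: "s \<in> carrier S \<Longrightarrow> \<one>\<^bsub>S\<^esub> \<otimes>\<^bsub>S\<^esub> s = s"
    \<comment> \<open>for \<open>s\<close> in \<open>\<aa>\<close>: \<open>\<gg>\<close> acts by derivations; for \<open>s\<close> in \<open>\<gg>\<close>: \<open>[g, ah] = [g, a]h + a[g, h]\<close>\<close>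
    and lie_mult: "\<lbrakk> x \<in> gpart S \<inter> part S p; a \<in> apart S \<inter> part S q; s \<in> carrier S \<rbrakk> \<Longrightarrow>
      lie S x (a \<otimes>\<^bsub>S\<^esub> s) =
        lie S x a \<otimes>\<^bsub>S\<^esub> s \<oplus>\<^bsub>S\<^esub> [sgn_of (p * q)] \<cdot>\<^bsub>S\<^esub> (a \<otimes>\<^bsub>S\<^esub> lie S x s)"


section \<open>The free nonassociative algebra on a vector space\<close>

record ('k, 'a) nalg = "('k, 'a) svec" +
  nprod :: "int \<Rightarrow> 'a \<Rightarrow> 'a \<Rightarrow> 'a"

datatype ('k, 'a) fterm =
    Gen 'a
  | Add "('k, 'a) fterm" "('k, 'a) fterm"
  | Scale 'k "('k, 'a) fterm"
  | Prod int "('k, 'a) fterm" "('k, 'a) fterm"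

inductive_set fterms :: "'k ring \<Rightarrow> ('k, 'a, 'm) svec_scheme \<Rightarrow> ('k, 'a) fterm set"
  for K and V where
  "a \<in> carrier V \<Longrightarrow> Gen a \<in> fterms K V"
| "\<lbrakk> s \<in> fterms K V; t \<in> fterms K V \<rbrakk> \<Longrightarrow> Add s t \<in> fterms K V"
| "\<lbrakk> c \<in> carrier K; t \<in> fterms K V \<rbrakk> \<Longrightarrow> Scale c t \<in> fterms K V"
| "\<lbrakk> s \<in> fterms K V; t \<in> fterms K V \<rbrakk> \<Longrightarrow> Prod n s t \<in> fterms K V"

text \<open>
  The least congruence on terms that makes the classes a vector space with zero \<open>Gen \<zero>\<close>, all
  products bilinear, and \<open>Gen\<close> linear.
\<close>

inductive feq :: "'k ring \<Rightarrow> ('k, 'a, 'm) svec_scheme \<Rightarrow> ('k, 'a) fterm \<Rightarrow> ('k, 'a) fterm \<Rightarrow> bool"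
  for K and V where
  refl: "t \<in> fterms K V \<Longrightarrow> feq K V t t"
| sym: "feq K V s t \<Longrightarrow> feq K V t s"
| trans: "\<lbrakk> feq K V s t; feq K V t u \<rbrakk> \<Longrightarrow> feq K V s u"
| cong_Add: "\<lbrakk> feq K V s s'; feq K V t t' \<rbrakk> \<Longrightarrow> feq K V (Add s t) (Add s' t')"
| cong_Scale: "\<lbrakk> c \<in> carrier K; feq K V t t' \<rbrakk> \<Longrightarrow> feq K V (Scale c t) (Scale c t')"
| cong_Prod: "\<lbrakk> feq K V s s'; feq K V t t' \<rbrakk> \<Longrightarrow> feq K V (Prod n s t) (Prod n s' t')"
| Add_assoc: "\<lbrakk> s \<in> fterms K V; t \<in> fterms K V; u \<in> fterms K V \<rbrakk> \<Longrightarrow>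
    feq K V (Add (Add s t) u) (Add s (Add t u))"
| Add_comm: "\<lbrakk> s \<in> fterms K V; t \<in> fterms K V \<rbrakk> \<Longrightarrow> feq K V (Add s t) (Add t s)"
| Add_zero: "t \<in> fterms K V \<Longrightarrow> feq K V (Add (Gen \<zero>\<^bsub>V\<^esub>) t) t"
| Add_minus: "t \<in> fterms K V \<Longrightarrow>
    feq K V (Add (Scale (\<ominus>\<^bsub>K\<^esub> \<one>\<^bsub>K\<^esub>) t) t) (Gen \<zero>\<^bsub>V\<^esub>)"
| Scale_Add: "\<lbrakk> c \<in> carrier K; s \<in> fterms K V; t \<in> fterms K V \<rbrakk> \<Longrightarrow>
    feq K V (Scale c (Add s t)) (Add (Scale c s) (Scale c t))"
| Scale_plus: "\<lbrakk> c \<in> carrier K; d \<in> carrier K; t \<in> fterms K V \<rbrakk> \<Longrightarrow>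
    feq K V (Scale (c \<oplus>\<^bsub>K\<^esub> d) t) (Add (Scale c t) (Scale d t))"
| Scale_mult: "\<lbrakk> c \<in> carrier K; d \<in> carrier K; t \<in> fterms K V \<rbrakk> \<Longrightarrow>
    feq K V (Scale (c \<otimes>\<^bsub>K\<^esub> d) t) (Scale c (Scale d t))"
| Scale_one: "t \<in> fterms K V \<Longrightarrow> feq K V (Scale \<one>\<^bsub>K\<^esub> t) t"
| Prod_Add_left: "\<lbrakk> s \<in> fterms K V; t \<in> fterms K V; u \<in> fterms K V \<rbrakk> \<Longrightarrow>
    feq K V (Prod n (Add s t) u) (Add (Prod n s u) (Prod n t u))"
| Prod_Add_right: "\<lbrakk> s \<in> fterms K V; t \<in> fterms K V; u \<in> fterms K V \<rbrakk> \<Longrightarrow>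
    feq K V (Prod n s (Add t u)) (Add (Prod n s t) (Prod n s u))"
| Prod_Scale_left: "\<lbrakk> c \<in> carrier K; s \<in> fterms K V; t \<in> fterms K V \<rbrakk> \<Longrightarrow>
    feq K V (Prod n (Scale c s) t) (Scale c (Prod n s t))"
| Prod_Scale_right: "\<lbrakk> c \<in> carrier K; s \<in> fterms K V; t \<in> fterms K V \<rbrakk> \<Longrightarrow>
    feq K V (Prod n s (Scale c t)) (Scale c (Prod n s t))"
| Gen_Add: "\<lbrakk> a \<in> carrier V; b \<in> carrier V \<rbrakk> \<Longrightarrow>
    feq K V (Gen (a \<oplus>\<^bsub>V\<^esub> b)) (Add (Gen a) (Gen b))"
| Gen_Scale: "\<lbrakk> c \<in> carrier K; a \<in> carrier V \<rbrakk> \<Longrightarrow>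
    feq K V (Gen (c \<odot>\<^bsub>V\<^esub> a)) (Scale c (Gen a))"

inductive fterm_parity ::
  "'k ring \<Rightarrow> ('k, 'a, 'm) svec_scheme \<Rightarrow> bit \<Rightarrow> ('k, 'a) fterm \<Rightarrow> bool"
  for K and V where
  "a \<in> part V p \<Longrightarrow> fterm_parity K V p (Gen a)"
| "\<lbrakk> fterm_parity K V p s; fterm_parity K V p t \<rbrakk> \<Longrightarrow> fterm_parity K V p (Add s t)"
| "\<lbrakk> c \<in> carrier K; fterm_parity K V p t \<rbrakk> \<Longrightarrow> fterm_parity K V p (Scale c t)"
| "\<lbrakk> fterm_parity K V p s; fterm_parity K V q t \<rbrakk> \<Longrightarrow> fterm_parity K V (p + q) (Prod n s t)"

definition fclass ::
  "'k ring \<Rightarrow> ('k, 'a, 'm) svec_scheme \<Rightarrow> ('k, 'a) fterm \<Rightarrow> ('k, 'a) fterm set" where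
  "fclass K V t = {s. feq K V t s}"

text \<open>The \<open>mult\<close> component of the free algebra plays no role; it is set to the product of index \<open>-1\<close>.\<close>

definition free_alg ::
  "'k ring \<Rightarrow> ('k, 'a, 'm) svec_scheme \<Rightarrow> ('k, ('k, 'a) fterm set) nalg" where
  "free_alg K V =
    \<lparr> carrier = fclass K V ` fterms K V,
      mult = (\<lambda>X Y. \<Union>s \<in> X. \<Union>t \<in> Y. fclass K V (Prod (- 1) s t)),
      one = fclass K V (Gen \<one>\<^bsub>V\<^esub>),
      zero = fclass K V (Gen \<zero>\<^bsub>V\<^esub>),
      add = (\<lambda>X Y. \<Union>s \<in> X. \<Union>t \<in> Y. fclass K V (Add s t)),
      smult = (\<lambda>c X. \<Union>t \<in> X. fclass K V (Scale c t)),
      part = (\<lambda>p. fclass K V ` {t. fterm_parity K V p t}),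
      nprod = (\<lambda>n X Y. \<Union>s \<in> X. \<Union>t \<in> Y. fclass K V (Prod n s t)) \<rparr>"

definition incl ::
  "'k ring \<Rightarrow> ('k, 'a, 'm) svec_scheme \<Rightarrow> 'a \<Rightarrow> ('k, 'a) fterm set" where
  "incl K V a = fclass K V (Gen a)"

inductive_set monomials :: "'k ring \<Rightarrow> ('k, 'a, 'm) svec_scheme \<Rightarrow> ('k, 'a) fterm set set"
  for K and V where
  "a \<in> carrier V \<Longrightarrow> incl K V a \<in> monomials K V"
| "\<lbrakk> x \<in> monomials K V; y \<in> monomials K V \<rbrakk> \<Longrightarrow>
    nprod (free_alg K V) n x y \<in> monomials K V"


section \<open>Ideals and quotients\<close>

definition nideal :: "'k ring \<Rightarrow> ('k, 'a, 'm) nalg_scheme \<Rightarrow> 'a set \<Rightarrow> bool" where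
  "nideal K A J \<longleftrightarrow>
     submodule J K A \<and>
     (\<forall>n. \<forall>x \<in> carrier A. \<forall>y \<in> J. nprod A n x y \<in> J \<and> nprod A n y x \<in> J)"

definition quot_alg ::
  "('k, 'a, 'm) nalg_scheme \<Rightarrow> 'a set \<Rightarrow> ('k, 'a set) nalg" where
  "quot_alg A J =
    \<lparr> carrier = a_rcosets\<^bsub>A\<^esub> J,
      mult = rcoset_mult A J,
      one = J +>\<^bsub>A\<^esub> \<one>\<^bsub>A\<^esub>,
      zero = J,
      add = set_add A,
      smult = (\<lambda>c X. \<Union>x \<in> X. J +>\<^bsub>A\<^esub> (c \<odot>\<^bsub>A\<^esub> x)),
      part = (\<lambda>p. (\<lambda>x. J +>\<^bsub>A\<^esub> x) ` part A p),
      nprod = (\<lambda>n X Y. \<Union>x \<in> X. \<Union>y \<in> Y. J +>\<^bsub>A\<^esub> nprod A n x y) \<rparr>"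


section \<open>The vertex algebra ideals\<close>

definition deriv :: "('k, 'a, 'm) nalg_scheme \<Rightarrow> 'a \<Rightarrow> 'a" where
  "deriv A x = nprod A (- 2) x \<one>\<^bsub>A\<^esub>"

text \<open>The indices \<open>-1\<close> and all sufficiently large integers, with threshold \<open>M\<close>.\<close>

definition indices :: "int \<Rightarrow> int set" where
  "indices M = insert (- 1) {M..}"

text \<open>
  The binomial coefficient for integers \<open>m\<close>; the division is exact.  The library's \<open>gchoose\<close> has
  the same definition, but its type constraint does not reliably admit \<open>int\<close> after theory merges.
\<close>

definition int_binomial :: "int \<Rightarrow> nat \<Rightarrow> int" where
  "int_binomial m k = (\<Prod>i = 0..<k. m - int i) div fact k"

text \<open>
  The last two families of generators involve infinite sums, which are read modulo the ideal
  \<open>J\<close> itself: if all terms with \<open>k \<ge> L\<close> may be dropped because the binomial coefficient vanishes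
  or because the products \<open>y\<^sub>n\<^sub>+\<^sub>kx\<close> (respectively \<open>y\<^sub>n\<^sub>+\<^sub>kz\<close> and \<open>x\<^sub>kz\<close>) lie in \<open>J\<close>, then the
  sum truncated at \<open>L\<close> is a relation.  These are closure conditions on \<open>J\<close>
  that are preserved by intersections of ideals.
\<close>

definition skew_symmetry_in ::
  "'k ring \<Rightarrow> ('k, 'a, 'm) nalg_scheme \<Rightarrow> int \<Rightarrow> 'a set \<Rightarrow> bool" where
  "skew_symmetry_in K A M J \<longleftrightarrow>
    (\<forall>n \<in> indices M. \<forall>p q. \<forall>x \<in> part A p. \<forall>y \<in> part A q. \<forall>L :: nat.
      (\<forall>k \<ge> L. nprod A (n + int k) y x \<in> J) \<longrightarrow>
      nprod A n x y \<oplus>\<^bsub>A\<^esub> [sgn_of (p * q)] \<cdot>\<^bsub>A\<^esub>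
        (\<Oplus>\<^bsub>A\<^esub> k \<in> {..<L}. [sgn_of (of_int (n + int k))] \<cdot>\<^bsub>A\<^esub>
          (inv\<^bsub>K\<^esub> ([(fact k :: nat)] \<cdot>\<^bsub>K\<^esub> \<one>\<^bsub>K\<^esub>) \<odot>\<^bsub>A\<^esub> (deriv A ^^ k) (nprod A (n + int k) y x)))
      \<in> J)"

definition associativity_in ::
  "('k, 'a, 'm) nalg_scheme \<Rightarrow> int \<Rightarrow> 'a set \<Rightarrow> bool" where
  "associativity_in A M J \<longleftrightarrow>
    (\<forall>m \<in> indices M. \<forall>n \<in> indices M. \<forall>p q r.
     \<forall>x \<in> part A p. \<forall>y \<in> part A q. \<forall>z \<in> part A r. \<forall>L :: nat.
      (\<forall>k \<ge> L. int_binomial m k = 0 \<or> nprod A (n + int k) y z \<in> J \<and> nprod A (int k) x z \<in> J) \<longrightarrow>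
      nprod A n (nprod A m x y) z \<ominus>\<^bsub>A\<^esub>
        (\<Oplus>\<^bsub>A\<^esub> k \<in> {..<L}. [(int_binomial m k * (- 1) ^ k)] \<cdot>\<^bsub>A\<^esub>
          (nprod A (m - int k) x (nprod A (n + int k) y z) \<ominus>\<^bsub>A\<^esub>
           [sgn_of (of_int m + p * q)] \<cdot>\<^bsub>A\<^esub>
             nprod A (m + n - int k) y (nprod A (int k) x z)))
      \<in> J)"

definition va_relations_in ::
  "'k ring \<Rightarrow> int \<Rightarrow> ('k, 'a, 'm) svec_scheme \<Rightarrow> ('a \<Rightarrow> 'a \<Rightarrow> nat) \<Rightarrow>
   ('k, 'a) fterm set set \<Rightarrow> bool" where
  "va_relations_in K M V N J \<longleftrightarrow>
    (let A = free_alg K V; D = deriv A in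
      (\<forall>n \<in> indices M. \<forall>p. \<forall>x \<in> part A p.
         nprod A n \<one>\<^bsub>A\<^esub> x \<ominus>\<^bsub>A\<^esub> (if n = - 1 then x else \<zero>\<^bsub>A\<^esub>) \<in> J) \<and>
      (\<forall>u \<in> carrier V. \<forall>v \<in> carrier V. \<forall>n \<ge> int (N u v).
         nprod A n (incl K V u) (incl K V v) \<in> J) \<and>
      (\<forall>n \<in> indices M. \<forall>p q. \<forall>x \<in> part A p. \<forall>y \<in> part A q.
         D (nprod A n x y) \<ominus>\<^bsub>A\<^esub> nprod A n (D x) y \<ominus>\<^bsub>A\<^esub> nprod A n x (D y) \<in> J) \<and>
      (\<forall>n :: int. \<forall>p q. \<forall>x \<in> part A p. \<forall>y \<in> part A q.
         nprod A n (D x) y \<oplus>\<^bsub>A\<^esub> [n] \<cdot>\<^bsub>A\<^esub> nprod A (n - 1) x y \<in> J) \<and>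
      skew_symmetry_in K A M J \<and>
      associativity_in A M J)"

definition sla_relations_in ::
  "'k ring \<Rightarrow> ('k, 'a, 'm) slie_scheme \<Rightarrow> ('k, 'a) fterm set set \<Rightarrow> bool" where
  "sla_relations_in K S J \<longleftrightarrow>
    (let A = free_alg K S; i = incl K S in
      (\<forall>s \<in> carrier S. \<forall>t \<in> carrier S. nprod A 0 (i s) (i t) \<ominus>\<^bsub>A\<^esub> i (lie S s t) \<in> J) \<and>
      (\<forall>a \<in> apart S. \<forall>s \<in> carrier S. nprod A (- 1) (i a) (i s) \<ominus>\<^bsub>A\<^esub> i (a \<otimes>\<^bsub>S\<^esub> s) \<in> J) \<and>
      (\<forall>a \<in> apart S. \<forall>b \<in> apart S. \<forall>x \<in> monomials K S.
         nprod A (- 1) (i (a \<otimes>\<^bsub>S\<^esub> b)) x \<ominus>\<^bsub>A\<^esub>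
           nprod A (- 1) (i a) (nprod A (- 1) (i b) x) \<in> J))"

definition va_ideal ::
  "'k ring \<Rightarrow> int \<Rightarrow> ('k, 'a, 'm) svec_scheme \<Rightarrow> ('a \<Rightarrow> 'a \<Rightarrow> nat) \<Rightarrow>
   ('k, 'a) fterm set set" where
  "va_ideal K M V N = \<Inter> {J. nideal K (free_alg K V) J \<and> va_relations_in K M V N J}"

definition sla_ideal ::
  "'k ring \<Rightarrow> int \<Rightarrow> ('k, 'a, 'm) slie_scheme \<Rightarrow> ('a \<Rightarrow> 'a \<Rightarrow> nat) \<Rightarrow>
   ('k, 'a) fterm set set" where
  "sla_ideal K M S N =
     \<Inter> {J. nideal K (free_alg K S) J \<and> va_relations_in K M S N J \<and> sla_relations_in K S J}"

text \<open>
  Since vector spaces are graded throughout, the ideal \<open>J\<close> defining a vertex algebra is required to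
  be a graded subspace, so that the quotient is again graded.
\<close>

definition vertex_algebra ::
  "'k ring \<Rightarrow> int \<Rightarrow> ('k, ('k, 'a) fterm set set) nalg \<Rightarrow> bool" where
  "vertex_algebra K M A \<longleftrightarrow>
    (\<exists>(V :: ('k, 'a) svec) N J.
       unital_vector_space K V \<and>
       nideal K (free_alg K V) J \<and>
       graded_subspace K (free_alg K V) J \<and>
       va_ideal K M V N \<subseteq> J \<and>
       J \<noteq> carrier (free_alg K V) \<and>
       A = quot_alg (free_alg K V) J)"


section \<open>Categories and functors\<close>

record ('o, 'm) cat =
  Ob :: "'o set"
  Hom :: "'o \<Rightarrow> 'o \<Rightarrow> 'm set"
  Id :: "'o \<Rightarrow> 'm"
  Comp :: "'o \<Rightarrow> 'o \<Rightarrow> 'o \<Rightarrow> 'm \<Rightarrow> 'm \<Rightarrow> 'm"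

locale category =
  fixes C :: "('o, 'm) cat"
  assumes Id_in_Hom: "X \<in> Ob C \<Longrightarrow> Id C X \<in> Hom C X X"
    and Comp_in_Hom: "\<lbrakk> X \<in> Ob C; Y \<in> Ob C; Z \<in> Ob C; f \<in> Hom C X Y; g \<in> Hom C Y Z \<rbrakk> \<Longrightarrow>
      Comp C X Y Z g f \<in> Hom C X Z"
    and Comp_Id_right: "\<lbrakk> X \<in> Ob C; Y \<in> Ob C; f \<in> Hom C X Y \<rbrakk> \<Longrightarrow> Comp C X X Y f (Id C X) = f"
    and Comp_Id_left: "\<lbrakk> X \<in> Ob C; Y \<in> Ob C; f \<in> Hom C X Y \<rbrakk> \<Longrightarrow> Comp C X Y Y (Id C Y) f = f"
    and Comp_assoc: "\<lbrakk> W \<in> Ob C; X \<in> Ob C; Y \<in> Ob C; Z \<in> Ob C;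
        f \<in> Hom C W X; g \<in> Hom C X Y; h \<in> Hom C Y Z \<rbrakk> \<Longrightarrow>
      Comp C W Y Z h (Comp C W X Y g f) = Comp C W X Z (Comp C X Y Z h g) f"

locale cat_functor = C: category C + D: category D
  for C :: "('o, 'm) cat" and D :: "('p, 'n) cat" +
  fixes F_ob :: "'o \<Rightarrow> 'p" and F_hom :: "'o \<Rightarrow> 'o \<Rightarrow> 'm \<Rightarrow> 'n"
  assumes F_ob: "X \<in> Ob C \<Longrightarrow> F_ob X \<in> Ob D"
    and F_hom: "\<lbrakk> X \<in> Ob C; Y \<in> Ob C; f \<in> Hom C X Y \<rbrakk> \<Longrightarrow> F_hom X Y f \<in> Hom D (F_ob X) (F_ob Y)"
    and F_Id: "X \<in> Ob C \<Longrightarrow> F_hom X X (Id C X) = Id D (F_ob X)"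
    and F_Comp: "\<lbrakk> X \<in> Ob C; Y \<in> Ob C; Z \<in> Ob C; f \<in> Hom C X Y; g \<in> Hom C Y Z \<rbrakk> \<Longrightarrow>
      F_hom X Z (Comp C X Y Z g f) =
        Comp D (F_ob X) (F_ob Y) (F_ob Z) (F_hom Y Z g) (F_hom X Y f)"

text \<open>
  Morphisms are functions that are \<open>undefined\<close> outside the carrier of the domain, so that equality
  of morphisms is equality of maps between the carriers.
\<close>

definition uVect :: "'k ring \<Rightarrow> (('k, 'a) svec, 'a \<Rightarrow> 'a) cat" where
  "uVect K =
    \<lparr> Ob = {V. unital_vector_space K V},
      Hom = (\<lambda>V W. {f \<in> carrier V \<rightarrow>\<^sub>E carrier W.
        linear_map K V W f \<and> even_map V W f \<and> f \<one>\<^bsub>V\<^esub> = \<one>\<^bsub>W\<^esub>}),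
      Id = (\<lambda>V. \<lambda>x \<in> carrier V. x),
      Comp = (\<lambda>U V W g f. compose (carrier U) g f) \<rparr>"

definition SLA :: "'k ring \<Rightarrow> (('k, 'a) slie, 'a \<Rightarrow> 'a) cat" where
  "SLA K =
    \<lparr> Ob = {S. souped_up_lie_algebra K S},
      Hom = (\<lambda>S T. {f \<in> carrier S \<rightarrow>\<^sub>E carrier T.
        linear_map K S T f \<and> even_map S T f \<and>
        f ` gpart S \<subseteq> gpart T \<and> f ` apart S \<subseteq> apart T \<and> f \<one>\<^bsub>S\<^esub> = \<one>\<^bsub>T\<^esub> \<and>
        (\<forall>s \<in> carrier S. \<forall>t \<in> carrier S. f (lie S s t) = lie T (f s) (f t)) \<and>
        (\<forall>a \<in> apart S. \<forall>s \<in> carrier S. f (a \<otimes>\<^bsub>S\<^esub> s) = f a \<otimes>\<^bsub>T\<^esub> f s)}),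
      Id = (\<lambda>S. \<lambda>x \<in> carrier S. x),
      Comp = (\<lambda>R S T g f. compose (carrier R) g f) \<rparr>"

definition VA ::
  "'k ring \<Rightarrow> int \<Rightarrow>
   (('k, ('k, 'a) fterm set set) nalg, ('k, 'a) fterm set set \<Rightarrow> ('k, 'a) fterm set set) cat" where
  "VA K M =
    \<lparr> Ob = {A. vertex_algebra K M A},
      Hom = (\<lambda>A B. {f \<in> carrier A \<rightarrow>\<^sub>E carrier B.
        linear_map K A B f \<and> even_map A B f \<and> f \<one>\<^bsub>A\<^esub> = \<one>\<^bsub>B\<^esub> \<and>
        (\<forall>n. \<forall>x \<in> carrier A. \<forall>y \<in> carrier A. f (nprod A n x y) = nprod B n (f x) (f y))}),
      Id = (\<lambda>A. \<lambda>x \<in> carrier A. x),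
      Comp = (\<lambda>A B C g f. compose (carrier A) g f) \<rparr>"


section \<open>The assignments on objects and morphisms\<close>

text \<open>
  \<open>\<Phi> : F(\<vv>)/J \<rightarrow> F(\<vv>')/J'\<close> is a linear map with \<open>\<Phi>(x) = \<phi>(x) + J'\<close> for \<open>x \<in> \<vv>\<close> and
  \<open>\<Phi>(x\<^sub>ny) = \<Phi>(x)\<^sub>n\<Phi>(y)\<close> for \<open>x, y \<in> F(\<vv>)\<close>.
\<close>

definition induced_map ::
  "'k ring \<Rightarrow> ('k, 'a, 'm) svec_scheme \<Rightarrow> ('k, 'a) fterm set set \<Rightarrow>
   ('k, 'b, 'n) svec_scheme \<Rightarrow> ('k, 'b) fterm set set \<Rightarrow> ('a \<Rightarrow> 'b) \<Rightarrow>
   (('k, 'a) fterm set set \<Rightarrow> ('k, 'b) fterm set set) \<Rightarrow> bool" where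
  "induced_map K V J V' J' \<phi> \<Phi> \<longleftrightarrow>
    (let A = free_alg K V; A' = free_alg K V'; Q = quot_alg A J; Q' = quot_alg A' J' in
      \<Phi> \<in> carrier Q \<rightarrow>\<^sub>E carrier Q' \<and>
      linear_map K Q Q' \<Phi> \<and>
      (\<forall>x \<in> carrier V. \<Phi> (J +>\<^bsub>A\<^esub> incl K V x) = J' +>\<^bsub>A'\<^esub> incl K V' (\<phi> x)) \<and>
      (\<forall>n. \<forall>x \<in> carrier A. \<forall>y \<in> carrier A.
        \<Phi> (J +>\<^bsub>A\<^esub> nprod A n x y) = nprod Q' n (\<Phi> (J +>\<^bsub>A\<^esub> x)) (\<Phi> (J +>\<^bsub>A\<^esub> y))))"

abbreviation uVect_ideal ::
  "'k ring \<Rightarrow> int \<Rightarrow> ('k, 'a) svec \<Rightarrow> ('k, 'a) fterm set set" where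
  "uVect_ideal K M V \<equiv> va_ideal K M V (\<lambda>u v. 0)"

definition uVect_V_ob ::
  "'k ring \<Rightarrow> int \<Rightarrow> ('k, 'a) svec \<Rightarrow> ('k, ('k, 'a) fterm set set) nalg" where
  "uVect_V_ob K M V = quot_alg (free_alg K V) (uVect_ideal K M V)"

definition uVect_V_hom ::
  "'k ring \<Rightarrow> int \<Rightarrow> ('k, 'a) svec \<Rightarrow> ('k, 'a) svec \<Rightarrow> ('a \<Rightarrow> 'a) \<Rightarrow>
   ('k, 'a) fterm set set \<Rightarrow> ('k, 'a) fterm set set" where
  "uVect_V_hom K M V V' \<phi> =
     (THE \<Phi>. induced_map K V (uVect_ideal K M V) V' (uVect_ideal K M V') \<phi> \<Phi>)"

abbreviation SLA_ideal ::
  "'k ring \<Rightarrow> int \<Rightarrow> nat \<Rightarrow> ('k, 'a) slie \<Rightarrow> ('k, 'a) fterm set set" where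
  "SLA_ideal K M N S \<equiv> sla_ideal K M S (\<lambda>s t. N)"

definition SLA_V_ob ::
  "'k ring \<Rightarrow> int \<Rightarrow> nat \<Rightarrow> ('k, 'a) slie \<Rightarrow> ('k, ('k, 'a) fterm set set) nalg" where
  "SLA_V_ob K M N S = quot_alg (free_alg K S) (SLA_ideal K M N S)"

definition SLA_V_hom ::
  "'k ring \<Rightarrow> int \<Rightarrow> nat \<Rightarrow> ('k, 'a) slie \<Rightarrow> ('k, 'a) slie \<Rightarrow> ('a \<Rightarrow> 'a) \<Rightarrow>
   ('k, 'a) fterm set set \<Rightarrow> ('k, 'a) fterm set set" where
  "SLA_V_hom K M N S S' \<phi> =
     (THE \<Phi>. induced_map K S (SLA_ideal K M N S) S' (SLA_ideal K M N S') \<phi> \<Phi>)"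

end

theory Submission
  imports Defs
begin

text \<open>
  The conditions that define the ideals \<open>I(\<vv>)\<close> and \<open>I(\<ss>)\<close> are inherited by preimages under
  homomorphisms, and this one principle carries both functors.  By the universal property of the
  free algebra, a morphism \<open>\<phi> : \<vv> \<rightarrow> \<vv>'\<close> extends to a homomorphism \<open>F(\<phi>) : F(\<vv>) \<rightarrow> F(\<vv>')\<close>
  (\<open>free_map\<close>).  The preimage of \<open>I(\<vv>')\<close> is an ideal of \<open>F(\<vv>)\<close>, and it satisfies every relation
  that \<open>I(\<vv>)\<close> has to satisfy.  This includes the two families with infinite sums: if the products
  with index beyond a bound \<open>L\<close> lie in the preimage, then their images lie in \<open>I(\<vv>')\<close>, so that the
  sum may be truncated at the same \<open>L\<close> on both sides.  As \<open>I(\<vv>)\<close> is the least such ideal, \<open>F(\<phi>)\<close> maps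
  it into \<open>I(\<vv>')\<close> (\<open>free_map_va_ideal\<close>, \<open>free_map_sla_ideal\<close>) and so descends to the quotients.
  The induced map is unique because \<open>F(\<vv>)\<close> is spanned by iterated products of elements of \<open>\<vv>\<close>,
  and for the same reason the assignment respects identities and composition (\<open>quotient_functor\<close>).

  The quotients must also be vertex algebras, which means that the ideals are graded and proper.

  Gradedness is a second use of functoriality.  The parity involution \<open>\<sigma>\<close> of \<open>\<vv>\<close>, which is \<open>1\<close> on
  the even part and \<open>-1\<close> on the odd part, is itself a morphism, also for souped-up Lie algebras.
  Hence \<open>F(\<sigma>)\<close> preserves the ideal.  If \<open>x = x\<^sub>0 + x\<^sub>1\<close> is the decomposition of an element of the
  ideal, then \<open>x + F(\<sigma>)x = 2x\<^sub>0\<close>, so \<open>x\<^sub>0\<close> and \<open>x\<^sub>1\<close> lie in the ideal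
  (\<open>graded_subspace_if_parity_stable\<close>).  Because the constant function \<open>N\<close> is invariant under \<open>\<sigma>\<close>,
  generators built from inhomogeneous vectors cause no difficulty.

  For properness of \<open>I(\<vv>)\<close>, the ground field is made an algebra in which \<open>x\<^sub>-\<^sub>1y = xy\<close> and all other
  products vanish; all relations hold in it.  An even linear functional on \<open>\<vv>\<close> with value \<open>1\<close> at
  \<open>\<one>\<close> exists by Zorn's lemma and extends to a homomorphism on \<open>F(\<vv>)\<close>.  Its kernel contains \<open>I(\<vv>)\<close>
  and not \<open>\<one>\<close> (\<open>exists_proper_va_ideal\<close>).  For souped-up Lie algebras, the additional relations need
  not hold in the ground field, and properness comes from the hypothesis \<open>I(\<ss>) \<inter> \<ss> = {0}\<close>: an ideal
  equal to \<open>F(\<ss>)\<close> would contain \<open>\<one>\<close>, and \<open>\<one> \<noteq> 0\<close> in \<open>F(\<ss>)\<close> by the same functional.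
\<close>

section \<open>Algebras with products indexed by the integers\<close>

lemma (in abelian_group) minus_add_cancel:
  assumes [simp]: "a \<in> carrier G" "b \<in> carrier G" "c \<in> carrier G"
  shows "(a \<oplus> c) \<ominus> (b \<oplus> c) = a \<ominus> b"
proof -
  have "(a \<oplus> c) \<ominus> (b \<oplus> c) = a \<oplus> c \<oplus> (\<ominus> c \<oplus> \<ominus> b)"
    by (simp add: a_minus_def minus_add a_comm)
  also have "\<dots> = a \<oplus> (c \<oplus> (\<ominus> c \<oplus> \<ominus> b))"
    by (simp add: a_assoc)
  finally show ?thesis
    by (simp add: r_neg2 a_minus_def)
qed

lemma (in abelian_monoid) finsum_eq_single_term:
  assumes "finite I" "i \<in> I" "f \<in> I \<rightarrow> carrier G" "\<And>j. j \<in> I \<Longrightarrow> j \<noteq> i \<Longrightarrow> f j = \<zero>"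
  shows "(\<Oplus>j\<in>I. f j) = f i"
proof -
  have "(\<Oplus>j\<in>I. f j) = (\<Oplus>j\<in>I. if i = j then f j else \<zero>)"
    using assms by (intro finsum_cong') (auto simp: Pi_def)
  also have "\<dots> = f i"
    by (rule finsum_singleton [OF assms(2,1,3)])
  finally show ?thesis .
qed

locale char_zero_field = field K for K :: "'k ring" +
  assumes char_zero: "\<And>n :: nat. n > 0 \<Longrightarrow> [n] \<cdot>\<^bsub>K\<^esub> \<one>\<^bsub>K\<^esub> \<noteq> \<zero>\<^bsub>K\<^esub>"
begin

lemma inv_fact_closed: "inv\<^bsub>K\<^esub> ([(fact k :: nat)] \<cdot>\<^bsub>K\<^esub> \<one>\<^bsub>K\<^esub>) \<in> carrier K"
  using char_zero [of "fact k"] by (simp add: field_Units)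

end

lemma (in abelian_group) eq_if_minus_zero:
  assumes "a \<ominus> b = \<zero>" "a \<in> carrier G" "b \<in> carrier G"
  shows "a = b"
  using assms minus_equality [of a "\<ominus> b"] by (simp add: a_minus_def)

text \<open>
  The free algebra and the ground field (with suitable products) are instances; stating the
  relations of vertex algebras for any such algebra lets them be pulled back along homomorphisms.
\<close>

locale product_algebra = module K A
  for K :: "'k ring" and A :: "('k, 'a, 'm) nalg_scheme" +
  assumes nprod_bilinear: "bilinear_map K A (carrier A) (carrier A) (nprod A n)"
    and one_part: "\<one>\<^bsub>A\<^esub> \<in> part A 0"
    and part_submodule: "submodule (part A p) K A"
    and nprod_part: "\<lbrakk> x \<in> part A p; y \<in> part A q \<rbrakk> \<Longrightarrow> nprod A n x y \<in> part A (p + q)"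
begin

lemma part_subset: "part A p \<subseteq> carrier A"
  by (rule submoduleE(1) [OF part_submodule])

lemma one_carrier [simp]: "\<one>\<^bsub>A\<^esub> \<in> carrier A"
  using one_part part_subset by blast

lemma nprod_closed [simp]:
  "\<lbrakk> x \<in> carrier A; y \<in> carrier A \<rbrakk> \<Longrightarrow> nprod A n x y \<in> carrier A"
  using nprod_bilinear by (simp add: bilinear_map_def)

lemma nprod_add_left: "\<lbrakk> x \<in> carrier A; x' \<in> carrier A; y \<in> carrier A \<rbrakk> \<Longrightarrow>
    nprod A n (x \<oplus>\<^bsub>A\<^esub> x') y = nprod A n x y \<oplus>\<^bsub>A\<^esub> nprod A n x' y"
  using nprod_bilinear by (simp add: bilinear_map_def)

lemma nprod_add_right: "\<lbrakk> x \<in> carrier A; y \<in> carrier A; y' \<in> carrier A \<rbrakk> \<Longrightarrow>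
    nprod A n x (y \<oplus>\<^bsub>A\<^esub> y') = nprod A n x y \<oplus>\<^bsub>A\<^esub> nprod A n x y'"
  using nprod_bilinear by (simp add: bilinear_map_def)

lemma nprod_smult_left: "\<lbrakk> c \<in> carrier K; x \<in> carrier A; y \<in> carrier A \<rbrakk> \<Longrightarrow>
    nprod A n (c \<odot>\<^bsub>A\<^esub> x) y = c \<odot>\<^bsub>A\<^esub> nprod A n x y"
  using nprod_bilinear by (simp add: bilinear_map_def)

lemma nprod_smult_right: "\<lbrakk> c \<in> carrier K; x \<in> carrier A; y \<in> carrier A \<rbrakk> \<Longrightarrow>
    nprod A n x (c \<odot>\<^bsub>A\<^esub> y) = c \<odot>\<^bsub>A\<^esub> nprod A n x y"
  using nprod_bilinear by (simp add: bilinear_map_def)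

lemma deriv_closed [simp]: "x \<in> carrier A \<Longrightarrow> deriv A x \<in> carrier A"
  by (simp add: deriv_def)

lemma deriv_funpow_closed [simp]: "x \<in> carrier A \<Longrightarrow> (deriv A ^^ k) x \<in> carrier A"
  by (induction k) simp_all

end

lemma linear_mapD:
  assumes "linear_map K V W f"
  shows "\<And>x. x \<in> carrier V \<Longrightarrow> f x \<in> carrier W"
    and "\<And>x y. \<lbrakk> x \<in> carrier V; y \<in> carrier V \<rbrakk> \<Longrightarrow> f (x \<oplus>\<^bsub>V\<^esub> y) = f x \<oplus>\<^bsub>W\<^esub> f y"
    and "\<And>c x. \<lbrakk> c \<in> carrier K; x \<in> carrier V \<rbrakk> \<Longrightarrow> f (c \<odot>\<^bsub>V\<^esub> x) = c \<odot>\<^bsub>W\<^esub> f x"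
  using assms unfolding linear_map_def by auto

lemma linear_map_abelian_group_hom:
  assumes "module K V" "module K W" "linear_map K V W f"
  shows "abelian_group_hom V W f"
proof -
  interpret V: module K V by fact
  interpret W: module K W by fact
  show ?thesis
    by (rule abelian_group_homI)
      (auto intro!: V.abelian_group_axioms W.abelian_group_axioms group_hom.intro V.a_group W.a_group
        simp: group_hom_axioms_def hom_def linear_mapD [OF assms(3)])
qed

locale product_algebra_hom = A: product_algebra K A + B: product_algebra K B
  for K :: "'k ring" and A :: "('k, 'a, 'm) nalg_scheme" and B :: "('k, 'b, 'n) nalg_scheme" +
  fixes h :: "'a \<Rightarrow> 'b"
  assumes linear: "linear_map K A B h"
    and even: "even_map A B h"
    and hom_one: "h \<one>\<^bsub>A\<^esub> = \<one>\<^bsub>B\<^esub>"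
    and hom_nprod: "\<lbrakk> x \<in> carrier A; y \<in> carrier A \<rbrakk> \<Longrightarrow> h (nprod A n x y) = nprod B n (h x) (h y)"
begin

sublocale abelian_group_hom A B h
  by (rule linear_map_abelian_group_hom [OF A.module_axioms B.module_axioms linear])

lemma hom_smult: "\<lbrakk> c \<in> carrier K; x \<in> carrier A \<rbrakk> \<Longrightarrow> h (c \<odot>\<^bsub>A\<^esub> x) = c \<odot>\<^bsub>B\<^esub> h x"
  using linear by (rule linear_mapD)

lemma hom_part: "x \<in> part A p \<Longrightarrow> h x \<in> part B p"
  using even by (auto simp: even_map_def)

lemma hom_minus: "\<lbrakk> x \<in> carrier A; y \<in> carrier A \<rbrakk> \<Longrightarrow> h (x \<ominus>\<^bsub>A\<^esub> y) = h x \<ominus>\<^bsub>B\<^esub> h y"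
  by (simp add: a_minus_def)

lemma hom_add_pow: "x \<in> carrier A \<Longrightarrow> h ([(n::int)] \<cdot>\<^bsub>A\<^esub> x) = [n] \<cdot>\<^bsub>B\<^esub> h x"
  using group_hom.hom_int_pow [OF a_group_hom, of x n] by (simp add: add_pow_def)

lemma hom_deriv: "x \<in> carrier A \<Longrightarrow> h (deriv A x) = deriv B (h x)"
  by (simp add: deriv_def hom_nprod hom_one)

lemma hom_deriv_funpow: "x \<in> carrier A \<Longrightarrow> h ((deriv A ^^ k) x) = (deriv B ^^ k) (h x)"
  by (induction k) (simp_all add: hom_deriv)

lemma hom_finsum: "f \<in> I \<rightarrow> carrier A \<Longrightarrow> finite I \<Longrightarrow> h (\<Oplus>\<^bsub>A\<^esub>i\<in>I. f i) = (\<Oplus>\<^bsub>B\<^esub>i\<in>I. h (f i))"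
  by (induction I rule: infinite_finite_induct) (auto simp: Pi_def)

end

section \<open>The vertex algebra relations and their preimages\<close>

text \<open>
  The part of \<open>va_relations_in\<close> that does not mention the generating space.  In this form it makes
  sense in any algebra with products \<open>\<circ>\<^sub>n\<close>, in particular in the target of a homomorphism that is not
  a free algebra.
\<close>

definition va_axioms_in :: "'k ring \<Rightarrow> int \<Rightarrow> ('k, 'a, 'm) nalg_scheme \<Rightarrow> 'a set \<Rightarrow> bool" where
  "va_axioms_in K M A J \<longleftrightarrow>
    (\<forall>n \<in> indices M. \<forall>p. \<forall>x \<in> part A p.
       nprod A n \<one>\<^bsub>A\<^esub> x \<ominus>\<^bsub>A\<^esub> (if n = - 1 then x else \<zero>\<^bsub>A\<^esub>) \<in> J) \<and>
    (\<forall>n \<in> indices M. \<forall>p q. \<forall>x \<in> part A p. \<forall>y \<in> part A q.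
       deriv A (nprod A n x y) \<ominus>\<^bsub>A\<^esub> nprod A n (deriv A x) y \<ominus>\<^bsub>A\<^esub> nprod A n x (deriv A y) \<in> J) \<and>
    (\<forall>n :: int. \<forall>p q. \<forall>x \<in> part A p. \<forall>y \<in> part A q.
       nprod A n (deriv A x) y \<oplus>\<^bsub>A\<^esub> [n] \<cdot>\<^bsub>A\<^esub> nprod A (n - 1) x y \<in> J) \<and>
    skew_symmetry_in K A M J \<and>
    associativity_in A M J"

lemma va_relations_in_iff:
  "va_relations_in K M V N J \<longleftrightarrow>
    va_axioms_in K M (free_alg K V) J \<and>
    (\<forall>u \<in> carrier V. \<forall>v \<in> carrier V. \<forall>n \<ge> int (N u v).
       nprod (free_alg K V) n (incl K V u) (incl K V v) \<in> J)"
  unfolding va_relations_in_def va_axioms_in_def Let_def by blast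

lemma (in product_algebra) nideal_carrier: "nideal K A (carrier A)"
  by (simp add: nideal_def carrier_is_submodule)

context product_algebra_hom begin

definition preimage :: "'b set \<Rightarrow> 'a set" where
  "preimage J = {x \<in> carrier A. h x \<in> J}"

lemma preimage_iff: "x \<in> carrier A \<Longrightarrow> x \<in> preimage J \<longleftrightarrow> h x \<in> J"
  by (simp add: preimage_def)

lemma nideal_preimage:
  assumes "nideal K B J"
  shows "nideal K A (preimage J)"
proof -
  have J: "submodule J K B"
    and J': "\<And>n x y. x \<in> carrier B \<Longrightarrow> y \<in> J \<Longrightarrow> nprod B n x y \<in> J \<and> nprod B n y x \<in> J"
    using assms unfolding nideal_def by auto
  interpret additive_subgroup J B
    using J by (simp add: additive_subgroup_def submodule_def)
  have "submodule (preimage J) K A"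
    by (rule A.submoduleI) (auto simp: preimage_def hom_smult submodule.smult_closed [OF J])
  then show ?thesis
    unfolding nideal_def using J' by (auto simp: preimage_def hom_nprod)
qed

text \<open>
  The truncation bound \<open>L\<close> is transported unchanged: a product lies in the preimage of \<open>J\<close> exactly
  when the product of the images lies in \<open>J\<close>.
\<close>

lemma skew_symmetry_preimage:
  assumes "char_zero_field K"
    and B: "skew_symmetry_in K B M J"
  shows "skew_symmetry_in K A M (preimage J)"
proof -
  interpret F: char_zero_field K by fact
  show ?thesis
    unfolding skew_symmetry_in_def
  proof (intro ballI allI impI)
    fix n p q x y and L :: nat
    assume n: "n \<in> indices M" and x: "x \<in> part A p" and y: "y \<in> part A q"
      and L: "\<forall>k\<ge>L. nprod A (n + int k) y x \<in> preimage J"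
    have [simp]: "x \<in> carrier A" "y \<in> carrier A"
      using x y A.part_subset by auto
    have L': "\<forall>k\<ge>L. nprod B (n + int k) (h y) (h x) \<in> J"
      using L by (auto simp: preimage_def hom_nprod)
    show "nprod A n x y \<oplus>\<^bsub>A\<^esub> [sgn_of (p * q)] \<cdot>\<^bsub>A\<^esub>
        (\<Oplus>\<^bsub>A\<^esub> k \<in> {..<L}. [sgn_of (of_int (n + int k))] \<cdot>\<^bsub>A\<^esub>
          (inv\<^bsub>K\<^esub> ([(fact k :: nat)] \<cdot>\<^bsub>K\<^esub> \<one>\<^bsub>K\<^esub>) \<odot>\<^bsub>A\<^esub> (deriv A ^^ k) (nprod A (n + int k) y x)))
      \<in> preimage J"
      using B [unfolded skew_symmetry_in_def, rule_format,
          OF n hom_part [OF x] hom_part [OF y] L' [rule_format]]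
      by (subst preimage_iff)
        (auto simp: Pi_def F.inv_fact_closed hom_add_pow hom_finsum hom_smult hom_nprod hom_deriv_funpow)
  qed
qed

lemma associativity_preimage:
  assumes B: "associativity_in B M J"
  shows "associativity_in A M (preimage J)"
  unfolding associativity_in_def
proof (intro ballI allI impI)
  fix m n p q r x y z and L :: nat
  assume m: "m \<in> indices M" and n: "n \<in> indices M"
    and x: "x \<in> part A p" and y: "y \<in> part A q" and z: "z \<in> part A r"
    and L: "\<forall>k\<ge>L. int_binomial m k = 0 \<or>
      nprod A (n + int k) y z \<in> preimage J \<and> nprod A (int k) x z \<in> preimage J"
  have [simp]: "x \<in> carrier A" "y \<in> carrier A" "z \<in> carrier A"
    using x y z A.part_subset by auto
  have L': "\<forall>k\<ge>L. int_binomial m k = 0 \<or>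
      nprod B (n + int k) (h y) (h z) \<in> J \<and> nprod B (int k) (h x) (h z) \<in> J"
    using L by (auto simp: preimage_def hom_nprod)
  show "nprod A n (nprod A m x y) z \<ominus>\<^bsub>A\<^esub>
        (\<Oplus>\<^bsub>A\<^esub> k \<in> {..<L}. [(int_binomial m k * (- 1) ^ k)] \<cdot>\<^bsub>A\<^esub>
          (nprod A (m - int k) x (nprod A (n + int k) y z) \<ominus>\<^bsub>A\<^esub>
           [sgn_of (of_int m + p * q)] \<cdot>\<^bsub>A\<^esub>
             nprod A (m + n - int k) y (nprod A (int k) x z)))
      \<in> preimage J"
    using B [unfolded associativity_in_def, rule_format,
        OF m n hom_part [OF x] hom_part [OF y] hom_part [OF z] L' [rule_format]]
    by (subst preimage_iff)
      (auto simp: Pi_def hom_minus hom_add_pow hom_finsum hom_nprod)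
qed

lemma va_axioms_preimage:
  assumes "char_zero_field K"
    and B: "va_axioms_in K M B J"
  shows "va_axioms_in K M A (preimage J)"
proof -
  have carr: "\<And>x p. x \<in> part A p \<Longrightarrow> x \<in> carrier A"
    using A.part_subset by auto
  have "\<forall>n \<in> indices M. \<forall>p. \<forall>x \<in> part A p.
       nprod A n \<one>\<^bsub>A\<^esub> x \<ominus>\<^bsub>A\<^esub> (if n = - 1 then x else \<zero>\<^bsub>A\<^esub>) \<in> preimage J"
  proof (intro ballI allI)
    fix n p x assume *: "n \<in> indices M" "x \<in> part A p"
    have "nprod B n \<one>\<^bsub>B\<^esub> (h x) \<ominus>\<^bsub>B\<^esub> (if n = - 1 then h x else \<zero>\<^bsub>B\<^esub>) \<in> J"
      using B * hom_part unfolding va_axioms_in_def by blast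
    then show "nprod A n \<one>\<^bsub>A\<^esub> x \<ominus>\<^bsub>A\<^esub> (if n = - 1 then x else \<zero>\<^bsub>A\<^esub>) \<in> preimage J"
      using carr [OF *(2)]
      by (subst preimage_iff) (auto simp: hom_minus hom_nprod hom_one split: if_splits)
  qed
  moreover have "\<forall>n \<in> indices M. \<forall>p q. \<forall>x \<in> part A p. \<forall>y \<in> part A q.
      deriv A (nprod A n x y) \<ominus>\<^bsub>A\<^esub> nprod A n (deriv A x) y \<ominus>\<^bsub>A\<^esub> nprod A n x (deriv A y)
        \<in> preimage J"
  proof (intro ballI allI)
    fix n p q x y assume *: "n \<in> indices M" "x \<in> part A p" "y \<in> part A q"
    have "deriv B (nprod B n (h x) (h y)) \<ominus>\<^bsub>B\<^esub> nprod B n (deriv B (h x)) (h y)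
        \<ominus>\<^bsub>B\<^esub> nprod B n (h x) (deriv B (h y)) \<in> J"
      using B * hom_part unfolding va_axioms_in_def by blast
    then show "deriv A (nprod A n x y) \<ominus>\<^bsub>A\<^esub> nprod A n (deriv A x) y \<ominus>\<^bsub>A\<^esub> nprod A n x (deriv A y)
        \<in> preimage J"
      using carr [OF *(2)] carr [OF *(3)]
      by (subst preimage_iff) (auto simp: hom_minus hom_nprod hom_deriv)
  qed
  moreover have "\<forall>n :: int. \<forall>p q. \<forall>x \<in> part A p. \<forall>y \<in> part A q.
       nprod A n (deriv A x) y \<oplus>\<^bsub>A\<^esub> [n] \<cdot>\<^bsub>A\<^esub> nprod A (n - 1) x y \<in> preimage J"
  proof (intro ballI allI)
    fix n :: int and p q x y assume *: "x \<in> part A p" "y \<in> part A q"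
    have "nprod B n (deriv B (h x)) (h y) \<oplus>\<^bsub>B\<^esub> [n] \<cdot>\<^bsub>B\<^esub> nprod B (n - 1) (h x) (h y) \<in> J"
      using B * hom_part unfolding va_axioms_in_def by blast
    then show "nprod A n (deriv A x) y \<oplus>\<^bsub>A\<^esub> [n] \<cdot>\<^bsub>A\<^esub> nprod A (n - 1) x y \<in> preimage J"
      using carr [OF *(1)] carr [OF *(2)]
      by (subst preimage_iff) (auto simp: hom_nprod hom_deriv hom_add_pow)
  qed
  moreover have "skew_symmetry_in K A M (preimage J)" "associativity_in A M (preimage J)"
    using B skew_symmetry_preimage [OF assms(1)] associativity_preimage
    by (simp_all add: va_axioms_in_def)
  ultimately show ?thesis
    unfolding va_axioms_in_def by (intro conjI)
qed

end

text \<open>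
  The whole algebra is one of the ideals that are intersected, so the intersections defining
  \<open>I(\<vv>)\<close> and \<open>I(\<ss>)\<close> are not over the empty family.
\<close>

lemma (in product_algebra) va_axioms_carrier:
  assumes "char_zero_field K"
  shows "va_axioms_in K M A (carrier A)"
proof -
  interpret F: char_zero_field K by fact
  have [simp]: "\<And>x p. x \<in> part A p \<Longrightarrow> x \<in> carrier A"
    using part_subset by auto
  show ?thesis
    unfolding va_axioms_in_def skew_symmetry_in_def associativity_in_def
    by (auto intro!: M.finsum_closed M.minus_closed M.a_closed simp: F.inv_fact_closed Pi_def)
qed

text \<open>
  Conditions with infinite sums pass to intersections because the premise of a truncation at \<open>L\<close>
  weakens as the ideal grows: terms that lie in \<open>\<Inter>\<J>\<close> lie in each \<open>J \<in> \<J>\<close>.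
\<close>

lemma skew_symmetry_Inter:
  assumes "\<And>J. J \<in> \<J> \<Longrightarrow> skew_symmetry_in K A M J"
  shows "skew_symmetry_in K A M (\<Inter>\<J>)"
  unfolding skew_symmetry_in_def
proof (intro ballI allI impI InterI, goal_cases)
  case (1 n p q x y L J)
  then have "\<forall>k\<ge>L. nprod A (n + int k) y x \<in> J"
    by blast
  from assms [OF 1(5), unfolded skew_symmetry_in_def, rule_format, OF 1(1-3) this [rule_format]]
  show ?case .
qed

lemma associativity_Inter:
  assumes "\<And>J. J \<in> \<J> \<Longrightarrow> associativity_in A M J"
  shows "associativity_in A M (\<Inter>\<J>)"
  unfolding associativity_in_def
proof (intro ballI allI impI InterI, goal_cases)
  case (1 m n p q r x y z L J)
  then have "\<forall>k\<ge>L. int_binomial m k = 0 \<or> nprod A (n + int k) y z \<in> J \<and> nprod A (int k) x z \<in> J"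
    by blast
  from assms [OF 1(7), unfolded associativity_in_def, rule_format, OF 1(1-5) this [rule_format]]
  show ?case .
qed

lemma va_axioms_Inter:
  assumes "\<And>J. J \<in> \<J> \<Longrightarrow> va_axioms_in K M A J"
  shows "va_axioms_in K M A (\<Inter>\<J>)"
  using assms skew_symmetry_Inter [of \<J> K A M] associativity_Inter [of \<J> A M]
  unfolding va_axioms_in_def by (intro conjI ballI allI impI InterI) simp_all

section \<open>The universal property of the free algebra\<close>

context unital_vector_space
begin

lemma feq_fterms: "feq K V s t \<Longrightarrow> s \<in> fterms K V \<and> t \<in> fterms K V"
  by (induction rule: feq.induct) (auto intro: fterms.intros)

lemma fclass_eq_iff: "s \<in> fterms K V \<Longrightarrow> fclass K V s = fclass K V t \<longleftrightarrow> feq K V s t"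
  unfolding fclass_def by (auto intro: feq.refl feq.sym feq.trans)

lemma fclass_eqI: "feq K V s t \<Longrightarrow> fclass K V s = fclass K V t"
  using fclass_eq_iff feq_fterms by blast

lemma fterm_parity_fterms: "fterm_parity K V p t \<Longrightarrow> t \<in> fterms K V"
  by (induction rule: fterm_parity.induct)
    (use submoduleE(1) [OF part_submodule] in \<open>auto intro: fterms.intros\<close>)

lemma free_alg_simps [simp]:
  "carrier (free_alg K V) = fclass K V ` fterms K V"
  "one (free_alg K V) = incl K V \<one>\<^bsub>V\<^esub>"
  "zero (free_alg K V) = incl K V \<zero>\<^bsub>V\<^esub>"
  "part (free_alg K V) p = fclass K V ` {t. fterm_parity K V p t}"
  by (simp_all add: free_alg_def incl_def)

lemma fclass_UN1:
  assumes "s \<in> fterms K V" "\<And>s s'. feq K V s s' \<Longrightarrow> feq K V (f s) (f s')"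
  shows "(\<Union>s \<in> fclass K V s. fclass K V (f s)) = fclass K V (f s)"
proof -
  have "fclass K V (f s') = fclass K V (f s)" if "s' \<in> fclass K V s" for s'
    using assms(2) [of s s'] that fclass_eq_iff [of "f s" "f s'"] feq_fterms by (auto simp: fclass_def)
  moreover have "s \<in> fclass K V s"
    using assms(1) by (auto simp: fclass_def feq.refl)
  ultimately show ?thesis by blast
qed

lemma fclass_UN2:
  assumes "s \<in> fterms K V" "t \<in> fterms K V"
    and "\<And>s s' t t'. feq K V s s' \<Longrightarrow> feq K V t t' \<Longrightarrow> feq K V (f s t) (f s' t')"
  shows "(\<Union>s \<in> fclass K V s. \<Union>t \<in> fclass K V t. fclass K V (f s t)) = fclass K V (f s t)"
proof -
  have "fclass K V (f s' t') = fclass K V (f s t)" if "s' \<in> fclass K V s" "t' \<in> fclass K V t" for s' t'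
    using assms(3) [of s s' t t'] that fclass_eq_iff [of "f s t" "f s' t'"] feq_fterms
    by (auto simp: fclass_def)
  moreover have "s \<in> fclass K V s" "t \<in> fclass K V t"
    using assms(1,2) by (auto simp: fclass_def feq.refl)
  ultimately show ?thesis by blast
qed

lemma fclass_ops [simp]:
  "\<lbrakk> s \<in> fterms K V; t \<in> fterms K V \<rbrakk> \<Longrightarrow>
    fclass K V s \<oplus>\<^bsub>free_alg K V\<^esub> fclass K V t = fclass K V (Add s t)"
  "\<lbrakk> s \<in> fterms K V; t \<in> fterms K V \<rbrakk> \<Longrightarrow>
    nprod (free_alg K V) n (fclass K V s) (fclass K V t) = fclass K V (Prod n s t)"
  "\<lbrakk> c \<in> carrier K; t \<in> fterms K V \<rbrakk> \<Longrightarrow>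
    c \<odot>\<^bsub>free_alg K V\<^esub> fclass K V t = fclass K V (Scale c t)"
  unfolding free_alg_def
  by (simp_all add: fclass_UN1 fclass_UN2 feq.cong_Add feq.cong_Prod feq.cong_Scale)

lemma fterms_Gen_zero [simp]: "Gen \<zero>\<^bsub>V\<^esub> \<in> fterms K V"
  by (simp add: fterms.intros)

lemma one_carrier [simp]: "\<one>\<^bsub>V\<^esub> \<in> carrier V"
  using one_even submoduleE(1) [OF part_submodule] by blast

text \<open>
  Each module axiom is one of the clauses of \<open>feq\<close>, read on classes of terms; the additive inverse is
  multiplication by \<open>-1\<close>.
\<close>

lemma module_free_alg: "module K (free_alg K V)"
proof (rule moduleI)
  show "cring K" by (rule module.axioms(1) [OF V.module_axioms])
  show "abelian_group (free_alg K V)"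
  proof (rule abelian_groupI, goal_cases)
    case (6 x)
    then obtain t where t: "t \<in> fterms K V" "x = fclass K V t" by auto
    then have "Scale (\<ominus>\<^bsub>K\<^esub> \<one>\<^bsub>K\<^esub>) t \<in> fterms K V"
      by (simp add: fterms.intros)
    moreover have "fclass K V (Scale (\<ominus>\<^bsub>K\<^esub> \<one>\<^bsub>K\<^esub>) t) \<oplus>\<^bsub>free_alg K V\<^esub> x = \<zero>\<^bsub>free_alg K V\<^esub>"
      using t calculation by (simp add: incl_def fclass_eq_iff fterms.intros feq.Add_minus)
    ultimately show ?case
      by auto
  qed (auto simp: incl_def fterms.intros del: equalityI intro!: fclass_eqI
      intro: feq.Add_assoc feq.Add_comm feq.Add_zero)
qed (auto simp: fterms.intros del: equalityI intro!: fclass_eqI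
    intro: feq.Scale_plus feq.Scale_Add feq.Scale_mult feq.Scale_one)

lemma product_algebra_free_alg: "product_algebra K (free_alg K V)"
proof -
  interpret A: module K "free_alg K V" by (rule module_free_alg)
  show ?thesis
  proof (intro product_algebra.intro product_algebra_axioms.intro module_free_alg)
    show "bilinear_map K (free_alg K V) (carrier (free_alg K V)) (carrier (free_alg K V))
        (nprod (free_alg K V) n)" for n
      unfolding bilinear_map_def
      by (auto simp: fterms.intros intro!: fclass_eqI intro: feq.intros)
    show "\<one>\<^bsub>free_alg K V\<^esub> \<in> part (free_alg K V) 0"
      using one_even by (auto simp: incl_def intro: fterm_parity.intros)
    show "submodule (part (free_alg K V) p) K (free_alg K V)" for p
    proof -
      have add: "\<And>a b. a \<in> part (free_alg K V) p \<Longrightarrow> b \<in> part (free_alg K V) p \<Longrightarrow>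
          a \<oplus>\<^bsub>free_alg K V\<^esub> b \<in> part (free_alg K V) p"
        by (auto simp: fterm_parity_fterms intro!: imageI fterm_parity.intros)
      have scale: "\<And>c a. c \<in> carrier K \<Longrightarrow> a \<in> part (free_alg K V) p \<Longrightarrow>
          c \<odot>\<^bsub>free_alg K V\<^esub> a \<in> part (free_alg K V) p"
        by (auto simp: fterm_parity_fterms intro!: imageI fterm_parity.intros)
      have sub: "part (free_alg K V) p \<subseteq> carrier (free_alg K V)"
        by (auto simp: fterm_parity_fterms)
      have "\<ominus>\<^bsub>free_alg K V\<^esub> a \<in> part (free_alg K V) p" if "a \<in> part (free_alg K V) p" for a
        using scale [OF _ that, of "\<ominus>\<^bsub>K\<^esub> \<one>\<^bsub>K\<^esub>"] A.smult_l_minus [of "\<one>\<^bsub>K\<^esub>" a] subsetD [OF sub that]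
        by (simp del: free_alg_simps)
      moreover have "Gen \<zero>\<^bsub>V\<^esub> \<in> {t. fterm_parity K V p t}"
        using submodule.axioms(1) [OF part_submodule] subgroup.one_closed
        by (fastforce intro: fterm_parity.intros)
      then have "\<zero>\<^bsub>free_alg K V\<^esub> \<in> part (free_alg K V) p"
        by (auto simp: incl_def)
      ultimately show ?thesis
        using sub add scale by (intro A.submoduleI) blast+
    qed
    show "nprod (free_alg K V) n x y \<in> part (free_alg K V) (p + q)"
      if "x \<in> part (free_alg K V) p" "y \<in> part (free_alg K V) q" for n x y p q
    proof -
      obtain s t where st: "fterm_parity K V p s" "x = fclass K V s" "fterm_parity K V q t" "y = fclass K V t"
        using \<open>x \<in> part (free_alg K V) p\<close> \<open>y \<in> part (free_alg K V) q\<close> by auto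
      then have "fterm_parity K V (p + q) (Prod n s t)"
        by (intro fterm_parity.intros)
      then show ?thesis
        using st by (simp add: fterm_parity_fterms)
    qed
  qed
qed

sublocale F: product_algebra K "free_alg K V"
  by (rule product_algebra_free_alg)

lemma incl_closed [simp]: "a \<in> carrier V \<Longrightarrow> incl K V a \<in> carrier (free_alg K V)"
  by (simp add: incl_def fterms.intros)

lemma linear_incl: "linear_map K V (free_alg K V) (incl K V)"
  unfolding linear_map_def
  by (auto simp: incl_def fterms.intros intro!: fclass_eqI intro: feq.intros)

lemma even_incl: "even_map V (free_alg K V) (incl K V)"
  by (auto simp: even_map_def incl_def intro: fterm_parity.intros)

text \<open>
  Inductions over the free algebra in this form need not pass to terms.  The rule is also the
  uniqueness half of the universal property: two homomorphisms that agree on \<open>\<vv>\<close> are equal.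
\<close>

lemma free_alg_induct [consumes 1, case_names incl add smult nprod]:
  assumes "x \<in> carrier (free_alg K V)"
    and "\<And>a. a \<in> carrier V \<Longrightarrow> P (incl K V a)"
    and "\<And>x y. \<lbrakk> x \<in> carrier (free_alg K V); y \<in> carrier (free_alg K V); P x; P y \<rbrakk> \<Longrightarrow>
      P (x \<oplus>\<^bsub>free_alg K V\<^esub> y)"
    and "\<And>c x. \<lbrakk> c \<in> carrier K; x \<in> carrier (free_alg K V); P x \<rbrakk> \<Longrightarrow> P (c \<odot>\<^bsub>free_alg K V\<^esub> x)"
    and "\<And>n x y. \<lbrakk> x \<in> carrier (free_alg K V); y \<in> carrier (free_alg K V); P x; P y \<rbrakk> \<Longrightarrow>
      P (nprod (free_alg K V) n x y)"
  shows "P x"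
proof -
  have "P (fclass K V t)" if "t \<in> fterms K V" for t
    using that
  proof induction
    case (1 a)
    then show ?case using assms(2) by (simp add: incl_def)
  next
    case (2 s t)
    then show ?case using assms(3) [of "fclass K V s" "fclass K V t"] by simp
  next
    case (3 c t)
    then show ?case using assms(4) [of c "fclass K V t"] by simp
  next
    case (4 s t n)
    then show ?case using assms(5) [of "fclass K V s" "fclass K V t" n] by simp
  qed
  then show ?thesis using assms(1) by auto
qed

lemma free_alg_part_induct [consumes 1, case_names incl add smult nprod]:
  assumes "x \<in> part (free_alg K V) p"
    and "\<And>a p. a \<in> part V p \<Longrightarrow> P p (incl K V a)"
    and "\<And>x y p. \<lbrakk> x \<in> part (free_alg K V) p; y \<in> part (free_alg K V) p; P p x; P p y \<rbrakk> \<Longrightarrow>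
      P p (x \<oplus>\<^bsub>free_alg K V\<^esub> y)"
    and "\<And>c x p. \<lbrakk> c \<in> carrier K; x \<in> part (free_alg K V) p; P p x \<rbrakk> \<Longrightarrow> P p (c \<odot>\<^bsub>free_alg K V\<^esub> x)"
    and "\<And>n x y p q. \<lbrakk> x \<in> part (free_alg K V) p; y \<in> part (free_alg K V) q; P p x; P q y \<rbrakk> \<Longrightarrow>
      P (p + q) (nprod (free_alg K V) n x y)"
  shows "P p x"
proof -
  have "P p (fclass K V t)" if "fterm_parity K V p t" for p t
    using that
  proof induction
    case (1 a)
    then show ?case using assms(2) by (simp add: incl_def)
  next
    case (2 p s t)
    then show ?case using assms(3) [of "fclass K V s" p "fclass K V t"] by (simp add: fterm_parity_fterms)
  next
    case (3 c p t)
    then show ?case using assms(4) [of c "fclass K V t" p] by (simp add: fterm_parity_fterms)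
  next
    case (4 p s q t n)
    then show ?case using assms(5) [of "fclass K V s" p "fclass K V t" q n] by (simp add: fterm_parity_fterms)
  qed
  then show ?thesis using assms(1) by auto
qed

end

primrec eval_fterm :: "('k, 'b, 'n) nalg_scheme \<Rightarrow> ('a \<Rightarrow> 'b) \<Rightarrow> ('k, 'a) fterm \<Rightarrow> 'b" where
  "eval_fterm B f (Gen a) = f a"
| "eval_fterm B f (Add s t) = eval_fterm B f s \<oplus>\<^bsub>B\<^esub> eval_fterm B f t"
| "eval_fterm B f (Scale c t) = c \<odot>\<^bsub>B\<^esub> eval_fterm B f t"
| "eval_fterm B f (Prod n s t) = nprod B n (eval_fterm B f s) (eval_fterm B f t)"

text \<open>
  The value on a class of terms is computed on an arbitrary representative;
  \<open>eval_fterm_cong\<close> below shows that the choice does not matter.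
\<close>

definition free_extension :: "('k, 'b, 'n) nalg_scheme \<Rightarrow> ('a \<Rightarrow> 'b) \<Rightarrow> ('k, 'a) fterm set \<Rightarrow> 'b" where
  "free_extension B f X = eval_fterm B f (SOME t. t \<in> X)"

context unital_vector_space
begin

context
  fixes B :: "('a, 'd, 'e) nalg_scheme" and f
  assumes B: "product_algebra K B" and f: "linear_map K V B f"
begin

interpretation B: product_algebra K B by (rule B)

lemma eval_fterm_closed: "t \<in> fterms K V \<Longrightarrow> eval_fterm B f t \<in> carrier B"
  by (induction rule: fterms.induct) (simp_all add: linear_mapD [OF f])

text \<open>
  \<open>feq\<close> only identifies terms that the axioms of a \<open>K\<close>-module with bilinear products and the linearity
  of \<open>f\<close> force to have the same value.
\<close>

lemma eval_fterm_cong: "feq K V s t \<Longrightarrow> eval_fterm B f s = eval_fterm B f t"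
proof (induction rule: feq.induct)
  case (Add_zero t)
  have "f \<zero>\<^bsub>V\<^esub> = \<zero>\<^bsub>B\<^esub>"
    using linear_map_abelian_group_hom [OF V.module_axioms B.module_axioms f]
    by (rule abelian_group_hom.hom_zero)
  then show ?case using Add_zero by (simp add: eval_fterm_closed)
next
  case (Add_minus t)
  have "f \<zero>\<^bsub>V\<^esub> = \<zero>\<^bsub>B\<^esub>"
    using linear_map_abelian_group_hom [OF V.module_axioms B.module_axioms f]
    by (rule abelian_group_hom.hom_zero)
  then show ?case
    using Add_minus by (simp add: eval_fterm_closed B.smult_l_minus B.M.l_neg)
qed (simp_all add: linear_mapD [OF f] eval_fterm_closed B.M.a_ac B.smult_r_distr
    B.smult_l_distr B.smult_assoc1 B.nprod_add_left B.nprod_add_right B.nprod_smult_left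
    B.nprod_smult_right)

lemma free_extension_fclass: "t \<in> fterms K V \<Longrightarrow> free_extension B f (fclass K V t) = eval_fterm B f t"
proof -
  assume t: "t \<in> fterms K V"
  have "(SOME s. s \<in> fclass K V t) \<in> fclass K V t"
    using t by (auto simp: fclass_def intro: feq.refl someI)
  then have "feq K V t (SOME s. s \<in> fclass K V t)"
    by (simp add: fclass_def)
  from eval_fterm_cong [OF this] show ?thesis
    unfolding free_extension_def by (rule HOL.sym)
qed

lemma free_extension_incl: "a \<in> carrier V \<Longrightarrow> free_extension B f (incl K V a) = f a"
  by (simp add: incl_def free_extension_fclass fterms.intros)

text \<open>
  The existence half of the universal property of \<open>F(\<vv>)\<close>.
\<close>

lemma free_extension_hom:
  assumes "even_map V B f" and "f \<one>\<^bsub>V\<^esub> = \<one>\<^bsub>B\<^esub>"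
  shows "product_algebra_hom K (free_alg K V) B (free_extension B f)"
proof
  show lin: "linear_map K (free_alg K V) B (free_extension B f)"
    unfolding linear_map_def by (auto simp: free_extension_fclass eval_fterm_closed fterms.intros)
  show one: "free_extension B f \<one>\<^bsub>free_alg K V\<^esub> = \<one>\<^bsub>B\<^esub>"
    using assms(2) by (simp add: free_extension_incl)
  show prod: "free_extension B f (nprod (free_alg K V) n x y) = nprod B n (free_extension B f x) (free_extension B f y)"
    if "x \<in> carrier (free_alg K V)" "y \<in> carrier (free_alg K V)" for n x y
    using that by (auto simp: free_extension_fclass fterms.intros)
  have "free_extension B f x \<in> part B p" if "x \<in> part (free_alg K V) p" for x p
    using that
  proof (induction rule: free_alg_part_induct)
    case (incl a p)
    then show ?case
      using assms(1) subsetD [OF submoduleE(1) [OF part_submodule] incl]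
      by (auto simp: even_map_def free_extension_incl)
  next
    case (add x y p)
    then have "free_extension B f x \<oplus>\<^bsub>B\<^esub> free_extension B f y \<in> part B p"
      by (intro B.submoduleE(5) [OF B.part_submodule])
    then show ?case
      using linear_mapD(2) [OF lin, OF add(1,2) [THEN subsetD [OF F.part_subset]]] by simp
  next
    case (smult c x p)
    then have "c \<odot>\<^bsub>B\<^esub> free_extension B f x \<in> part B p"
      by (intro B.submoduleE(4) [OF B.part_submodule])
    then show ?case
      using linear_mapD(3) [OF lin, OF smult(1) subsetD [OF F.part_subset smult(2)]] by simp
  next
    case (nprod n x y p q)
    then have "nprod B n (free_extension B f x) (free_extension B f y) \<in> part B (p + q)"
      by (intro B.nprod_part)
    then show ?case
      by (simp only: prod [OF nprod(1,2) [THEN subsetD [OF F.part_subset]]])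
  qed
  then show "even_map (free_alg K V) B (free_extension B f)"
    unfolding even_map_def by blast
qed

end

end

section \<open>The ground field as a commutative vertex algebra\<close>

text \<open>
  The ground field as the simplest vertex algebra: it is purely even, \<open>D = 0\<close>, and only the product
  of index \<open>-1\<close> is nonzero.
\<close>

definition scalar_alg :: "'k ring \<Rightarrow> ('k, 'k) nalg" where
  "scalar_alg K =
    \<lparr> carrier = carrier K, mult = mult K, one = one K, zero = zero K, add = add K,
      smult = mult K,
      part = (\<lambda>p. if p = 0 then carrier K else {\<zero>\<^bsub>K\<^esub>}),
      nprod = (\<lambda>n x y. if n = - 1 then x \<otimes>\<^bsub>K\<^esub> y else \<zero>\<^bsub>K\<^esub>) \<rparr>"

lemma int_binomial_0 [simp]: "int_binomial m 0 = 1"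
  by (simp add: int_binomial_def)

lemma int_binomial_Suc_self [simp]: "int_binomial (int j) (Suc j) = 0"
  by (simp add: int_binomial_def)

context char_zero_field
begin

lemma scalar_alg_simps [simp]:
  "carrier (scalar_alg K) = carrier K"
  "one (scalar_alg K) = one K"
  "zero (scalar_alg K) = zero K"
  "add (scalar_alg K) = add K"
  "smult (scalar_alg K) = mult K"
  "part (scalar_alg K) p = (if p = 0 then carrier K else {\<zero>\<^bsub>K\<^esub>})"
  "nprod (scalar_alg K) n x y = (if n = - 1 then x \<otimes>\<^bsub>K\<^esub> y else \<zero>\<^bsub>K\<^esub>)"
  "deriv (scalar_alg K) x = \<zero>\<^bsub>K\<^esub>"
  by (simp_all add: scalar_alg_def deriv_def)

lemma scalar_alg_a_inv [simp]: "a_inv (scalar_alg K) x = \<ominus>\<^bsub>K\<^esub> x"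
  by (simp add: a_inv_def m_inv_def)

lemma product_algebra_scalar_alg: "product_algebra K (scalar_alg K)"
proof -
  have "abelian_group (scalar_alg K)"
    by (rule abelian_groupI) (auto simp: a_ac intro: l_neg)
  then interpret A: module K "scalar_alg K"
    by (intro moduleI) (auto simp: is_cring l_distr r_distr m_assoc)
  show ?thesis
  proof (intro product_algebra.intro product_algebra_axioms.intro A.module_axioms)
    show "bilinear_map K (scalar_alg K) (carrier (scalar_alg K)) (carrier (scalar_alg K))
        (nprod (scalar_alg K) n)" for n
      by (auto simp: bilinear_map_def l_distr r_distr m_ac)
    show "submodule (part (scalar_alg K) p) K (scalar_alg K)" for p
      by (rule A.submoduleI) auto
  qed (auto split: if_splits)
qed

interpretation S: product_algebra K "scalar_alg K"
  by (rule product_algebra_scalar_alg)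

lemma scalar_alg_add_pow [simp]:
  "[(- 1 :: int)] \<cdot>\<^bsub>scalar_alg K\<^esub> x = \<ominus>\<^bsub>K\<^esub> x" if "x \<in> carrier K"
  using that S.M.add.int_pow_neg [of x 1] S.M.add.int_pow_1 [of x] by simp

lemma scalar_alg_add_pow_zero [simp]:
  "[(n :: int)] \<cdot>\<^bsub>scalar_alg K\<^esub> \<zero>\<^bsub>K\<^esub> = \<zero>\<^bsub>K\<^esub>"
  "[(0 :: int)] \<cdot>\<^bsub>scalar_alg K\<^esub> x = \<zero>\<^bsub>K\<^esub>"
  using S.M.add.int_pow_one [of n] by (simp_all add: add_pow_def)

lemma scalar_alg_deriv_funpow: "x \<in> carrier K \<Longrightarrow> (deriv (scalar_alg K) ^^ k) x = (if k = 0 then x else \<zero>\<^bsub>K\<^esub>)"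
  by (cases k) simp_all

text \<open>
  As \<open>D = 0\<close>, only the term \<open>k = 0\<close> of the sum survives, and only for \<open>n = -1\<close>, where the relation
  reads \<open>xy - yx = 0\<close>.  If the sum is truncated at \<open>L = 0\<close>, then the premise says that this term is
  zero as well.
\<close>

lemma scalar_alg_skew_symmetry: "skew_symmetry_in K (scalar_alg K) M {\<zero>\<^bsub>K\<^esub>}"
  unfolding skew_symmetry_in_def
proof (intro ballI allI impI, goal_cases)
  case (1 n p q x y L)
  then have [simp]: "x \<in> carrier K" "y \<in> carrier K"
    by (auto split: if_splits)
  let ?f = "\<lambda>k. [sgn_of (of_int (n + int k))] \<cdot>\<^bsub>scalar_alg K\<^esub>
    (inv\<^bsub>K\<^esub> ([(fact k :: nat)] \<cdot>\<^bsub>K\<^esub> \<one>\<^bsub>K\<^esub>) \<odot>\<^bsub>scalar_alg K\<^esub>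
      (deriv (scalar_alg K) ^^ k) (nprod (scalar_alg K) (n + int k) y x))"
  have f: "?f k = (if n = - 1 \<and> k = 0 then \<ominus>\<^bsub>K\<^esub> (y \<otimes>\<^bsub>K\<^esub> x) else \<zero>\<^bsub>K\<^esub>)" for k
    using inv_fact_closed [of k]
    by (auto simp: scalar_alg_deriv_funpow sgn_of_def)
  have sum: "(\<Oplus>\<^bsub>scalar_alg K\<^esub> k \<in> {..<L}. ?f k) =
      (if n = - 1 \<and> L \<noteq> 0 then \<ominus>\<^bsub>K\<^esub> (y \<otimes>\<^bsub>K\<^esub> x) else \<zero>\<^bsub>K\<^esub>)"
  proof (cases "L = 0")
    case False
    then show ?thesis
      unfolding f by (subst S.M.finsum_eq_single_term [of _ 0]) auto
  qed simp
  show ?case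
  proof (cases "p = 1 \<and> q = 1")
    case True
    then have "x = \<zero>\<^bsub>K\<^esub>" "y = \<zero>\<^bsub>K\<^esub>"
      using 1(2,3) by auto
    then show ?thesis
      unfolding sum by simp
  next
    case False
    then have sgn: "sgn_of (p * q) = 1"
      by (auto simp: sgn_of_def)
    have "y \<otimes>\<^bsub>K\<^esub> x = \<zero>\<^bsub>K\<^esub>" if "n = - 1" "L = 0"
      using 1(4) [rule_format, of 0] that by simp
    then show ?thesis
      unfolding sum sgn by (auto simp: m_comm [of x y] r_neg)
  qed
qed

text \<open>
  All products \<open>x\<^sub>kz\<close> with \<open>k \<ge> 0\<close> vanish, so the second half of each term is zero.  The first half
  requires \<open>m - k = -1 = n + k\<close>.  For \<open>m \<ge> 0\<close> this means \<open>k = m + 1\<close>, where the binomial coefficient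
  vanishes; the only other solution is \<open>m = n = -1\<close>, \<open>k = 0\<close>, which gives the associative law of the
  field.
\<close>

lemma scalar_alg_associativity: "associativity_in (scalar_alg K) M {\<zero>\<^bsub>K\<^esub>}"
  unfolding associativity_in_def
proof (intro ballI allI impI, goal_cases)
  case (1 m n p q r x y z L)
  then have [simp]: "x \<in> carrier K" "y \<in> carrier K" "z \<in> carrier K"
    by (auto split: if_splits)
  let ?f = "\<lambda>k. [(int_binomial m k * (- 1) ^ k)] \<cdot>\<^bsub>scalar_alg K\<^esub>
    (nprod (scalar_alg K) (m - int k) x (nprod (scalar_alg K) (n + int k) y z) \<ominus>\<^bsub>scalar_alg K\<^esub>
      [sgn_of (of_int m + p * q)] \<cdot>\<^bsub>scalar_alg K\<^esub>
        nprod (scalar_alg K) (m + n - int k) y (nprod (scalar_alg K) (int k) x z))"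
  have f: "?f k = (if m = - 1 \<and> n = - 1 \<and> k = 0 then x \<otimes>\<^bsub>K\<^esub> (y \<otimes>\<^bsub>K\<^esub> z) else \<zero>\<^bsub>K\<^esub>)" for k
  proof (cases "m - int k = - 1 \<and> n + int k = - 1")
    case True
    \<comment> \<open>for \<open>k > 0\<close> the index \<open>m = k - 1\<close> is a natural number below \<open>k\<close>, so the binomial coefficient is zero\<close>
    then have "m = - 1 \<and> n = - 1 \<and> k = 0 \<or> m = int (k - 1) \<and> k = Suc (k - 1)"
      by auto
    then show ?thesis
    proof
      assume "m = int (k - 1) \<and> k = Suc (k - 1)"
      moreover from this have "int_binomial m k = 0"
        by (metis int_binomial_Suc_self)
      moreover have "int (k - 1) \<noteq> - 1"
        by linarith
      ultimately have "int_binomial m k = 0" "m \<noteq> - 1"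
        by metis+
      then show ?thesis
        using True by simp
    qed (simp add: a_minus_def)
  next
    case False
    then show ?thesis
      by (auto simp: a_minus_def)
  qed
  have sum: "(\<Oplus>\<^bsub>scalar_alg K\<^esub> k \<in> {..<L}. ?f k) =
      (if m = - 1 \<and> n = - 1 \<and> L \<noteq> 0 then x \<otimes>\<^bsub>K\<^esub> (y \<otimes>\<^bsub>K\<^esub> z) else \<zero>\<^bsub>K\<^esub>)"
  proof (cases "L = 0")
    case False
    then show ?thesis
      unfolding f by (subst S.M.finsum_eq_single_term [of _ 0]) auto
  qed simp
  have "y \<otimes>\<^bsub>K\<^esub> z = \<zero>\<^bsub>K\<^esub>" if "n = - 1" "L = 0"
    using 1(6) [rule_format, of 0] that by auto
  then show ?case
    unfolding sum by (auto simp: a_minus_def m_assoc r_neg)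
qed

lemma scalar_alg_va_axioms: "va_axioms_in K M (scalar_alg K) {\<zero>\<^bsub>K\<^esub>}"
proof -
  have [simp]: "x \<in> part (scalar_alg K) p \<Longrightarrow> x \<in> carrier K" for x p
    by (auto split: if_splits)
  have [simp]: "\<ominus>\<^bsub>K\<^esub> \<zero>\<^bsub>K\<^esub> = \<zero>\<^bsub>K\<^esub>"
    by simp
  show ?thesis
    unfolding va_axioms_in_def
    by (intro conjI scalar_alg_skew_symmetry scalar_alg_associativity ballI allI)
      (auto simp: a_minus_def r_neg split: if_splits)
qed

end

context unital_vector_space
begin

text \<open>
  Among the subspaces that contain the odd part but not \<open>\<one>\<close> there is a maximal one \<open>W\<close>.  If \<open>x\<close>
  lies outside \<open>W\<close>, then \<open>\<one> \<in> W + Kx\<close> by maximality, so \<open>x\<close> is congruent to a multiple of \<open>\<one>\<close>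
  modulo \<open>W\<close>.  Thus \<open>W\<close> is a hyperplane complementary to \<open>K\<one>\<close>, and the functional with kernel
  \<open>W\<close> is even because \<open>W\<close> contains the odd part.
\<close>

lemma exists_even_unital_functional:
  assumes "char_zero_field K"
  obtains f where "linear_map K V (scalar_alg K) f" "even_map V (scalar_alg K) f"
    "f \<one>\<^bsub>V\<^esub> = \<one>\<^bsub>K\<^esub>"
proof -
  interpret char_zero_field K by fact
  have [simp]: "\<ominus>\<^bsub>V\<^esub> \<zero>\<^bsub>V\<^esub> = \<zero>\<^bsub>V\<^esub>"
    by (rule V.M.minus_equality) simp_all
  let ?\<A> = "{W. submodule W K V \<and> part V 1 \<subseteq> W \<and> \<one>\<^bsub>V\<^esub> \<notin> W}"
  have "part V 1 \<in> ?\<A>"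
    using part_submodule one_even one_not_zero' part_disjoint by blast
  moreover have "\<Union>\<C> \<in> ?\<A>" if \<C>: "\<C> \<noteq> {}" "subset.chain ?\<A> \<C>" for \<C>
  proof -
    have sub: "\<And>W. W \<in> \<C> \<Longrightarrow> submodule W K V \<and> part V 1 \<subseteq> W \<and> \<one>\<^bsub>V\<^esub> \<notin> W"
      using \<C> by (auto simp: subset_chain_def)
    have "submodule (\<Union>\<C>) K V"
    proof (rule V.submoduleI)
      show "\<Union>\<C> \<subseteq> carrier V"
        using sub V.submoduleE(1) by blast
      obtain W where "W \<in> \<C>" using \<C>(1) by blast
      then have "\<zero>\<^bsub>V\<^esub> \<in> W"
        using sub [of W] subgroup.one_closed [of W "add_monoid V"] by (auto simp: submodule_def)
      then show "\<zero>\<^bsub>V\<^esub> \<in> \<Union>\<C>"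
        using \<open>W \<in> \<C>\<close> by blast
      show "\<ominus>\<^bsub>V\<^esub> a \<in> \<Union>\<C>" if "a \<in> \<Union>\<C>" for a
        using that sub V.submoduleE(3) by blast
      show "c \<odot>\<^bsub>V\<^esub> a \<in> \<Union>\<C>" if "c \<in> carrier K" "a \<in> \<Union>\<C>" for c a
        using that sub V.submoduleE(4) by blast
      show "a \<oplus>\<^bsub>V\<^esub> b \<in> \<Union>\<C>" if ab: "a \<in> \<Union>\<C>" "b \<in> \<Union>\<C>" for a b
      proof -
        obtain W W' where W: "W \<in> \<C>" "a \<in> W" "W' \<in> \<C>" "b \<in> W'"
          using ab by blast
        then have "W \<subseteq> W' \<or> W' \<subseteq> W"
          using \<C>(2) by (auto simp: subset_chain_def)
        then have "a \<oplus>\<^bsub>V\<^esub> b \<in> W \<or> a \<oplus>\<^bsub>V\<^esub> b \<in> W'"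
          using W sub V.submoduleE(5) by (meson subsetD)
        then show ?thesis using W by blast
      qed
    qed
    then show ?thesis using sub \<C>(1) by blast
  qed
  ultimately obtain W where W: "W \<in> ?\<A>" and max: "\<forall>X \<in> ?\<A>. W \<subseteq> X \<longrightarrow> X = W"
    using subset_Zorn_nonempty [of ?\<A>] by blast
  then have sub: "submodule W K V" and odd: "part V 1 \<subseteq> W" and one: "\<one>\<^bsub>V\<^esub> \<notin> W"
    by auto
  have W_carrier: "w \<in> carrier V" if "w \<in> W" for w
    using that V.submoduleE(1) [OF sub] by blast
  note W_closed = V.submoduleE(3-5) [OF sub]
  have W_zero: "\<zero>\<^bsub>V\<^esub> \<in> W"
    using sub subgroup.one_closed [of W "add_monoid V"] by (auto simp: submodule_def)
  have ex: "\<exists>c \<in> carrier K. x \<ominus>\<^bsub>V\<^esub> c \<odot>\<^bsub>V\<^esub> \<one>\<^bsub>V\<^esub> \<in> W" if x: "x \<in> carrier V" for x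
  proof (cases "x \<in> W")
    case True
    then show ?thesis
      using x by (intro bexI [of _ "\<zero>\<^bsub>K\<^esub>"]) (simp_all add: a_minus_def)
  next
    case False
    \<comment> \<open>the subspace \<open>W + Kx\<close>, which contains \<open>\<one>\<close> by maximality of \<open>W\<close>\<close>
    let ?X = "{w \<oplus>\<^bsub>V\<^esub> c \<odot>\<^bsub>V\<^esub> x | w c. w \<in> W \<and> c \<in> carrier K}"
    have X: "submodule ?X K V"
    proof (rule V.submoduleI)
      show "?X \<subseteq> carrier V"
        using x W_carrier by auto
      show "\<zero>\<^bsub>V\<^esub> \<in> ?X"
        using x W_zero by (auto intro!: exI [of _ "\<zero>\<^bsub>V\<^esub>"] exI [of _ "\<zero>\<^bsub>K\<^esub>"])
      show "\<ominus>\<^bsub>V\<^esub> a \<in> ?X" if a: "a \<in> ?X" for a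
      proof -
        obtain w c where "a = w \<oplus>\<^bsub>V\<^esub> c \<odot>\<^bsub>V\<^esub> x" "w \<in> W" "c \<in> carrier K" using a by blast
        then show ?thesis
          using x W_carrier W_closed(1)
          by (auto intro!: exI [of _ "\<ominus>\<^bsub>V\<^esub> w"] exI [of _ "\<ominus>\<^bsub>K\<^esub> c"] simp: V.M.minus_add V.smult_l_minus)
      qed
      show "a \<oplus>\<^bsub>V\<^esub> b \<in> ?X" if ab: "a \<in> ?X" "b \<in> ?X" for a b
      proof -
        obtain w c w' c' where "a = w \<oplus>\<^bsub>V\<^esub> c \<odot>\<^bsub>V\<^esub> x" "w \<in> W" "c \<in> carrier K"
          "b = w' \<oplus>\<^bsub>V\<^esub> c' \<odot>\<^bsub>V\<^esub> x" "w' \<in> W" "c' \<in> carrier K" using ab by blast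
        then show ?thesis
          using x W_carrier W_closed(3)
          by (auto intro!: exI [of _ "w \<oplus>\<^bsub>V\<^esub> w'"] exI [of _ "c \<oplus>\<^bsub>K\<^esub> c'"]
              simp: V.M.a_ac V.smult_l_distr)
      qed
      show "d \<odot>\<^bsub>V\<^esub> a \<in> ?X" if d: "d \<in> carrier K" and a: "a \<in> ?X" for d a
      proof -
        obtain w c where "a = w \<oplus>\<^bsub>V\<^esub> c \<odot>\<^bsub>V\<^esub> x" "w \<in> W" "c \<in> carrier K" using a by blast
        then show ?thesis
          using x d W_carrier W_closed(2)
          by (auto intro!: exI [of _ "d \<odot>\<^bsub>V\<^esub> w"] exI [of _ "d \<otimes>\<^bsub>K\<^esub> c"]
              simp: V.smult_r_distr V.smult_assoc1)
      qed
    qed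
    have WX: "W \<subseteq> ?X"
    proof
      fix w assume "w \<in> W"
      then show "w \<in> ?X"
        using x W_carrier by (auto intro!: exI [of _ w] exI [of _ "\<zero>\<^bsub>K\<^esub>"])
    qed
    have xX: "x \<in> ?X"
      using x W_zero by (auto intro!: exI [of _ "\<zero>\<^bsub>V\<^esub>"] exI [of _ "\<one>\<^bsub>K\<^esub>"])
    have "\<one>\<^bsub>V\<^esub> \<in> ?X"
    proof (rule ccontr)
      assume "\<one>\<^bsub>V\<^esub> \<notin> ?X"
      then have "?X \<in> ?\<A>"
        using X subset_trans [OF odd WX] by (intro CollectI conjI)
      from max [rule_format, OF this WX] show False
        using xX False by simp
    qed
    then obtain w c where wc: "\<one>\<^bsub>V\<^esub> = w \<oplus>\<^bsub>V\<^esub> c \<odot>\<^bsub>V\<^esub> x" "w \<in> W" "c \<in> carrier K"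
      by blast
    then have "c \<noteq> \<zero>\<^bsub>K\<^esub>"
      using one x W_carrier by auto
    then have c: "inv\<^bsub>K\<^esub> c \<in> carrier K" "inv\<^bsub>K\<^esub> c \<otimes>\<^bsub>K\<^esub> c = \<one>\<^bsub>K\<^esub>"
      using wc(3) by (simp_all add: field_Units)
    have w: "w \<in> carrier V" using wc W_carrier by blast
    have "inv\<^bsub>K\<^esub> c \<odot>\<^bsub>V\<^esub> \<one>\<^bsub>V\<^esub> = inv\<^bsub>K\<^esub> c \<odot>\<^bsub>V\<^esub> w \<oplus>\<^bsub>V\<^esub> x"
      using wc(3) w x c by (simp add: wc(1) V.smult_r_distr flip: V.smult_assoc1)
    then have "x \<ominus>\<^bsub>V\<^esub> inv\<^bsub>K\<^esub> c \<odot>\<^bsub>V\<^esub> \<one>\<^bsub>V\<^esub> = x \<ominus>\<^bsub>V\<^esub> (inv\<^bsub>K\<^esub> c \<odot>\<^bsub>V\<^esub> w \<oplus>\<^bsub>V\<^esub> x)"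
      by simp
    also have "\<dots> = \<ominus>\<^bsub>V\<^esub> (inv\<^bsub>K\<^esub> c \<odot>\<^bsub>V\<^esub> w)"
      using w x c(1) by (simp add: a_minus_def V.M.minus_add V.M.a_ac V.M.r_neg1 V.M.r_neg2 V.M.r_neg)
    also have "\<dots> \<in> W"
      using wc(2) c(1) W_closed by blast
    finally show ?thesis
      using c(1) by blast
  qed
  have unique: "c = d" if "c \<in> carrier K" "d \<in> carrier K" "x \<in> carrier V"
    "x \<ominus>\<^bsub>V\<^esub> c \<odot>\<^bsub>V\<^esub> \<one>\<^bsub>V\<^esub> \<in> W" "x \<ominus>\<^bsub>V\<^esub> d \<odot>\<^bsub>V\<^esub> \<one>\<^bsub>V\<^esub> \<in> W" for c d x
  proof (rule ccontr)
    assume "c \<noteq> d"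
    let ?e = "d \<ominus>\<^bsub>K\<^esub> c"
    have e: "?e \<in> carrier K" "?e \<noteq> \<zero>\<^bsub>K\<^esub>"
      using that \<open>c \<noteq> d\<close> K.eq_if_minus_zero [of d c] by auto
    have "?e \<odot>\<^bsub>V\<^esub> \<one>\<^bsub>V\<^esub> = (x \<ominus>\<^bsub>V\<^esub> c \<odot>\<^bsub>V\<^esub> \<one>\<^bsub>V\<^esub>) \<oplus>\<^bsub>V\<^esub> \<ominus>\<^bsub>V\<^esub> (x \<ominus>\<^bsub>V\<^esub> d \<odot>\<^bsub>V\<^esub> \<one>\<^bsub>V\<^esub>)"
      using that by (simp add: a_minus_def V.M.minus_add V.M.a_ac V.M.r_neg1 V.M.r_neg2 V.M.r_neg V.smult_l_distr V.smult_l_minus)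
    also have "\<dots> \<in> W"
      using that W_closed by blast
    finally have "inv\<^bsub>K\<^esub> ?e \<odot>\<^bsub>V\<^esub> (?e \<odot>\<^bsub>V\<^esub> \<one>\<^bsub>V\<^esub>) \<in> W"
      using e by (auto intro: W_closed(2) simp: field_Units)
    then show False
      using e one by (simp add: field_Units flip: V.smult_assoc1)
  qed
  define f where "f x = (THE c. c \<in> carrier K \<and> x \<ominus>\<^bsub>V\<^esub> c \<odot>\<^bsub>V\<^esub> \<one>\<^bsub>V\<^esub> \<in> W)" for x
  have f: "f x = c" if "c \<in> carrier K" "x \<in> carrier V" "x \<ominus>\<^bsub>V\<^esub> c \<odot>\<^bsub>V\<^esub> \<one>\<^bsub>V\<^esub> \<in> W" for c x
    unfolding f_def using that unique by blast
  have f': "f x \<in> carrier K" "x \<ominus>\<^bsub>V\<^esub> f x \<odot>\<^bsub>V\<^esub> \<one>\<^bsub>V\<^esub> \<in> W" if "x \<in> carrier V" for x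
    using ex [OF that] f that by auto
  show thesis
  proof
    show "linear_map K V (scalar_alg K) f"
      unfolding linear_map_def
    proof (intro conjI ballI)
      show "f \<in> carrier V \<rightarrow> carrier (scalar_alg K)"
        using f' by simp
      show "f (x \<oplus>\<^bsub>V\<^esub> y) = f x \<oplus>\<^bsub>scalar_alg K\<^esub> f y" if "x \<in> carrier V" "y \<in> carrier V" for x y
      proof -
        have "x \<oplus>\<^bsub>V\<^esub> y \<ominus>\<^bsub>V\<^esub> (f x \<oplus>\<^bsub>K\<^esub> f y) \<odot>\<^bsub>V\<^esub> \<one>\<^bsub>V\<^esub> =
            (x \<ominus>\<^bsub>V\<^esub> f x \<odot>\<^bsub>V\<^esub> \<one>\<^bsub>V\<^esub>) \<oplus>\<^bsub>V\<^esub> (y \<ominus>\<^bsub>V\<^esub> f y \<odot>\<^bsub>V\<^esub> \<one>\<^bsub>V\<^esub>)"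
          using that f' by (simp add: a_minus_def V.M.minus_add V.M.a_ac V.smult_l_distr)
        also have "\<dots> \<in> W"
          by (intro W_closed(3) f' that)
        finally show ?thesis
          using that f' by (simp add: f)
      qed
      show "f (c \<odot>\<^bsub>V\<^esub> x) = c \<odot>\<^bsub>scalar_alg K\<^esub> f x" if "c \<in> carrier K" "x \<in> carrier V" for c x
      proof -
        have "c \<odot>\<^bsub>V\<^esub> x \<ominus>\<^bsub>V\<^esub> (c \<otimes>\<^bsub>K\<^esub> f x) \<odot>\<^bsub>V\<^esub> \<one>\<^bsub>V\<^esub> = c \<odot>\<^bsub>V\<^esub> (x \<ominus>\<^bsub>V\<^esub> f x \<odot>\<^bsub>V\<^esub> \<one>\<^bsub>V\<^esub>)"
          using that f' by (simp add: a_minus_def V.smult_r_distr V.smult_r_minus V.smult_assoc1)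
        also have "\<dots> \<in> W"
          by (intro W_closed(2) f' that)
        finally show ?thesis
          using that f' by (simp add: f)
      qed
    qed
    have "f x = \<zero>\<^bsub>K\<^esub>" if "x \<in> part V 1" for x
      using that odd W_carrier by (intro f) (auto simp: a_minus_def)
    moreover have "f x \<in> carrier K" if "x \<in> part V p" for x p
      using that submoduleE(1) [OF part_submodule] f' by blast
    ultimately show "even_map V (scalar_alg K) f"
      by (auto simp: even_map_def)
    show "f \<one>\<^bsub>V\<^esub> = \<one>\<^bsub>K\<^esub>"
      using W_zero by (intro f) (auto simp: a_minus_def V.M.r_neg)
  qed
qed

text \<open>
  The kernel of the homomorphism to the ground field.  It contains the generators \<open>u\<^sub>nv\<close> with
  \<open>n \<ge> N(u, v)\<close> for every \<open>N\<close>, since \<open>N(u, v) \<ge> 0\<close> excludes the index \<open>-1\<close>.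
\<close>

lemma exists_proper_va_ideal:
  assumes "char_zero_field K"
  obtains J where "nideal K (free_alg K V) J" "va_relations_in K M V N J"
    "incl K V \<one>\<^bsub>V\<^esub> \<notin> J" "\<zero>\<^bsub>free_alg K V\<^esub> \<in> J"
proof -
  interpret C: char_zero_field K by fact
  interpret S: product_algebra K "scalar_alg K" by (rule C.product_algebra_scalar_alg)
  obtain f where f: "linear_map K V (scalar_alg K) f" "even_map V (scalar_alg K) f"
    "f \<one>\<^bsub>V\<^esub> = \<one>\<^bsub>K\<^esub>"
    by (rule exists_even_unital_functional [OF assms])
  interpret h: product_algebra_hom K "free_alg K V" "scalar_alg K" "free_extension (scalar_alg K) f"
    by (rule free_extension_hom [OF S.product_algebra_axioms f(1,2)]) (simp add: f(3))
  have "nideal K (scalar_alg K) {\<zero>\<^bsub>K\<^esub>}"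
    unfolding nideal_def
  proof
    show "submodule {\<zero>\<^bsub>K\<^esub>} K (scalar_alg K)"
      using S.part_submodule [of 1] by simp
  qed simp
  then have "nideal K (free_alg K V) (h.preimage {\<zero>\<^bsub>K\<^esub>})"
    by (rule h.nideal_preimage)
  moreover have "va_relations_in K M V N (h.preimage {\<zero>\<^bsub>K\<^esub>})"
    unfolding va_relations_in_iff
  proof (intro conjI ballI allI impI)
    show "va_axioms_in K M (free_alg K V) (h.preimage {\<zero>\<^bsub>K\<^esub>})"
      by (intro h.va_axioms_preimage assms C.scalar_alg_va_axioms)
    fix u v and n :: int assume *: "u \<in> carrier V" "v \<in> carrier V" "int (N u v) \<le> n"
    then have "n \<noteq> - 1" by auto
    then show "nprod (free_alg K V) n (incl K V u) (incl K V v) \<in> h.preimage {\<zero>\<^bsub>K\<^esub>}"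
      using * by (subst h.preimage_iff) (simp_all add: h.hom_nprod del: free_alg_simps)
  qed
  moreover have "incl K V \<one>\<^bsub>V\<^esub> \<notin> h.preimage {\<zero>\<^bsub>K\<^esub>}"
    using h.hom_one by (simp add: h.preimage_def)
  moreover have "\<zero>\<^bsub>free_alg K V\<^esub> \<in> h.preimage {\<zero>\<^bsub>K\<^esub>}"
    using h.hom_zero by (simp add: h.preimage_def incl_def)
  ultimately show thesis by (rule that)
qed

end

section \<open>Functoriality of the vertex algebra ideal\<close>

text \<open>
  From here on, elements of the free algebra are treated abstractly and not as classes of terms.
\<close>

declare (in unital_vector_space) free_alg_simps [simp del]

lemma (in product_algebra) nideal_Inter:
  assumes "\<J> \<noteq> {}" "\<And>J. J \<in> \<J> \<Longrightarrow> nideal K A J"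
  shows "nideal K A (\<Inter>\<J>)"
proof -
  have sub: "submodule J K A" if "J \<in> \<J>" for J
    using assms(2) [OF that] by (simp add: nideal_def)
  obtain J\<^sub>0 where J\<^sub>0: "J\<^sub>0 \<in> \<J>" using assms(1) by blast
  have "submodule (\<Inter>\<J>) K A"
  proof (rule submoduleI)
    show "\<Inter>\<J> \<subseteq> carrier A"
      using submoduleE(1) [OF sub [OF J\<^sub>0]] J\<^sub>0 by blast
    show "\<zero>\<^bsub>A\<^esub> \<in> \<Inter>\<J>"
      using sub subgroup.one_closed [of _ "add_monoid A"] by (force simp: submodule_def)
  qed (use submoduleE(3-5) [OF sub] in blast)+
  then show ?thesis
    using assms(2) unfolding nideal_def by blast
qed

lemma va_relations_Inter:
  assumes "\<And>J. J \<in> \<J> \<Longrightarrow> va_relations_in K M V N J"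
  shows "va_relations_in K M V N (\<Inter>\<J>)"
  using assms va_axioms_Inter [of \<J> K M "free_alg K V"] unfolding va_relations_in_iff by blast

context unital_vector_space
begin

lemma va_relations_carrier:
  "char_zero_field K \<Longrightarrow> va_relations_in K M V N (carrier (free_alg K V))"
  unfolding va_relations_in_iff using F.va_axioms_carrier by simp

lemma va_ideal_closed:
  assumes "char_zero_field K"
  shows "nideal K (free_alg K V) (va_ideal K M V N)" "va_relations_in K M V N (va_ideal K M V N)"
proof -
  have "carrier (free_alg K V) \<in> {J. nideal K (free_alg K V) J \<and> va_relations_in K M V N J}"
    using va_relations_carrier [OF assms] F.nideal_carrier by simp
  then show "nideal K (free_alg K V) (va_ideal K M V N)"
    unfolding va_ideal_def by (intro F.nideal_Inter) auto
  show "va_relations_in K M V N (va_ideal K M V N)"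
    unfolding va_ideal_def by (intro va_relations_Inter) auto
qed

end

definition free_map ::
  "'k ring \<Rightarrow> ('k, 'b, 'n) svec_scheme \<Rightarrow> ('a \<Rightarrow> 'b) \<Rightarrow> ('k, 'a) fterm set \<Rightarrow> ('k, 'b) fterm set" where
  "free_map K W \<phi> = free_extension (free_alg K W) (\<lambda>a. incl K W (\<phi> a))"

text \<open>
  A morphism of unital vector spaces without the requirement that it be \<open>undefined\<close> outside the
  carrier, so that the parity involution is an instance.
\<close>

locale unital_map = V: unital_vector_space K V + W: unital_vector_space K W
  for K :: "'k ring" and V :: "('k, 'a, 'm) svec_scheme" and W :: "('k, 'b, 'n) svec_scheme" +
  fixes \<phi> :: "'a \<Rightarrow> 'b"
  assumes linear: "linear_map K V W \<phi>"
    and even: "even_map V W \<phi>"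
    and map_one: "\<phi> \<one>\<^bsub>V\<^esub> = \<one>\<^bsub>W\<^esub>"
begin

lemma incl_linear: "linear_map K V (free_alg K W) (\<lambda>a. incl K W (\<phi> a))"
  using linear_mapD [OF linear] linear_mapD [OF W.linear_incl] by (auto simp: linear_map_def)

sublocale hom: product_algebra_hom K "free_alg K V" "free_alg K W" "free_map K W \<phi>"
  unfolding free_map_def
proof (rule V.free_extension_hom [OF W.product_algebra_free_alg incl_linear])
  show "even_map V (free_alg K W) (\<lambda>a. incl K W (\<phi> a))"
    using even W.even_incl unfolding even_map_def by blast
qed (simp add: map_one W.free_alg_simps)

lemma free_map_incl: "a \<in> carrier V \<Longrightarrow> free_map K W \<phi> (incl K V a) = incl K W (\<phi> a)"
  unfolding free_map_def
  by (rule V.free_extension_incl [OF W.product_algebra_free_alg incl_linear])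

lemma map_closed: "a \<in> carrier V \<Longrightarrow> \<phi> a \<in> carrier W"
  using linear by (rule linear_mapD)

lemma free_map_monomials: "x \<in> monomials K V \<Longrightarrow> x \<in> carrier (free_alg K V) \<and> free_map K W \<phi> x \<in> monomials K W"
  by (induction rule: monomials.induct) (auto simp: free_map_incl hom.hom_nprod map_closed intro: monomials.intros)

text \<open>
  The inequality makes every generator \<open>u\<^sub>nv\<close> of the source map to a generator of the target.
\<close>

lemma va_relations_preimage:
  assumes "char_zero_field K"
    and N: "\<And>u v. u \<in> carrier V \<Longrightarrow> v \<in> carrier V \<Longrightarrow> N' (\<phi> u) (\<phi> v) \<le> N u v"
    and J: "va_relations_in K M W N' J"
  shows "va_relations_in K M V N (hom.preimage J)"
  unfolding va_relations_in_iff
proof (intro conjI ballI allI impI)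
  show "va_axioms_in K M (free_alg K V) (hom.preimage J)"
    using J hom.va_axioms_preimage [OF assms(1)] by (simp add: va_relations_in_iff)
  fix u v and n :: int assume *: "u \<in> carrier V" "v \<in> carrier V" "int (N u v) \<le> n"
  then have "int (N' (\<phi> u) (\<phi> v)) \<le> n"
    using N [of u v] by linarith
  then have "nprod (free_alg K W) n (incl K W (\<phi> u)) (incl K W (\<phi> v)) \<in> J"
    using J * map_closed by (simp add: va_relations_in_iff)
  then show "nprod (free_alg K V) n (incl K V u) (incl K V v) \<in> hom.preimage J"
    using * by (subst hom.preimage_iff) (simp_all add: hom.hom_nprod free_map_incl)
qed

text \<open>
  \<open>I(\<vv>)\<close> is the least ideal with its relations, and the preimage of \<open>I(\<vv>')\<close> is one of the competitors.
\<close>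

lemma free_map_va_ideal:
  assumes "char_zero_field K"
    and N: "\<And>u v. u \<in> carrier V \<Longrightarrow> v \<in> carrier V \<Longrightarrow> N' (\<phi> u) (\<phi> v) \<le> N u v"
  shows "free_map K W \<phi> ` va_ideal K M V N \<subseteq> va_ideal K M W N'"
proof -
  have "nideal K (free_alg K V) (hom.preimage (va_ideal K M W N'))"
    by (intro hom.nideal_preimage W.va_ideal_closed assms(1))
  moreover have "va_relations_in K M V N (hom.preimage (va_ideal K M W N'))"
    by (rule va_relations_preimage [where N' = N']) (use assms W.va_ideal_closed in auto)
  ultimately have "va_ideal K M V N \<subseteq> hom.preimage (va_ideal K M W N')"
    unfolding va_ideal_def by blast
  then show ?thesis by (auto simp: hom.preimage_def)
qed

end

section \<open>The parity involution and gradedness\<close>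

text \<open>
  The sign \<open>(-1)\<^sup>p\<close> as an element of the field, where \<open>sgn_of\<close> is an integer.
\<close>

definition parity_scalar :: "'k ring \<Rightarrow> bit \<Rightarrow> 'k" where
  "parity_scalar K p = (if p = 0 then \<one>\<^bsub>K\<^esub> else \<ominus>\<^bsub>K\<^esub> \<one>\<^bsub>K\<^esub>)"

definition parity_involution :: "('k, 'a, 'm) svec_scheme \<Rightarrow> 'a \<Rightarrow> 'a" where
  "parity_involution V x =
    (THE y. \<exists>x\<^sub>0 \<in> part V 0. \<exists>x\<^sub>1 \<in> part V 1. x = x\<^sub>0 \<oplus>\<^bsub>V\<^esub> x\<^sub>1 \<and> y = x\<^sub>0 \<ominus>\<^bsub>V\<^esub> x\<^sub>1)"

context super_vector_space
begin

lemma part_carrier: "x \<in> part V p \<Longrightarrow> x \<in> carrier V"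
  using submoduleE(1) [OF part_submodule] by blast

lemma part_zero [simp]: "\<zero>\<^bsub>V\<^esub> \<in> part V p"
  using part_submodule [of p] subgroup.one_closed [of _ "add_monoid V"] by (auto simp: submodule_def)

lemmas part_closed = submoduleE(3-5) [OF part_submodule]

lemma part_minus_closed: "\<lbrakk> x \<in> part V p; y \<in> part V p \<rbrakk> \<Longrightarrow> x \<ominus>\<^bsub>V\<^esub> y \<in> part V p"
  by (simp add: a_minus_def part_closed)

lemma parity_scalar_closed [simp]: "parity_scalar K p \<in> carrier K"
  by (simp add: parity_scalar_def)

lemma parity_scalar_add: "parity_scalar K (p + q) = parity_scalar K p \<otimes>\<^bsub>K\<^esub> parity_scalar K q"
  by (cases p; cases q) (simp_all add: parity_scalar_def K.l_minus)

lemma zero_minus_zero [simp]: "\<ominus>\<^bsub>V\<^esub> \<zero>\<^bsub>V\<^esub> = \<zero>\<^bsub>V\<^esub>"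
  by (rule V.M.minus_equality) simp_all

lemma part_decompose:
  assumes "x \<in> carrier V"
  obtains x\<^sub>0 x\<^sub>1 where "x\<^sub>0 \<in> part V 0" "x\<^sub>1 \<in> part V 1" "x = x\<^sub>0 \<oplus>\<^bsub>V\<^esub> x\<^sub>1"
  using assms part_sum by (auto simp: set_add_def')

lemma part_decompose_unique:
  assumes "x\<^sub>0 \<in> part V 0" "x\<^sub>1 \<in> part V 1" "y\<^sub>0 \<in> part V 0" "y\<^sub>1 \<in> part V 1"
    and eq: "x\<^sub>0 \<oplus>\<^bsub>V\<^esub> x\<^sub>1 = y\<^sub>0 \<oplus>\<^bsub>V\<^esub> y\<^sub>1"
  shows "x\<^sub>0 = y\<^sub>0 \<and> x\<^sub>1 = y\<^sub>1"
proof -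
  note c [simp] = assms(1-4) [THEN part_carrier]
  have "x\<^sub>0 \<ominus>\<^bsub>V\<^esub> y\<^sub>0 = (x\<^sub>0 \<oplus>\<^bsub>V\<^esub> x\<^sub>1) \<ominus>\<^bsub>V\<^esub> (y\<^sub>0 \<oplus>\<^bsub>V\<^esub> x\<^sub>1)"
    by (simp add: V.M.minus_add_cancel)
  also have "\<dots> = (y\<^sub>1 \<oplus>\<^bsub>V\<^esub> y\<^sub>0) \<ominus>\<^bsub>V\<^esub> (x\<^sub>1 \<oplus>\<^bsub>V\<^esub> y\<^sub>0)"
    unfolding eq by (simp add: V.M.a_comm)
  also have "\<dots> = y\<^sub>1 \<ominus>\<^bsub>V\<^esub> x\<^sub>1"
    by (simp add: V.M.minus_add_cancel)
  finally have "x\<^sub>0 \<ominus>\<^bsub>V\<^esub> y\<^sub>0 \<in> part V 0 \<inter> part V 1"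
    using assms part_minus_closed by (metis IntI)
  then have "x\<^sub>0 \<ominus>\<^bsub>V\<^esub> y\<^sub>0 = \<zero>\<^bsub>V\<^esub>"
    using part_disjoint by blast
  then have "x\<^sub>0 = y\<^sub>0"
    using V.M.eq_if_minus_zero by simp
  then show ?thesis
    using eq by simp
qed

lemma parity_involution_eq:
  assumes "x\<^sub>0 \<in> part V 0" "x\<^sub>1 \<in> part V 1"
  shows "parity_involution V (x\<^sub>0 \<oplus>\<^bsub>V\<^esub> x\<^sub>1) = x\<^sub>0 \<ominus>\<^bsub>V\<^esub> x\<^sub>1"
  unfolding parity_involution_def
proof (rule the_equality)
  fix y
  assume "\<exists>y\<^sub>0\<in>part V 0. \<exists>y\<^sub>1\<in>part V 1. x\<^sub>0 \<oplus>\<^bsub>V\<^esub> x\<^sub>1 = y\<^sub>0 \<oplus>\<^bsub>V\<^esub> y\<^sub>1 \<and> y = y\<^sub>0 \<ominus>\<^bsub>V\<^esub> y\<^sub>1"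
  then show "y = x\<^sub>0 \<ominus>\<^bsub>V\<^esub> x\<^sub>1"
    using part_decompose_unique [OF assms] by metis
qed (use assms in blast)

lemma parity_involution_part:
  assumes "x \<in> part V p"
  shows "parity_involution V x = parity_scalar K p \<odot>\<^bsub>V\<^esub> x"
proof (cases "p = 0")
  case True
  then show ?thesis
    using assms parity_involution_eq [of x "\<zero>\<^bsub>V\<^esub>"] part_carrier [OF assms]
    by (simp add: parity_scalar_def a_minus_def)
next
  case False
  then show ?thesis
    using assms parity_involution_eq [of "\<zero>\<^bsub>V\<^esub>" x] part_carrier [OF assms]
    by (simp add: parity_scalar_def a_minus_def V.smult_l_minus)
qed

lemma linear_parity_involution: "linear_map K V V (parity_involution V)"
  unfolding linear_map_def
proof (intro conjI ballI)
  show "parity_involution V \<in> carrier V \<rightarrow> carrier V"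
  proof
    fix x assume "x \<in> carrier V"
    then show "parity_involution V x \<in> carrier V"
      using part_carrier by (elim part_decompose) (simp add: parity_involution_eq)
  qed
  fix x assume "x \<in> carrier V"
  then obtain x\<^sub>0 x\<^sub>1 where x: "x\<^sub>0 \<in> part V 0" "x\<^sub>1 \<in> part V 1" "x = x\<^sub>0 \<oplus>\<^bsub>V\<^esub> x\<^sub>1"
    by (rule part_decompose)
  note [simp] = x(1,2) [THEN part_carrier]
  show "parity_involution V (x \<oplus>\<^bsub>V\<^esub> y) = parity_involution V x \<oplus>\<^bsub>V\<^esub> parity_involution V y"
    if y_carrier: "y \<in> carrier V" for y
  proof -
    obtain y\<^sub>0 y\<^sub>1 where y: "y\<^sub>0 \<in> part V 0" "y\<^sub>1 \<in> part V 1" "y = y\<^sub>0 \<oplus>\<^bsub>V\<^esub> y\<^sub>1"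
      using y_carrier by (rule part_decompose)
    note [simp] = y(1,2) [THEN part_carrier]
    have "x \<oplus>\<^bsub>V\<^esub> y = (x\<^sub>0 \<oplus>\<^bsub>V\<^esub> y\<^sub>0) \<oplus>\<^bsub>V\<^esub> (x\<^sub>1 \<oplus>\<^bsub>V\<^esub> y\<^sub>1)"
      by (simp add: x(3) y(3) V.M.a_ac)
    then have "parity_involution V (x \<oplus>\<^bsub>V\<^esub> y) = (x\<^sub>0 \<oplus>\<^bsub>V\<^esub> y\<^sub>0) \<ominus>\<^bsub>V\<^esub> (x\<^sub>1 \<oplus>\<^bsub>V\<^esub> y\<^sub>1)"
      using x y by (simp only: parity_involution_eq part_closed)
    then show ?thesis
      using x y by (simp add: parity_involution_eq a_minus_def V.M.minus_add V.M.a_ac)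
  qed
  show "parity_involution V (c \<odot>\<^bsub>V\<^esub> x) = c \<odot>\<^bsub>V\<^esub> parity_involution V x" if "c \<in> carrier K" for c
    using x that
    by (simp add: V.smult_r_distr parity_involution_eq part_closed a_minus_def V.smult_r_minus)
qed

lemma even_parity_involution: "even_map V V (parity_involution V)"
  by (auto simp: even_map_def parity_involution_part part_closed)

lemma parity_involution_graded_subspace:
  assumes A: "graded_subspace K V A" and x: "x \<in> A"
  shows "parity_involution V x \<in> A"
proof -
  have A': "submodule A K V"
    using A by (simp add: graded_subspace_def)
  obtain x\<^sub>0 x\<^sub>1 where x01: "x\<^sub>0 \<in> A" "x\<^sub>0 \<in> part V 0" "x\<^sub>1 \<in> A" "x\<^sub>1 \<in> part V 1" "x = x\<^sub>0 \<oplus>\<^bsub>V\<^esub> x\<^sub>1"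
    using A x unfolding graded_subspace_def set_add_def' by blast
  then show ?thesis
    using V.submoduleE(3,5) [OF A'] by (simp add: parity_involution_eq a_minus_def)
qed

text \<open>
  On homogeneous arguments both sides are \<open>(-1)\<^sup>p\<^sup>+\<^sup>q f(x, y)\<close>; additivity does the rest.  This makes
  the parity involution compatible with the bracket and with the multiplication by \<open>\<aa>\<close>, the latter
  being defined only on \<open>\<aa> \<times> \<ss>\<close>.
\<close>

lemma parity_involution_bilinear:
  assumes f: "bilinear_map K V A B f"
    and A: "graded_subspace K V A" and B: "graded_subspace K V B"
    and f_part: "\<And>x y p q. \<lbrakk> x \<in> A \<inter> part V p; y \<in> B \<inter> part V q \<rbrakk> \<Longrightarrow> f x y \<in> part V (p + q)"
    and x: "x \<in> A" and y: "y \<in> B"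
  shows "parity_involution V (f x y) = f (parity_involution V x) (parity_involution V y)"
proof -
  let ?\<sigma> = "parity_involution V"
  have A': "submodule A K V" and B': "submodule B K V"
    using A B by (simp_all add: graded_subspace_def)
  note closed = V.submoduleE(4,5) [OF A'] V.submoduleE(4,5) [OF B']
  have fD: "\<And>x y. x \<in> A \<Longrightarrow> y \<in> B \<Longrightarrow> f x y \<in> carrier V"
    "\<And>x x' y. x \<in> A \<Longrightarrow> x' \<in> A \<Longrightarrow> y \<in> B \<Longrightarrow> f (x \<oplus>\<^bsub>V\<^esub> x') y = f x y \<oplus>\<^bsub>V\<^esub> f x' y"
    "\<And>x y y'. x \<in> A \<Longrightarrow> y \<in> B \<Longrightarrow> y' \<in> B \<Longrightarrow> f x (y \<oplus>\<^bsub>V\<^esub> y') = f x y \<oplus>\<^bsub>V\<^esub> f x y'"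
    "\<And>c x y. c \<in> carrier K \<Longrightarrow> x \<in> A \<Longrightarrow> y \<in> B \<Longrightarrow> f (c \<odot>\<^bsub>V\<^esub> x) y = c \<odot>\<^bsub>V\<^esub> f x y"
    "\<And>c x y. c \<in> carrier K \<Longrightarrow> x \<in> A \<Longrightarrow> y \<in> B \<Longrightarrow> f x (c \<odot>\<^bsub>V\<^esub> y) = c \<odot>\<^bsub>V\<^esub> f x y"
    using f unfolding bilinear_map_def by blast+
  have hom: "?\<sigma> (f x y) = f (?\<sigma> x) (?\<sigma> y)" if "x \<in> A" "x \<in> part V p" "y \<in> B" "y \<in> part V q" for x y p q
  proof -
    have "f x y \<in> part V (p + q)"
      using that f_part by blast
    then have "?\<sigma> (f x y) = parity_scalar K p \<odot>\<^bsub>V\<^esub> (parity_scalar K q \<odot>\<^bsub>V\<^esub> f x y)"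
      using that by (simp only: parity_involution_part parity_scalar_add V.smult_assoc1
          parity_scalar_closed fD(1))
    also have "\<dots> = f (parity_scalar K p \<odot>\<^bsub>V\<^esub> x) (parity_scalar K q \<odot>\<^bsub>V\<^esub> y)"
      using that by (subst fD(4)) (simp_all add: fD closed)
    also have "\<dots> = f (?\<sigma> x) (?\<sigma> y)"
      using that by (simp add: parity_involution_part)
    finally show ?thesis .
  qed
  note \<sigma>AB = parity_involution_graded_subspace [OF A] parity_involution_graded_subspace [OF B]
  note add = linear_mapD(2) [OF linear_parity_involution]
  obtain x\<^sub>0 x\<^sub>1 where x01: "x\<^sub>0 \<in> A" "x\<^sub>0 \<in> part V 0" "x\<^sub>1 \<in> A" "x\<^sub>1 \<in> part V 1" "x = x\<^sub>0 \<oplus>\<^bsub>V\<^esub> x\<^sub>1"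
    using A x unfolding graded_subspace_def set_add_def' by blast
  obtain y\<^sub>0 y\<^sub>1 where y01: "y\<^sub>0 \<in> B" "y\<^sub>0 \<in> part V 0" "y\<^sub>1 \<in> B" "y\<^sub>1 \<in> part V 1" "y = y\<^sub>0 \<oplus>\<^bsub>V\<^esub> y\<^sub>1"
    using B y unfolding graded_subspace_def set_add_def' by blast
  note c = x01(2,4) [THEN part_carrier] y01(2,4) [THEN part_carrier]
  have "?\<sigma> (f x y) = ?\<sigma> (f x\<^sub>0 y\<^sub>0 \<oplus>\<^bsub>V\<^esub> f x\<^sub>1 y\<^sub>0 \<oplus>\<^bsub>V\<^esub> (f x\<^sub>0 y\<^sub>1 \<oplus>\<^bsub>V\<^esub> f x\<^sub>1 y\<^sub>1))"
    using x01 y01 by (simp add: fD closed)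
  also have "\<dots> = f (?\<sigma> x\<^sub>0) (?\<sigma> y\<^sub>0) \<oplus>\<^bsub>V\<^esub> f (?\<sigma> x\<^sub>1) (?\<sigma> y\<^sub>0) \<oplus>\<^bsub>V\<^esub>
      (f (?\<sigma> x\<^sub>0) (?\<sigma> y\<^sub>1) \<oplus>\<^bsub>V\<^esub> f (?\<sigma> x\<^sub>1) (?\<sigma> y\<^sub>1))"
    using x01 y01 by (simp add: add hom [symmetric] fD)
  also have "\<dots> = f (?\<sigma> x\<^sub>0 \<oplus>\<^bsub>V\<^esub> ?\<sigma> x\<^sub>1) (?\<sigma> y\<^sub>0 \<oplus>\<^bsub>V\<^esub> ?\<sigma> y\<^sub>1)"
    using x01 y01 \<sigma>AB by (simp add: fD closed)
  finally show "?\<sigma> (f x y) = f (?\<sigma> x) (?\<sigma> y)"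
    using x01 y01 c by (simp add: add)
qed

end

context unital_vector_space
begin

lemma unital_map_parity_involution: "unital_map K V V (parity_involution V)"
proof
  show "parity_involution V \<one>\<^bsub>V\<^esub> = \<one>\<^bsub>V\<^esub>"
    using parity_involution_part [OF one_even] by (simp add: parity_scalar_def)
qed (rule linear_parity_involution even_parity_involution)+

interpretation \<sigma>: unital_map K V V "parity_involution V"
  by (rule unital_map_parity_involution)

lemma free_map_parity_involution:
  "x \<in> part (free_alg K V) p \<Longrightarrow>
    free_map K V (parity_involution V) x = parity_scalar K p \<odot>\<^bsub>free_alg K V\<^esub> x"
proof (induction rule: free_alg_part_induct)
  case (incl a p)
  then show ?case
    using linear_mapD(3) [OF linear_incl, of "parity_scalar K p" a] part_carrier [OF incl]
    by (simp add: \<sigma>.free_map_incl parity_involution_part)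
next
  case (add x y p)
  then show ?case
    using F.part_subset [of p] by (simp add: subset_iff F.smult_r_distr)
next
  case (smult c x p)
  then have "x \<in> carrier (free_alg K V)"
    using F.part_subset by blast
  with smult show ?case
    by (simp add: \<sigma>.hom.hom_smult K.m_comm flip: F.smult_assoc1)
next
  case (nprod n x y p q)
  then have "x \<in> carrier (free_alg K V)" "y \<in> carrier (free_alg K V)"
    using F.part_subset by blast+
  then have "nprod (free_alg K V) n (parity_scalar K p \<odot>\<^bsub>free_alg K V\<^esub> x)
      (parity_scalar K q \<odot>\<^bsub>free_alg K V\<^esub> y) =
    parity_scalar K (p + q) \<odot>\<^bsub>free_alg K V\<^esub> nprod (free_alg K V) n x y"
    by (subst F.nprod_smult_left)
      (simp_all only: F.nprod_smult_right parity_scalar_add F.smult_assoc1 parity_scalar_closed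
        F.nprod_closed F.smult_closed)
  with nprod show ?case
    using \<open>x \<in> carrier (free_alg K V)\<close> \<open>y \<in> carrier (free_alg K V)\<close> by (simp only: \<sigma>.hom.hom_nprod)
qed

lemma free_alg_part_carrier: "x \<in> part (free_alg K V) p \<Longrightarrow> x \<in> carrier (free_alg K V)"
  using F.part_subset by blast

lemmas free_alg_part_closed = F.submoduleE(3-5) [OF F.part_submodule]

text \<open>
  The parts of the free algebra are defined by parities of terms, so that the decomposition into
  homogeneous components has to be propagated from \<open>\<vv>\<close> through sums and products.
\<close>

lemma free_alg_decompose:
  "x \<in> carrier (free_alg K V) \<Longrightarrow>
    \<exists>x\<^sub>0 \<in> part (free_alg K V) 0. \<exists>x\<^sub>1 \<in> part (free_alg K V) 1. x = x\<^sub>0 \<oplus>\<^bsub>free_alg K V\<^esub> x\<^sub>1"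
proof (induction rule: free_alg_induct)
  case (incl a)
  then obtain a\<^sub>0 a\<^sub>1 where a: "a\<^sub>0 \<in> part V 0" "a\<^sub>1 \<in> part V 1" "a = a\<^sub>0 \<oplus>\<^bsub>V\<^esub> a\<^sub>1"
    by (rule part_decompose)
  then have "incl K V a = incl K V a\<^sub>0 \<oplus>\<^bsub>free_alg K V\<^esub> incl K V a\<^sub>1"
    using linear_mapD(2) [OF linear_incl] part_carrier by blast
  moreover have "incl K V a\<^sub>0 \<in> part (free_alg K V) 0" "incl K V a\<^sub>1 \<in> part (free_alg K V) 1"
    using a even_incl by (auto simp: even_map_def)
  ultimately show ?case by blast
next
  case (add x y)
  then obtain x\<^sub>0 x\<^sub>1 y\<^sub>0 y\<^sub>1 where *:
    "x\<^sub>0 \<in> part (free_alg K V) 0" "x\<^sub>1 \<in> part (free_alg K V) 1" "x = x\<^sub>0 \<oplus>\<^bsub>free_alg K V\<^esub> x\<^sub>1"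
    "y\<^sub>0 \<in> part (free_alg K V) 0" "y\<^sub>1 \<in> part (free_alg K V) 1" "y = y\<^sub>0 \<oplus>\<^bsub>free_alg K V\<^esub> y\<^sub>1"
    by blast
  then have "x \<oplus>\<^bsub>free_alg K V\<^esub> y =
      (x\<^sub>0 \<oplus>\<^bsub>free_alg K V\<^esub> y\<^sub>0) \<oplus>\<^bsub>free_alg K V\<^esub> (x\<^sub>1 \<oplus>\<^bsub>free_alg K V\<^esub> y\<^sub>1)"
    using *(1,2,4,5) [THEN free_alg_part_carrier] by (simp add: F.M.a_ac)
  then show ?case
    using * free_alg_part_closed(3) by blast
next
  case (smult c x)
  then obtain x\<^sub>0 x\<^sub>1 where *:
    "x\<^sub>0 \<in> part (free_alg K V) 0" "x\<^sub>1 \<in> part (free_alg K V) 1" "x = x\<^sub>0 \<oplus>\<^bsub>free_alg K V\<^esub> x\<^sub>1"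
    by blast
  then have "c \<odot>\<^bsub>free_alg K V\<^esub> x = c \<odot>\<^bsub>free_alg K V\<^esub> x\<^sub>0 \<oplus>\<^bsub>free_alg K V\<^esub> c \<odot>\<^bsub>free_alg K V\<^esub> x\<^sub>1"
    using smult(1) free_alg_part_carrier by (simp add: F.smult_r_distr)
  then show ?case
    using * smult(1) free_alg_part_closed(2) by blast
next
  case (nprod n x y)
  then obtain x\<^sub>0 x\<^sub>1 y\<^sub>0 y\<^sub>1 where *:
    "x\<^sub>0 \<in> part (free_alg K V) 0" "x\<^sub>1 \<in> part (free_alg K V) 1" "x = x\<^sub>0 \<oplus>\<^bsub>free_alg K V\<^esub> x\<^sub>1"
    "y\<^sub>0 \<in> part (free_alg K V) 0" "y\<^sub>1 \<in> part (free_alg K V) 1" "y = y\<^sub>0 \<oplus>\<^bsub>free_alg K V\<^esub> y\<^sub>1"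
    by blast
  let ?p = "nprod (free_alg K V) n"
  have "?p x y = (?p x\<^sub>0 y\<^sub>0 \<oplus>\<^bsub>free_alg K V\<^esub> ?p x\<^sub>1 y\<^sub>1) \<oplus>\<^bsub>free_alg K V\<^esub>
      (?p x\<^sub>0 y\<^sub>1 \<oplus>\<^bsub>free_alg K V\<^esub> ?p x\<^sub>1 y\<^sub>0)"
    using *(1,2,4,5) [THEN free_alg_part_carrier]
    by (simp add: *(3,6) F.nprod_add_left F.nprod_add_right F.M.a_ac)
  moreover have "?p x\<^sub>0 y\<^sub>0 \<oplus>\<^bsub>free_alg K V\<^esub> ?p x\<^sub>1 y\<^sub>1 \<in> part (free_alg K V) 0"
    using F.nprod_part [OF *(1,4), of n] F.nprod_part [OF *(2,5), of n]
    by (intro free_alg_part_closed(3)) simp_all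
  moreover have "?p x\<^sub>0 y\<^sub>1 \<oplus>\<^bsub>free_alg K V\<^esub> ?p x\<^sub>1 y\<^sub>0 \<in> part (free_alg K V) 1"
    using F.nprod_part [OF *(1,5), of n] F.nprod_part [OF *(2,4), of n]
    by (intro free_alg_part_closed(3)) simp_all
  ultimately show ?case by blast
qed

text \<open>
  The projection of \<open>x\<close> to its even component is \<open>(x + \<sigma>x)/2\<close>; division by \<open>2\<close> uses the
  assumption on the characteristic.
\<close>

lemma graded_subspace_if_parity_stable:
  assumes "char_zero_field K" and J: "nideal K (free_alg K V) J"
    and stable: "free_map K V (parity_involution V) ` J \<subseteq> J"
  shows "graded_subspace K (free_alg K V) J"
proof -
  interpret C: char_zero_field K by fact
  have J': "submodule J K (free_alg K V)"
    using J by (simp add: nideal_def)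
  note J_closed = F.submoduleE(3-5) [OF J']
  have "\<exists>x\<^sub>0 \<in> J \<inter> part (free_alg K V) 0. \<exists>x\<^sub>1 \<in> J \<inter> part (free_alg K V) 1.
      x = x\<^sub>0 \<oplus>\<^bsub>free_alg K V\<^esub> x\<^sub>1" if x: "x \<in> J" for x
  proof -
    have "x \<in> carrier (free_alg K V)"
      using F.submoduleE(1) [OF J'] x by blast
    then obtain x\<^sub>0 x\<^sub>1 where *:
      "x\<^sub>0 \<in> part (free_alg K V) 0" "x\<^sub>1 \<in> part (free_alg K V) 1" "x = x\<^sub>0 \<oplus>\<^bsub>free_alg K V\<^esub> x\<^sub>1"
      using free_alg_decompose by blast
    note c [simp] = *(1,2) [THEN free_alg_part_carrier]
    have "free_map K V (parity_involution V) x = x\<^sub>0 \<oplus>\<^bsub>free_alg K V\<^esub> \<ominus>\<^bsub>free_alg K V\<^esub> x\<^sub>1"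
      using *(1,2) [THEN free_map_parity_involution]
      by (simp add: *(3) parity_scalar_def F.smult_l_minus)
    then have "x\<^sub>0 \<oplus>\<^bsub>free_alg K V\<^esub> \<ominus>\<^bsub>free_alg K V\<^esub> x\<^sub>1 \<in> J"
      using stable x by (metis image_subset_iff)
    then have "x \<oplus>\<^bsub>free_alg K V\<^esub> (x\<^sub>0 \<oplus>\<^bsub>free_alg K V\<^esub> \<ominus>\<^bsub>free_alg K V\<^esub> x\<^sub>1) \<in> J"
      using x J_closed(3) by blast
    moreover have "x \<oplus>\<^bsub>free_alg K V\<^esub> (x\<^sub>0 \<oplus>\<^bsub>free_alg K V\<^esub> \<ominus>\<^bsub>free_alg K V\<^esub> x\<^sub>1) =
        (\<one>\<^bsub>K\<^esub> \<oplus>\<^bsub>K\<^esub> \<one>\<^bsub>K\<^esub>) \<odot>\<^bsub>free_alg K V\<^esub> x\<^sub>0"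
      by (simp add: *(3) F.smult_l_distr F.M.a_ac F.M.r_neg F.M.r_neg2 F.M.r_neg1)
    ultimately have two: "(\<one>\<^bsub>K\<^esub> \<oplus>\<^bsub>K\<^esub> \<one>\<^bsub>K\<^esub>) \<odot>\<^bsub>free_alg K V\<^esub> x\<^sub>0 \<in> J"
      by simp
    have "\<one>\<^bsub>K\<^esub> \<oplus>\<^bsub>K\<^esub> \<one>\<^bsub>K\<^esub> \<noteq> \<zero>\<^bsub>K\<^esub>"
      using C.char_zero [of 2] by (simp add: numeral_2_eq_2)
    then have "inv\<^bsub>K\<^esub> (\<one>\<^bsub>K\<^esub> \<oplus>\<^bsub>K\<^esub> \<one>\<^bsub>K\<^esub>) \<in> carrier K"
      "inv\<^bsub>K\<^esub> (\<one>\<^bsub>K\<^esub> \<oplus>\<^bsub>K\<^esub> \<one>\<^bsub>K\<^esub>) \<otimes>\<^bsub>K\<^esub> (\<one>\<^bsub>K\<^esub> \<oplus>\<^bsub>K\<^esub> \<one>\<^bsub>K\<^esub>) = \<one>\<^bsub>K\<^esub>"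
      by (simp_all add: K.field_Units)
    then have x\<^sub>0: "x\<^sub>0 \<in> J"
      using J_closed(2) [OF _ two, of "inv\<^bsub>K\<^esub> (\<one>\<^bsub>K\<^esub> \<oplus>\<^bsub>K\<^esub> \<one>\<^bsub>K\<^esub>)"] by (simp flip: F.smult_assoc1)
    have "x\<^sub>1 = \<ominus>\<^bsub>free_alg K V\<^esub> x\<^sub>0 \<oplus>\<^bsub>free_alg K V\<^esub> x"
      by (simp add: *(3) F.M.r_neg1)
    then have "x\<^sub>1 \<in> J"
      using J_closed x\<^sub>0 x by metis
    then show ?thesis
      using * x\<^sub>0 by blast
  qed
  moreover have "x\<^sub>0 \<oplus>\<^bsub>free_alg K V\<^esub> x\<^sub>1 \<in> J" if "x\<^sub>0 \<in> J" "x\<^sub>1 \<in> J" for x\<^sub>0 x\<^sub>1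
    using J_closed that by blast
  ultimately show ?thesis
    using J' unfolding graded_subspace_def set_add_def' by blast
qed

lemma graded_va_ideal:
  assumes "char_zero_field K"
  shows "graded_subspace K (free_alg K V) (va_ideal K M V (\<lambda>u v. N))"
  by (intro graded_subspace_if_parity_stable assms va_ideal_closed \<sigma>.free_map_va_ideal) simp

end

section \<open>The ideal of a souped-up Lie algebra\<close>

lemma sla_relations_Inter:
  "(\<And>J. J \<in> \<J> \<Longrightarrow> sla_relations_in K S J) \<Longrightarrow> sla_relations_in K S (\<Inter>\<J>)"
  unfolding sla_relations_in_def Let_def by blast

locale sla_map = S: souped_up_lie_algebra K S + T: souped_up_lie_algebra K T + unital_map K S T \<phi>
  for K :: "'k ring" and S :: "('k, 'a, 'm) slie_scheme" and T :: "('k, 'b, 'n) slie_scheme" and \<phi> +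
  assumes map_gpart: "\<phi> ` gpart S \<subseteq> gpart T"
    and map_apart: "\<phi> ` apart S \<subseteq> apart T"
    and map_lie: "\<lbrakk> s \<in> carrier S; t \<in> carrier S \<rbrakk> \<Longrightarrow> \<phi> (lie S s t) = lie T (\<phi> s) (\<phi> t)"
    and map_mult: "\<lbrakk> a \<in> apart S; s \<in> carrier S \<rbrakk> \<Longrightarrow> \<phi> (a \<otimes>\<^bsub>S\<^esub> s) = \<phi> a \<otimes>\<^bsub>T\<^esub> \<phi> s"

context souped_up_lie_algebra
begin

lemma apart_carrier: "a \<in> apart S \<Longrightarrow> a \<in> carrier S"
  using a_subspace V.submoduleE(1) by (auto simp: graded_subspace_def)

lemma lie_closed: "\<lbrakk> s \<in> carrier S; t \<in> carrier S \<rbrakk> \<Longrightarrow> lie S s t \<in> carrier S"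
  using lie_bilinear by (simp add: bilinear_map_def)

lemma mult_closed: "\<lbrakk> a \<in> apart S; s \<in> carrier S \<rbrakk> \<Longrightarrow> a \<otimes>\<^bsub>S\<^esub> s \<in> carrier S"
  using mult_bilinear by (simp add: bilinear_map_def)

lemma monomials_carrier: "x \<in> monomials K S \<Longrightarrow> x \<in> carrier (free_alg K S)"
  by (induction rule: monomials.induct) simp_all

lemma sla_relations_carrier: "sla_relations_in K S (carrier (free_alg K S))"
  unfolding sla_relations_in_def Let_def
  by (auto simp: lie_closed mult_closed monomials_carrier apart_carrier intro!: F.M.minus_closed)

lemma sla_ideal_closed:
  assumes "char_zero_field K"
  shows "nideal K (free_alg K S) (sla_ideal K M S N)"
    "va_relations_in K M S N (sla_ideal K M S N)"
    "sla_relations_in K S (sla_ideal K M S N)"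
proof -
  have "carrier (free_alg K S) \<in>
      {J. nideal K (free_alg K S) J \<and> va_relations_in K M S N J \<and> sla_relations_in K S J}"
    using va_relations_carrier [OF assms] F.nideal_carrier sla_relations_carrier by simp
  then show "nideal K (free_alg K S) (sla_ideal K M S N)"
    unfolding sla_ideal_def by (intro F.nideal_Inter) auto
  show "va_relations_in K M S N (sla_ideal K M S N)"
    unfolding sla_ideal_def by (intro va_relations_Inter) auto
  show "sla_relations_in K S (sla_ideal K M S N)"
    unfolding sla_ideal_def by (intro sla_relations_Inter) auto
qed

lemma va_ideal_subset_sla_ideal: "va_ideal K M S N \<subseteq> sla_ideal K M S N"
  unfolding va_ideal_def sla_ideal_def by blast

end

context sla_map
begin

lemma sla_relations_preimage:
  assumes J: "sla_relations_in K T J"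
  shows "sla_relations_in K S (hom.preimage J)"
proof -
  have a: "\<phi> a \<in> apart T" if "a \<in> apart S" for a
    using that map_apart by blast
  note [simp] = S.lie_closed S.mult_closed S.apart_carrier map_closed hom.hom_minus hom.hom_nprod
    free_map_incl map_lie map_mult a S.mult_a_a
  show ?thesis
    unfolding sla_relations_in_def Let_def
  proof (intro conjI ballI)
    fix s t assume "s \<in> carrier S" "t \<in> carrier S"
    then show "nprod (free_alg K S) 0 (incl K S s) (incl K S t) \<ominus>\<^bsub>free_alg K S\<^esub> incl K S (lie S s t)
        \<in> hom.preimage J"
      using J by (subst hom.preimage_iff) (simp_all add: sla_relations_in_def Let_def)
  next
    fix a s assume "a \<in> apart S" "s \<in> carrier S"
    then show "nprod (free_alg K S) (- 1) (incl K S a) (incl K S s) \<ominus>\<^bsub>free_alg K S\<^esub> incl K S (a \<otimes>\<^bsub>S\<^esub> s)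
        \<in> hom.preimage J"
      using J by (subst hom.preimage_iff) (simp_all add: sla_relations_in_def Let_def)
  next
    fix a b x assume "a \<in> apart S" "b \<in> apart S" "x \<in> monomials K S"
    then show "nprod (free_alg K S) (- 1) (incl K S (a \<otimes>\<^bsub>S\<^esub> b)) x \<ominus>\<^bsub>free_alg K S\<^esub>
        nprod (free_alg K S) (- 1) (incl K S a) (nprod (free_alg K S) (- 1) (incl K S b) x)
        \<in> hom.preimage J"
      using J free_map_monomials [of x]
      by (subst hom.preimage_iff) (simp_all add: sla_relations_in_def Let_def)
  qed
qed

lemma free_map_sla_ideal:
  assumes "char_zero_field K"
    and N: "\<And>u v. u \<in> carrier S \<Longrightarrow> v \<in> carrier S \<Longrightarrow> N' (\<phi> u) (\<phi> v) \<le> N u v"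
  shows "free_map K T \<phi> ` sla_ideal K M S N \<subseteq> sla_ideal K M T N'"
proof -
  have "nideal K (free_alg K S) (hom.preimage (sla_ideal K M T N'))"
    by (intro hom.nideal_preimage T.sla_ideal_closed assms(1))
  moreover have "va_relations_in K M S N (hom.preimage (sla_ideal K M T N'))"
    by (rule va_relations_preimage [where N' = N']) (use assms T.sla_ideal_closed in auto)
  moreover have "sla_relations_in K S (hom.preimage (sla_ideal K M T N'))"
    by (intro sla_relations_preimage T.sla_ideal_closed assms(1))
  ultimately have "sla_ideal K M S N \<subseteq> hom.preimage (sla_ideal K M T N')"
    unfolding sla_ideal_def by blast
  then show ?thesis by (auto simp: hom.preimage_def)
qed

end

context souped_up_lie_algebra
begin

lemma graded_carrier: "graded_subspace K S (carrier S)"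
proof -
  have "carrier S \<inter> part S p = part S p" for p
    using part_carrier by blast
  then show ?thesis
    unfolding graded_subspace_def using part_sum V.carrier_is_submodule by (intro conjI) simp_all
qed

text \<open>
  Bracket and multiplication add parities, and \<open>\<gg>\<close> and \<open>\<aa>\<close> are graded subspaces.
\<close>

lemma sla_map_parity_involution: "sla_map K S S (parity_involution S)"
proof -
  interpret \<sigma>: unital_map K S S "parity_involution S"
    by (rule unital_map_parity_involution)
  show ?thesis
  proof (intro sla_map.intro sla_map_axioms.intro \<sigma>.unital_map_axioms souped_up_lie_algebra_axioms)
    show "parity_involution S (lie S s t) = lie S (parity_involution S s) (parity_involution S t)"
      if "s \<in> carrier S" "t \<in> carrier S" for s t
      using that
      by (intro parity_involution_bilinear [OF lie_bilinear graded_carrier graded_carrier])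
        (blast intro: lie_parity)+
    show "parity_involution S (a \<otimes>\<^bsub>S\<^esub> s) = parity_involution S a \<otimes>\<^bsub>S\<^esub> parity_involution S s"
      if "a \<in> apart S" "s \<in> carrier S" for a s
      using that
      by (intro parity_involution_bilinear [OF mult_bilinear a_subspace graded_carrier])
        (blast intro: mult_parity)+
  qed (use parity_involution_graded_subspace g_subspace a_subspace in blast)+
qed

lemma graded_sla_ideal:
  assumes "char_zero_field K"
  shows "graded_subspace K (free_alg K S) (sla_ideal K M S (\<lambda>s t. N))"
  by (intro graded_subspace_if_parity_stable assms sla_ideal_closed
      sla_map.free_map_sla_ideal [OF sla_map_parity_involution]) simp

end

section \<open>Quotients and induced maps\<close>

context product_algebra
begin

context
  fixes J
  assumes J: "nideal K A J"
begin

lemma nideal_submodule: "submodule J K A"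
  using J by (simp add: nideal_def)

lemma nideal_nprod:
  "\<lbrakk> x \<in> carrier A; y \<in> J \<rbrakk> \<Longrightarrow> nprod A n x y \<in> J"
  "\<lbrakk> x \<in> carrier A; y \<in> J \<rbrakk> \<Longrightarrow> nprod A n y x \<in> J"
  using J by (simp_all add: nideal_def)

lemma abelian_subgroup_nideal: "abelian_subgroup J A"
  by (intro abelian_subgroupI3 M.abelian_group_axioms additive_subgroupI
      submodule.axioms(1) [OF nideal_submodule])

interpretation J: abelian_subgroup J A
  by (rule abelian_subgroup_nideal)

lemma coset_carrier: "carrier (quot_alg A J) = (\<lambda>x. J +>\<^bsub>A\<^esub> x) ` carrier A"
  by (auto simp: quot_alg_def A_RCOSETS_def')

lemma coset_eq_iff:
  assumes "x \<in> carrier A" "y \<in> carrier A"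
  shows "J +>\<^bsub>A\<^esub> x = J +>\<^bsub>A\<^esub> y \<longleftrightarrow> x \<ominus>\<^bsub>A\<^esub> y \<in> J"
  using assms J.a_rcos_module [of y x] J.a_repr_independence' [of x y] J.a_rcos_self [of x]
  by (auto simp: a_minus_def)

lemma coset_mem:
  assumes "x \<in> carrier A" "x' \<in> J +>\<^bsub>A\<^esub> x"
  shows "x' \<in> carrier A" "J +>\<^bsub>A\<^esub> x' = J +>\<^bsub>A\<^esub> x"
  using assms J.a_elemrcos_carrier J.a_repr_independence' by auto

text \<open>
  The operations of \<open>quot_alg\<close> are unions over representatives; for a function that is constant on the
  coset the union collapses to a single value.
\<close>

lemma coset_UN:
  assumes x: "x \<in> carrier A"
    and f: "\<And>x'. \<lbrakk> x' \<in> carrier A; x' \<ominus>\<^bsub>A\<^esub> x \<in> J \<rbrakk> \<Longrightarrow> f x' = f x"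
  shows "(\<Union>x' \<in> J +>\<^bsub>A\<^esub> x. f x') = f x"
proof -
  have "f x' = f x" if "x' \<in> J +>\<^bsub>A\<^esub> x" for x'
    using coset_mem [OF x that] f coset_eq_iff x by auto
  moreover have "x \<in> J +>\<^bsub>A\<^esub> x"
    using x by (rule J.a_rcos_self)
  ultimately show ?thesis by blast
qed

lemma coset_add:
  "\<lbrakk> x \<in> carrier A; y \<in> carrier A \<rbrakk> \<Longrightarrow>
    (J +>\<^bsub>A\<^esub> x) \<oplus>\<^bsub>quot_alg A J\<^esub> (J +>\<^bsub>A\<^esub> y) = J +>\<^bsub>A\<^esub> (x \<oplus>\<^bsub>A\<^esub> y)"
  by (simp add: quot_alg_def J.a_rcos_sum)

lemma coset_smult:
  assumes "c \<in> carrier K" "x \<in> carrier A"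
  shows "c \<odot>\<^bsub>quot_alg A J\<^esub> (J +>\<^bsub>A\<^esub> x) = J +>\<^bsub>A\<^esub> (c \<odot>\<^bsub>A\<^esub> x)"
proof -
  have "J +>\<^bsub>A\<^esub> (c \<odot>\<^bsub>A\<^esub> x') = J +>\<^bsub>A\<^esub> (c \<odot>\<^bsub>A\<^esub> x)" if "x' \<in> carrier A" "x' \<ominus>\<^bsub>A\<^esub> x \<in> J" for x'
  proof -
    have "c \<odot>\<^bsub>A\<^esub> x' \<ominus>\<^bsub>A\<^esub> c \<odot>\<^bsub>A\<^esub> x = c \<odot>\<^bsub>A\<^esub> (x' \<ominus>\<^bsub>A\<^esub> x)"
      using that assms by (simp add: a_minus_def smult_r_distr smult_r_minus)
    then show ?thesis
      using that assms submoduleE(4) [OF nideal_submodule] by (simp add: coset_eq_iff)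
  qed
  then show ?thesis
    using assms by (simp add: quot_alg_def coset_UN)
qed

lemma coset_nprod:
  assumes "x \<in> carrier A" "y \<in> carrier A"
  shows "nprod (quot_alg A J) n (J +>\<^bsub>A\<^esub> x) (J +>\<^bsub>A\<^esub> y) = J +>\<^bsub>A\<^esub> nprod A n x y"
proof -
  have left: "J +>\<^bsub>A\<^esub> nprod A n x' y' = J +>\<^bsub>A\<^esub> nprod A n x y'"
    if "x' \<in> carrier A" "x' \<ominus>\<^bsub>A\<^esub> x \<in> J" "y' \<in> carrier A" for x' y'
  proof -
    have "nprod A n x' y' \<ominus>\<^bsub>A\<^esub> nprod A n x y' = nprod A n (x' \<ominus>\<^bsub>A\<^esub> x) y'"
      using that assms nprod_smult_left [of "\<ominus>\<^bsub>K\<^esub> \<one>\<^bsub>K\<^esub>" x y' n]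
      by (simp add: a_minus_def nprod_add_left smult_l_minus)
    then show ?thesis
      using that assms nideal_nprod by (simp add: coset_eq_iff)
  qed
  have right: "J +>\<^bsub>A\<^esub> nprod A n x y' = J +>\<^bsub>A\<^esub> nprod A n x y"
    if "y' \<in> carrier A" "y' \<ominus>\<^bsub>A\<^esub> y \<in> J" for y'
  proof -
    have "nprod A n x y' \<ominus>\<^bsub>A\<^esub> nprod A n x y = nprod A n x (y' \<ominus>\<^bsub>A\<^esub> y)"
      using that assms nprod_smult_right [of "\<ominus>\<^bsub>K\<^esub> \<one>\<^bsub>K\<^esub>" x y n]
      by (simp add: a_minus_def nprod_add_right smult_l_minus)
    then show ?thesis
      using that assms nideal_nprod by (simp add: coset_eq_iff)
  qed
  have "(\<Union>y' \<in> J +>\<^bsub>A\<^esub> y. J +>\<^bsub>A\<^esub> nprod A n x' y') = J +>\<^bsub>A\<^esub> nprod A n x y"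
    if "x' \<in> carrier A" "x' \<ominus>\<^bsub>A\<^esub> x \<in> J" for x'
    using left [OF that] right assms by (subst coset_UN) (auto dest: coset_mem)
  moreover have "x \<ominus>\<^bsub>A\<^esub> x \<in> J"
    using assms by (simp add: a_minus_def M.r_neg)
  ultimately have "(\<Union>x' \<in> J +>\<^bsub>A\<^esub> x. \<Union>y' \<in> J +>\<^bsub>A\<^esub> y. J +>\<^bsub>A\<^esub> nprod A n x' y') =
      J +>\<^bsub>A\<^esub> nprod A n x y"
    by (subst coset_UN) (simp_all only: assms)
  then show ?thesis
    by (simp add: quot_alg_def)
qed

lemma coset_one: "\<one>\<^bsub>quot_alg A J\<^esub> = J +>\<^bsub>A\<^esub> \<one>\<^bsub>A\<^esub>"
  by (simp add: quot_alg_def)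

lemma coset_part: "part (quot_alg A J) p = (\<lambda>x. J +>\<^bsub>A\<^esub> x) ` part A p"
  by (simp add: quot_alg_def)

lemma quot_alg_closed:
  "\<lbrakk> X \<in> carrier (quot_alg A J); Y \<in> carrier (quot_alg A J) \<rbrakk> \<Longrightarrow>
    X \<oplus>\<^bsub>quot_alg A J\<^esub> Y \<in> carrier (quot_alg A J)"
  "\<lbrakk> c \<in> carrier K; X \<in> carrier (quot_alg A J) \<rbrakk> \<Longrightarrow>
    c \<odot>\<^bsub>quot_alg A J\<^esub> X \<in> carrier (quot_alg A J)"
  "\<lbrakk> X \<in> carrier (quot_alg A J); Y \<in> carrier (quot_alg A J) \<rbrakk> \<Longrightarrow>
    nprod (quot_alg A J) n X Y \<in> carrier (quot_alg A J)"
  "\<one>\<^bsub>quot_alg A J\<^esub> \<in> carrier (quot_alg A J)"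
  "part (quot_alg A J) p \<subseteq> carrier (quot_alg A J)"
  using part_subset
  by (auto simp: coset_carrier coset_add coset_smult coset_nprod coset_one coset_part)

end

end

definition quot_map ::
  "('k, 'a, 'm) nalg_scheme \<Rightarrow> 'a set \<Rightarrow> ('k, 'b, 'n) nalg_scheme \<Rightarrow> 'b set \<Rightarrow> ('a \<Rightarrow> 'b) \<Rightarrow>
   'a set \<Rightarrow> 'b set" where
  "quot_map A J B J' h = (\<lambda>X \<in> carrier (quot_alg A J). J' +>\<^bsub>B\<^esub> h (SOME x. x \<in> X))"

locale quotient_hom = product_algebra_hom +
  fixes J J'
  assumes J: "nideal K A J" and J': "nideal K B J'" and hom_ideal: "h ` J \<subseteq> J'"
begin

lemma quot_map_coset:
  assumes "x \<in> carrier A"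
  shows "quot_map A J B J' h (J +>\<^bsub>A\<^esub> x) = J' +>\<^bsub>B\<^esub> h x"
proof -
  interpret I: abelian_subgroup J A by (rule A.abelian_subgroup_nideal [OF J])
  let ?y = "SOME y. y \<in> J +>\<^bsub>A\<^esub> x"
  have "?y \<in> J +>\<^bsub>A\<^esub> x"
    using I.a_rcos_self [OF assms] by (rule someI)
  then have y: "?y \<in> carrier A" "J +>\<^bsub>A\<^esub> ?y = J +>\<^bsub>A\<^esub> x"
    using A.coset_mem [OF J assms] by blast+
  then have "?y \<ominus>\<^bsub>A\<^esub> x \<in> J"
    using assms by (simp add: A.coset_eq_iff [OF J])
  then have "h ?y \<ominus>\<^bsub>B\<^esub> h x \<in> J'"
    using hom_ideal hom_minus [OF y(1) assms] by (metis image_subset_iff)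
  then have "J' +>\<^bsub>B\<^esub> h ?y = J' +>\<^bsub>B\<^esub> h x"
    using assms y by (simp add: B.coset_eq_iff [OF J'])
  then show ?thesis
    using assms by (simp add: quot_map_def A.coset_carrier [OF J])
qed

lemma quot_map_hom:
  "quot_map A J B J' h \<in> carrier (quot_alg A J) \<rightarrow>\<^sub>E carrier (quot_alg B J')"
  "linear_map K (quot_alg A J) (quot_alg B J') (quot_map A J B J' h)"
  "even_map (quot_alg A J) (quot_alg B J') (quot_map A J B J' h)"
  "quot_map A J B J' h \<one>\<^bsub>quot_alg A J\<^esub> = \<one>\<^bsub>quot_alg B J'\<^esub>"
  "\<lbrakk> X \<in> carrier (quot_alg A J); Y \<in> carrier (quot_alg A J) \<rbrakk> \<Longrightarrow>
    quot_map A J B J' h (nprod (quot_alg A J) n X Y) =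
      nprod (quot_alg B J') n (quot_map A J B J' h X) (quot_map A J B J' h Y)"
proof -
  note [simp] = A.coset_carrier [OF J] B.coset_carrier [OF J'] quot_map_coset
    A.coset_add [OF J] B.coset_add [OF J'] A.coset_smult [OF J] B.coset_smult [OF J']
    A.coset_nprod [OF J] B.coset_nprod [OF J'] A.coset_one [OF J] B.coset_one [OF J']
    A.coset_part [OF J] B.coset_part [OF J']
  have part: "\<And>x p. x \<in> part A p \<Longrightarrow> x \<in> carrier A"
    using A.part_subset by blast
  show maps: "quot_map A J B J' h \<in> carrier (quot_alg A J) \<rightarrow>\<^sub>E carrier (quot_alg B J')"
  proof (rule PiE_I)
    fix X assume "X \<notin> carrier (quot_alg A J)"
    then show "quot_map A J B J' h X = undefined"
      unfolding quot_map_def restrict_def by (rule if_not_P)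
  qed auto
  show "linear_map K (quot_alg A J) (quot_alg B J') (quot_map A J B J' h)"
    unfolding linear_map_def using maps by (auto simp: hom_smult)
  show "even_map (quot_alg A J) (quot_alg B J') (quot_map A J B J' h)"
    by (auto simp: even_map_def part hom_part)
  show "quot_map A J B J' h \<one>\<^bsub>quot_alg A J\<^esub> = \<one>\<^bsub>quot_alg B J'\<^esub>"
    by (simp add: hom_one)
  show "quot_map A J B J' h (nprod (quot_alg A J) n X Y) =
      nprod (quot_alg B J') n (quot_map A J B J' h X) (quot_map A J B J' h Y)"
    if "X \<in> carrier (quot_alg A J)" "Y \<in> carrier (quot_alg A J)"
    using that by (auto simp: hom_nprod)
qed

end

context unital_map
begin

text \<open>
  A map with the required properties has the value \<open>\<phi>(x) + J'\<close> at the coset of \<open>x \<in> \<vv>\<close>, and linearity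
  and multiplicativity determine it on everything generated by \<open>\<vv>\<close>.
\<close>

lemma induced_map_iff:
  assumes J: "nideal K (free_alg K V) J" and J': "nideal K (free_alg K W) J'"
    and ideals: "free_map K W \<phi> ` J \<subseteq> J'"
  shows "induced_map K V J W J' \<phi> \<Phi> \<longleftrightarrow>
    \<Phi> = quot_map (free_alg K V) J (free_alg K W) J' (free_map K W \<phi>)"
proof -
  interpret Q: quotient_hom K "free_alg K V" "free_alg K W" "free_map K W \<phi>" J J'
    by unfold_locales (fact J J' ideals)+
  let ?\<Psi> = "quot_map (free_alg K V) J (free_alg K W) J' (free_map K W \<phi>)"
  note coset = V.F.coset_carrier [OF J] V.F.coset_add [OF J] V.F.coset_smult [OF J]
    V.F.coset_nprod [OF J] W.F.coset_add [OF J'] W.F.coset_smult [OF J'] W.F.coset_nprod [OF J']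
  show ?thesis
  proof
    assume "\<Phi> = ?\<Psi>"
    then show "induced_map K V J W J' \<phi> \<Phi>"
      unfolding induced_map_def Let_def
      using Q.quot_map_hom by (auto simp: Q.quot_map_coset free_map_incl hom.hom_nprod coset)
  next
    assume \<Phi>: "induced_map K V J W J' \<phi> \<Phi>"
    then have maps: "\<Phi> \<in> carrier (quot_alg (free_alg K V) J) \<rightarrow>\<^sub>E carrier (quot_alg (free_alg K W) J')"
      and lin: "linear_map K (quot_alg (free_alg K V) J) (quot_alg (free_alg K W) J') \<Phi>"
      and gen: "\<And>x. x \<in> carrier V \<Longrightarrow>
        \<Phi> (J +>\<^bsub>free_alg K V\<^esub> incl K V x) = J' +>\<^bsub>free_alg K W\<^esub> incl K W (\<phi> x)"
      and prod: "\<And>n x y. x \<in> carrier (free_alg K V) \<Longrightarrow> y \<in> carrier (free_alg K V) \<Longrightarrow>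
        \<Phi> (J +>\<^bsub>free_alg K V\<^esub> nprod (free_alg K V) n x y) =
          nprod (quot_alg (free_alg K W) J') n (\<Phi> (J +>\<^bsub>free_alg K V\<^esub> x)) (\<Phi> (J +>\<^bsub>free_alg K V\<^esub> y))"
      unfolding induced_map_def Let_def by auto
    have "\<Phi> (J +>\<^bsub>free_alg K V\<^esub> x) = J' +>\<^bsub>free_alg K W\<^esub> free_map K W \<phi> x"
      if "x \<in> carrier (free_alg K V)" for x
      using that
    proof (induction rule: V.free_alg_induct)
      case (incl a)
      then show ?case by (simp add: gen free_map_incl)
    next
      case (add x y)
      then show ?case
        using linear_mapD(2) [OF lin, of "J +>\<^bsub>free_alg K V\<^esub> x" "J +>\<^bsub>free_alg K V\<^esub> y"] by (simp add: coset)
    next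
      case (smult c x)
      then show ?case
        using linear_mapD(3) [OF lin, of c "J +>\<^bsub>free_alg K V\<^esub> x"] by (simp add: coset hom.hom_smult)
    next
      case (nprod n x y)
      then show ?case
        by (simp add: prod coset hom.hom_nprod)
    qed
    then show "\<Phi> = ?\<Psi>"
      by (intro extensionalityI [of _ "carrier (quot_alg (free_alg K V) J)"])
        (use maps Q.quot_map_hom(1) in \<open>auto simp: PiE_def coset Q.quot_map_coset\<close>)
  qed
qed

end

lemma (in unital_vector_space) free_map_id:
  assumes "unital_map K V V f" and f: "\<And>a. a \<in> carrier V \<Longrightarrow> f a = a"
    and "x \<in> carrier (free_alg K V)"
  shows "free_map K V f x = x"
proof -
  interpret f: unital_map K V V f by fact
  show ?thesis
    using assms(3)
    by (induction rule: free_alg_induct) (simp_all add: f f.free_map_incl f.hom.hom_smult f.hom.hom_nprod)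
qed

lemma free_map_compose:
  assumes "unital_map K U V f" "unital_map K V W g" "unital_map K U W (compose (carrier U) g f)"
    and "x \<in> carrier (free_alg K U)"
  shows "free_map K W (compose (carrier U) g f) x = free_map K W g (free_map K V f x)"
proof -
  interpret f: unital_map K U V f by fact
  interpret g: unital_map K V W g by fact
  interpret gf: unital_map K U W "compose (carrier U) g f" by fact
  show ?thesis
    using assms(4)
    by (induction rule: f.V.free_alg_induct)
      (simp_all add: f.free_map_incl g.free_map_incl gf.free_map_incl f.map_closed compose_eq
        f.hom.hom_smult g.hom.hom_smult gf.hom.hom_smult
        f.hom.hom_nprod g.hom.hom_nprod gf.hom.hom_nprod)
qed

section \<open>Vertex algebras as quotients of free algebras\<close>

lemma fterms_cong_subset:
  assumes "carrier V = carrier W"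
  shows "t \<in> fterms K V \<Longrightarrow> t \<in> fterms K W"
  by (induction rule: fterms.induct) (auto intro: fterms.intros simp: assms)

lemma feq_cong_imp:
  assumes V: "carrier V = carrier W" "zero V = zero W" "add V = add W" "smult V = smult W"
  shows "feq K V s t \<Longrightarrow> feq K W s t"
proof (induction rule: feq.induct)
qed (use fterms_cong_subset [OF V(1)] in \<open>auto intro: feq.intros simp: V\<close>)

lemma fterm_parity_cong_imp:
  assumes "part V = part W"
  shows "fterm_parity K V p t \<Longrightarrow> fterm_parity K W p t"
  by (induction rule: fterm_parity.induct) (simp_all only: assms fterm_parity.intros)

text \<open>
  Vertex algebras are presented by plain \<open>svec\<close> records, whereas a souped-up Lie algebra is a larger
  record.  The free algebra reads only the components of the underlying unital vector space, so the
  record may be truncated.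
\<close>

lemma free_alg_cong:
  assumes "carrier V = carrier W" "zero V = zero W" "one V = one W" "add V = add W"
    "smult V = smult W" "part V = part W"
  shows "free_alg K V = free_alg K W" "incl K V = incl K W"
proof -
  have "fterms K V = fterms K W"
    using fterms_cong_subset [of V W _ K] fterms_cong_subset [of W V _ K] assms(1) by auto
  moreover have "feq K V = feq K W"
    using feq_cong_imp [of V W K] feq_cong_imp [of W V K] assms by (auto simp: fun_eq_iff)
  moreover have "fterm_parity K V = fterm_parity K W"
    using fterm_parity_cong_imp [of V W K] fterm_parity_cong_imp [of W V K] assms
    by (auto simp: fun_eq_iff)
  ultimately show "free_alg K V = free_alg K W" "incl K V = incl K W"
    using assms by (simp_all add: free_alg_def fclass_def [abs_def] incl_def [abs_def])
qed

lemma svec_truncate_simps: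
  "carrier (svec.truncate V) = carrier V" "mult (svec.truncate V) = mult V"
  "one (svec.truncate V) = one V" "zero (svec.truncate V) = zero V" "add (svec.truncate V) = add V"
  "smult (svec.truncate V) = smult V" "part (svec.truncate V) = part V"
  by (simp_all add: svec.truncate_def)

lemma free_alg_truncate:
  "free_alg K (svec.truncate V) = free_alg K V" "incl K (svec.truncate V) = incl K V"
  by (intro free_alg_cong; simp add: svec_truncate_simps)+

lemma va_ideal_truncate: "va_ideal K M (svec.truncate V) N = va_ideal K M V N"
  by (simp add: va_ideal_def va_relations_in_iff free_alg_truncate svec_truncate_simps)

lemma unital_vector_space_truncate:
  assumes "unital_vector_space K V"
  shows "unital_vector_space K (svec.truncate V)"
proof -
  interpret unital_vector_space K V by fact
  have "module K (svec.truncate V)"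
  proof (rule moduleI)
    show "cring K" by (rule module.axioms(1) [OF V.module_axioms])
    show "abelian_group (svec.truncate V)"
      by (rule abelian_groupI)
        (auto simp: svec_truncate_simps V.M.a_ac intro: V.M.l_neg V.M.a_inv_closed)
  qed (simp_all add: svec_truncate_simps V.smult_l_distr V.smult_r_distr V.smult_assoc1)
  moreover have "submodule (part (svec.truncate V) p) K (svec.truncate V)" for p
    using part_submodule [of p]
    by (simp add: submodule_def submodule_axioms_def subgroup_def m_inv_def svec_truncate_simps)
  ultimately show ?thesis
    using K.field_axioms part_disjoint part_sum one_even one_not_zero'
    by (intro unital_vector_space.intro super_vector_space.intro super_vector_space_axioms.intro
        unital_vector_space_axioms.intro)
      (simp_all add: svec_truncate_simps set_add_def')
qed

lemma (in unital_vector_space) vertex_algebra_quotient: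
  assumes "nideal K (free_alg K V) J" "graded_subspace K (free_alg K V) J"
    "va_ideal K M V N \<subseteq> J" "J \<noteq> carrier (free_alg K V)"
  shows "vertex_algebra K M (quot_alg (free_alg K V) J)"
  unfolding vertex_algebra_def
  using assms unital_vector_space_truncate [OF unital_vector_space_axioms]
  by (intro exI [of _ "svec.truncate V"] exI [of _ N] exI [of _ J])
    (simp add: free_alg_truncate va_ideal_truncate)

section \<open>The categories and the functors\<close>

text \<open>
  All three categories consist of maps between carriers with a property \<open>P\<close> that is stable under
  composition; the laws are those of functions restricted to the carriers.
\<close>

lemma category_of_maps:
  assumes C: "C = \<lparr> Ob = Obs, Hom = (\<lambda>X Y. {f \<in> car X \<rightarrow>\<^sub>E car Y. P X Y f}),
      Id = (\<lambda>X. \<lambda>x \<in> car X. x), Comp = (\<lambda>X Y Z g f. compose (car X) g f) \<rparr>"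
    and Id: "\<And>X. X \<in> Obs \<Longrightarrow> P X X (\<lambda>x \<in> car X. x)"
    and Comp: "\<And>X Y Z f g. \<lbrakk> X \<in> Obs; Y \<in> Obs; Z \<in> Obs; f \<in> car X \<rightarrow>\<^sub>E car Y; g \<in> car Y \<rightarrow>\<^sub>E car Z;
      P X Y f; P Y Z g \<rbrakk> \<Longrightarrow> P X Z (compose (car X) g f)"
  shows "category C"
proof
  fix X Y Z f g
  assume "X \<in> Ob C" "Y \<in> Ob C" "Z \<in> Ob C" "f \<in> Hom C X Y" "g \<in> Hom C Y Z"
  then show "Comp C X Y Z g f \<in> Hom C X Z"
    using Comp [of X Y Z f g] by (auto simp: C compose_def)
next
  fix X Y f
  assume "X \<in> Ob C" "Y \<in> Ob C" "f \<in> Hom C X Y"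
  then show "Comp C X X Y f (Id C X) = f" "Comp C X Y Y (Id C Y) f = f"
    by (auto simp: C compose_def fun_eq_iff PiE_def extensional_def Pi_def)
next
  fix W X Y Z f g h
  assume "W \<in> Ob C" "X \<in> Ob C" "Y \<in> Ob C" "Z \<in> Ob C" "f \<in> Hom C W X" "g \<in> Hom C X Y" "h \<in> Hom C Y Z"
  then show "Comp C W Y Z h (Comp C W X Y g f) = Comp C W X Z (Comp C X Y Z h g) f"
    by (auto simp: C compose_def fun_eq_iff PiE_def Pi_def)
qed (use Id in \<open>auto simp: C\<close>)

lemma linear_map_compose:
  "\<lbrakk> linear_map K U V f; linear_map K V W g; module K U \<rbrakk> \<Longrightarrow> linear_map K U W (compose (carrier U) g f)"
  unfolding linear_map_def
  by (auto simp: compose_def Pi_def module.smult_closed abelian_groupE(1) [OF module.axioms(2)])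

lemma even_map_compose:
  "\<lbrakk> even_map U V f; even_map V W g; \<And>p. part U p \<subseteq> carrier U \<rbrakk> \<Longrightarrow>
    even_map U W (compose (carrier U) g f)"
  unfolding even_map_def by (force simp: compose_def)

context unital_vector_space
begin

lemma identity_map:
  "linear_map K V V (\<lambda>x \<in> carrier V. x)" "even_map V V (\<lambda>x \<in> carrier V. x)"
  by (auto simp: linear_map_def even_map_def part_carrier)

end

lemma category_uVect:
  fixes K :: "'k ring"
  shows "category (uVect K :: (('k, 'a) svec, 'a \<Rightarrow> 'a) cat)"
proof (rule category_of_maps [OF uVect_def])
  fix V :: "('k, 'a) svec"
  assume "V \<in> {V. unital_vector_space K V}"
  then interpret unital_vector_space K V by simp
  show "linear_map K V V (\<lambda>x \<in> carrier V. x) \<and> even_map V V (\<lambda>x \<in> carrier V. x) \<and>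
      (\<lambda>x \<in> carrier V. x) \<one>\<^bsub>V\<^esub> = \<one>\<^bsub>V\<^esub>"
    using identity_map by simp
next
  fix U V W :: "('k, 'a) svec" and f g
  assume "U \<in> {V. unital_vector_space K V}"
  then interpret U: unital_vector_space K U by simp
  assume "linear_map K U V f \<and> even_map U V f \<and> f \<one>\<^bsub>U\<^esub> = \<one>\<^bsub>V\<^esub>"
    "linear_map K V W g \<and> even_map V W g \<and> g \<one>\<^bsub>V\<^esub> = \<one>\<^bsub>W\<^esub>"
  then show "linear_map K U W (compose (carrier U) g f) \<and> even_map U W (compose (carrier U) g f) \<and>
      compose (carrier U) g f \<one>\<^bsub>U\<^esub> = \<one>\<^bsub>W\<^esub>"
    using U.V.module_axioms U.part_carrier
    by (auto simp: compose_eq intro!: linear_map_compose even_map_compose)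
qed

lemma category_SLA:
  fixes K :: "'k ring"
  shows "category (SLA K :: (('k, 'a) slie, 'a \<Rightarrow> 'a) cat)"
proof (rule category_of_maps [OF SLA_def])
  fix S :: "('k, 'a) slie"
  assume "S \<in> {S. souped_up_lie_algebra K S}"
  then interpret souped_up_lie_algebra K S by simp
  have "gpart S \<subseteq> carrier S"
    using g_subspace V.submoduleE(1) by (auto simp: graded_subspace_def)
  then show "linear_map K S S (\<lambda>x \<in> carrier S. x) \<and> even_map S S (\<lambda>x \<in> carrier S. x) \<and>
      (\<lambda>x \<in> carrier S. x) ` gpart S \<subseteq> gpart S \<and> (\<lambda>x \<in> carrier S. x) ` apart S \<subseteq> apart S \<and>
      (\<lambda>x \<in> carrier S. x) \<one>\<^bsub>S\<^esub> = \<one>\<^bsub>S\<^esub> \<and>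
      (\<forall>s \<in> carrier S. \<forall>t \<in> carrier S. (\<lambda>x \<in> carrier S. x) (lie S s t) =
        lie S ((\<lambda>x \<in> carrier S. x) s) ((\<lambda>x \<in> carrier S. x) t)) \<and>
      (\<forall>a \<in> apart S. \<forall>s \<in> carrier S. (\<lambda>x \<in> carrier S. x) (a \<otimes>\<^bsub>S\<^esub> s) =
        (\<lambda>x \<in> carrier S. x) a \<otimes>\<^bsub>S\<^esub> (\<lambda>x \<in> carrier S. x) s)"
    using identity_map by (auto simp: lie_closed mult_closed apart_carrier)
next
  fix R S T :: "('k, 'a) slie" and f g
  assume "R \<in> {S. souped_up_lie_algebra K S}"
  then interpret R: souped_up_lie_algebra K R by simp
  have gpart_carrier: "x \<in> carrier R" if "x \<in> gpart R" for x
    using that R.g_subspace R.V.submoduleE(1) by (auto simp: graded_subspace_def)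
  assume maps: "f \<in> carrier R \<rightarrow>\<^sub>E carrier S"
    and f: "linear_map K R S f \<and> even_map R S f \<and>
        f ` gpart R \<subseteq> gpart S \<and> f ` apart R \<subseteq> apart S \<and> f \<one>\<^bsub>R\<^esub> = \<one>\<^bsub>S\<^esub> \<and>
        (\<forall>s \<in> carrier R. \<forall>t \<in> carrier R. f (lie R s t) = lie S (f s) (f t)) \<and>
        (\<forall>a \<in> apart R. \<forall>s \<in> carrier R. f (a \<otimes>\<^bsub>R\<^esub> s) = f a \<otimes>\<^bsub>S\<^esub> f s)"
    and g: "linear_map K S T g \<and> even_map S T g \<and>
        g ` gpart S \<subseteq> gpart T \<and> g ` apart S \<subseteq> apart T \<and> g \<one>\<^bsub>S\<^esub> = \<one>\<^bsub>T\<^esub> \<and>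
        (\<forall>s \<in> carrier S. \<forall>t \<in> carrier S. g (lie S s t) = lie T (g s) (g t)) \<and>
        (\<forall>a \<in> apart S. \<forall>s \<in> carrier S. g (a \<otimes>\<^bsub>S\<^esub> s) = g a \<otimes>\<^bsub>T\<^esub> g s)"
  have "linear_map K R T (compose (carrier R) g f)" "even_map R T (compose (carrier R) g f)"
    using f g R.V.module_axioms R.part_carrier by (auto intro!: linear_map_compose even_map_compose)
  moreover have "\<And>x. x \<in> carrier R \<Longrightarrow> f x \<in> carrier S"
    using maps by auto
  moreover have images: "f ` gpart R \<subseteq> gpart S" "g ` gpart S \<subseteq> gpart T"
      "f ` apart R \<subseteq> apart S" "g ` apart S \<subseteq> apart T"
    using f g by simp_all
  moreover have "g (f x) \<in> gpart T" if "x \<in> gpart R" for x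
    using images(1,2) that by blast
  moreover have "f a \<in> apart S" "g (f a) \<in> apart T" if "a \<in> apart R" for a
    using images(3,4) that by blast+
  ultimately show "linear_map K R T (compose (carrier R) g f) \<and> even_map R T (compose (carrier R) g f) \<and>
      compose (carrier R) g f ` gpart R \<subseteq> gpart T \<and> compose (carrier R) g f ` apart R \<subseteq> apart T \<and>
      compose (carrier R) g f \<one>\<^bsub>R\<^esub> = \<one>\<^bsub>T\<^esub> \<and>
      (\<forall>s \<in> carrier R. \<forall>t \<in> carrier R. compose (carrier R) g f (lie R s t) =
        lie T (compose (carrier R) g f s) (compose (carrier R) g f t)) \<and>
      (\<forall>a \<in> apart R. \<forall>s \<in> carrier R. compose (carrier R) g f (a \<otimes>\<^bsub>R\<^esub> s) =
        compose (carrier R) g f a \<otimes>\<^bsub>T\<^esub> compose (carrier R) g f s)"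
    using f g by (auto simp: compose_eq gpart_carrier R.lie_closed R.mult_closed R.apart_carrier)
qed

lemma vertex_algebra_closed:
  assumes "vertex_algebra K M A"
  shows "\<lbrakk> x \<in> carrier A; y \<in> carrier A \<rbrakk> \<Longrightarrow> x \<oplus>\<^bsub>A\<^esub> y \<in> carrier A"
    "\<lbrakk> c \<in> carrier K; x \<in> carrier A \<rbrakk> \<Longrightarrow> c \<odot>\<^bsub>A\<^esub> x \<in> carrier A"
    "\<lbrakk> x \<in> carrier A; y \<in> carrier A \<rbrakk> \<Longrightarrow> nprod A n x y \<in> carrier A"
    "\<one>\<^bsub>A\<^esub> \<in> carrier A"
    "part A p \<subseteq> carrier A"
proof -
  from assms obtain V :: "('a, 'b) svec" and J where V: "unital_vector_space K V"
    and J: "nideal K (free_alg K V) J" and A: "A = quot_alg (free_alg K V) J"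
    unfolding vertex_algebra_def by blast
  interpret unital_vector_space K V by (rule V)
  show "\<lbrakk> x \<in> carrier A; y \<in> carrier A \<rbrakk> \<Longrightarrow> x \<oplus>\<^bsub>A\<^esub> y \<in> carrier A"
    "\<lbrakk> c \<in> carrier K; x \<in> carrier A \<rbrakk> \<Longrightarrow> c \<odot>\<^bsub>A\<^esub> x \<in> carrier A"
    "\<lbrakk> x \<in> carrier A; y \<in> carrier A \<rbrakk> \<Longrightarrow> nprod A n x y \<in> carrier A"
    "\<one>\<^bsub>A\<^esub> \<in> carrier A"
    "part A p \<subseteq> carrier A"
    unfolding A by (rule F.quot_alg_closed [OF J]; assumption)+
qed

lemma category_VA: "category (VA K M)"
proof (rule category_of_maps [OF VA_def])
  fix A :: "('a, ('a, 'b) fterm set set) nalg"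
  assume "A \<in> {A. vertex_algebra K M A}"
  then have "vertex_algebra K M A" by simp
  note closed = vertex_algebra_closed [OF this]
  show "linear_map K A A (\<lambda>x \<in> carrier A. x) \<and> even_map A A (\<lambda>x \<in> carrier A. x) \<and>
      (\<lambda>x \<in> carrier A. x) \<one>\<^bsub>A\<^esub> = \<one>\<^bsub>A\<^esub> \<and>
      (\<forall>n. \<forall>x \<in> carrier A. \<forall>y \<in> carrier A. (\<lambda>x \<in> carrier A. x) (nprod A n x y) =
        nprod A n ((\<lambda>x \<in> carrier A. x) x) ((\<lambda>x \<in> carrier A. x) y))"
    using closed(5) by (auto simp: linear_map_def even_map_def closed(1-4) subset_iff)
next
  fix A B C :: "('a, ('a, 'b) fterm set set) nalg" and f g
  assume "A \<in> {A. vertex_algebra K M A}"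
  then have "vertex_algebra K M A" by simp
  note closed = vertex_algebra_closed [OF this]
  assume maps: "f \<in> carrier A \<rightarrow>\<^sub>E carrier B"
    and f: "linear_map K A B f \<and> even_map A B f \<and> f \<one>\<^bsub>A\<^esub> = \<one>\<^bsub>B\<^esub> \<and>
        (\<forall>n. \<forall>x \<in> carrier A. \<forall>y \<in> carrier A. f (nprod A n x y) = nprod B n (f x) (f y))"
    and g: "linear_map K B C g \<and> even_map B C g \<and> g \<one>\<^bsub>B\<^esub> = \<one>\<^bsub>C\<^esub> \<and>
        (\<forall>n. \<forall>x \<in> carrier B. \<forall>y \<in> carrier B. g (nprod B n x y) = nprod C n (g x) (g y))"
  have "\<And>x. x \<in> carrier A \<Longrightarrow> f x \<in> carrier B"
    using maps by auto
  moreover have "linear_map K A C (compose (carrier A) g f)"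
    using f g maps unfolding linear_map_def by (auto simp: compose_eq closed(1,2) Pi_def)
  moreover have "even_map A C (compose (carrier A) g f)"
    using f g closed(5) by (auto intro: even_map_compose)
  ultimately show "linear_map K A C (compose (carrier A) g f) \<and> even_map A C (compose (carrier A) g f) \<and>
      compose (carrier A) g f \<one>\<^bsub>A\<^esub> = \<one>\<^bsub>C\<^esub> \<and>
      (\<forall>n. \<forall>x \<in> carrier A. \<forall>y \<in> carrier A. compose (carrier A) g f (nprod A n x y) =
        nprod C n (compose (carrier A) g f x) (compose (carrier A) g f y))"
    using f g by (auto simp: compose_eq closed(3,4))
qed

text \<open>
  The common part of both functors.  Since \<open>induced_map_iff\<close> gives the induced map explicitly,
  functoriality reduces to that of the extension to free algebras.
\<close>

lemma quotient_functor:
  fixes C :: "(('k, 'a, 'm) svec_scheme, 'a \<Rightarrow> 'a) cat"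
    and I :: "('k, 'a, 'm) svec_scheme \<Rightarrow> ('k, 'a) fterm set set"
  assumes C: "category C"
    and C_Id: "\<And>X. Id C X = (\<lambda>x \<in> carrier X. x)"
    and C_Comp: "\<And>X Y Z f g. Comp C X Y Z g f = compose (carrier X) g f"
    and ideal: "\<And>X. X \<in> Ob C \<Longrightarrow> nideal K (free_alg K X) (I X)"
    and vertex: "\<And>X. X \<in> Ob C \<Longrightarrow> vertex_algebra K M (quot_alg (free_alg K X) (I X))"
    and map: "\<And>X Y f. \<lbrakk> X \<in> Ob C; Y \<in> Ob C; f \<in> Hom C X Y \<rbrakk> \<Longrightarrow> unital_map K X Y f"
    and map_ideal: "\<And>X Y f. \<lbrakk> X \<in> Ob C; Y \<in> Ob C; f \<in> Hom C X Y \<rbrakk> \<Longrightarrow>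
      free_map K Y f ` I X \<subseteq> I Y"
  shows "\<lbrakk> X \<in> Ob C; Y \<in> Ob C; f \<in> Hom C X Y \<rbrakk> \<Longrightarrow> \<exists>!\<Phi>. induced_map K X (I X) Y (I Y) f \<Phi>"
    and "cat_functor C (VA K M) (\<lambda>X. quot_alg (free_alg K X) (I X))
      (\<lambda>X Y f. THE \<Phi>. induced_map K X (I X) Y (I Y) f \<Phi>)"
proof -
  define Q where "Q X Y f = quot_map (free_alg K X) (I X) (free_alg K Y) (I Y) (free_map K Y f)"
    for X Y f
  have induced: "induced_map K X (I X) Y (I Y) f \<Phi> \<longleftrightarrow> \<Phi> = Q X Y f"
    if "X \<in> Ob C" "Y \<in> Ob C" "f \<in> Hom C X Y" for X Y f \<Phi>
    unfolding Q_def using that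
    by (intro unital_map.induced_map_iff [OF map] ideal map_ideal)
  then show "\<exists>!\<Phi>. induced_map K X (I X) Y (I Y) f \<Phi>" if "X \<in> Ob C" "Y \<in> Ob C" "f \<in> Hom C X Y"
    using that by simp
  have The: "(THE \<Phi>. induced_map K X (I X) Y (I Y) f \<Phi>) = Q X Y f"
    if "X \<in> Ob C" "Y \<in> Ob C" "f \<in> Hom C X Y" for X Y f
    using induced [OF that] by simp
  have Q: "quotient_hom K (free_alg K X) (free_alg K Y) (free_map K Y f) (I X) (I Y)"
    if "X \<in> Ob C" "Y \<in> Ob C" "f \<in> Hom C X Y" for X Y f
  proof -
    interpret unital_map K X Y f using that by (rule map)
    show ?thesis
      by unfold_locales (use that ideal map_ideal in blast)+
  qed
  interpret C: category C by (rule C)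
  show "cat_functor C (VA K M) (\<lambda>X. quot_alg (free_alg K X) (I X))
      (\<lambda>X Y f. THE \<Phi>. induced_map K X (I X) Y (I Y) f \<Phi>)"
  proof (intro cat_functor.intro cat_functor_axioms.intro C category_VA)
    fix X assume X: "X \<in> Ob C"
    then show "quot_alg (free_alg K X) (I X) \<in> Ob (VA K M)"
      using vertex by (simp add: VA_def)
    note Id = C.Id_in_Hom [OF X]
    interpret unital_map K X X "Id C X"
      using X Id by (intro map)
    interpret Q: quotient_hom K "free_alg K X" "free_alg K X" "free_map K X (Id C X)" "I X" "I X"
      using X Id by (intro Q)
    have "Q X X (Id C X) = (\<lambda>x \<in> carrier (quot_alg (free_alg K X) (I X)). x)"
    proof (rule extensionalityI [of _ "carrier (quot_alg (free_alg K X) (I X))"])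
      show "Q X X (Id C X) \<in> extensional (carrier (quot_alg (free_alg K X) (I X)))"
        using Q.quot_map_hom(1) by (simp add: Q_def PiE_def)
      fix c assume "c \<in> carrier (quot_alg (free_alg K X) (I X))"
      then obtain x where "x \<in> carrier (free_alg K X)" "c = I X +>\<^bsub>free_alg K X\<^esub> x"
        using V.F.coset_carrier [OF ideal [OF X]] by blast
      moreover from this have "free_map K X (Id C X) x = x"
        by (intro V.free_map_id unital_map_axioms) (simp add: C_Id)
      ultimately show "Q X X (Id C X) c = (\<lambda>x \<in> carrier (quot_alg (free_alg K X) (I X)). x) c"
        using \<open>c \<in> _\<close> by (simp add: Q_def Q.quot_map_coset)
    qed simp
    then show "(THE \<Phi>. induced_map K X (I X) X (I X) (Id C X) \<Phi>) =
        Id (VA K M) (quot_alg (free_alg K X) (I X))"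
      by (simp add: The [OF X X Id] VA_def)
  next
    fix X Y f assume f: "X \<in> Ob C" "Y \<in> Ob C" "f \<in> Hom C X Y"
    interpret Q: quotient_hom K "free_alg K X" "free_alg K Y" "free_map K Y f" "I X" "I Y"
      using f by (rule Q)
    show "(THE \<Phi>. induced_map K X (I X) Y (I Y) f \<Phi>) \<in>
        Hom (VA K M) (quot_alg (free_alg K X) (I X)) (quot_alg (free_alg K Y) (I Y))"
      unfolding The [OF f] unfolding Q_def VA_def using Q.quot_map_hom by simp
  next
    fix X Y Z f g
    assume f: "X \<in> Ob C" "Y \<in> Ob C" "f \<in> Hom C X Y" and Z: "Z \<in> Ob C" and g: "g \<in> Hom C Y Z"
    note gf = C.Comp_in_Hom [OF f(1,2) Z f(3) g]
    interpret f: quotient_hom K "free_alg K X" "free_alg K Y" "free_map K Y f" "I X" "I Y"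
      using f by (rule Q)
    interpret g: quotient_hom K "free_alg K Y" "free_alg K Z" "free_map K Z g" "I Y" "I Z"
      using f(2) Z g by (rule Q)
    interpret gf: quotient_hom K "free_alg K X" "free_alg K Z" "free_map K Z (Comp C X Y Z g f)" "I X" "I Z"
      using f(1) Z gf by (rule Q)
    have "Q X Z (Comp C X Y Z g f) = compose (carrier (quot_alg (free_alg K X) (I X))) (Q Y Z g) (Q X Y f)"
    proof (rule extensionalityI [of _ "carrier (quot_alg (free_alg K X) (I X))"])
      show "Q X Z (Comp C X Y Z g f) \<in> extensional (carrier (quot_alg (free_alg K X) (I X)))"
        using gf.quot_map_hom(1) by (simp add: Q_def PiE_def)
      fix c assume c: "c \<in> carrier (quot_alg (free_alg K X) (I X))"
      then obtain x where x: "x \<in> carrier (free_alg K X)" "c = I X +>\<^bsub>free_alg K X\<^esub> x"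
        using f.A.coset_carrier [OF ideal [OF f(1)]] by blast
      moreover from this have "free_map K Z (Comp C X Y Z g f) x = free_map K Z g (free_map K Y f x)"
        unfolding C_Comp
        by (intro free_map_compose map f Z g gf [unfolded C_Comp])
      ultimately show "Q X Z (Comp C X Y Z g f) c =
          compose (carrier (quot_alg (free_alg K X) (I X))) (Q Y Z g) (Q X Y f) c"
        using c by (simp add: Q_def compose_eq f.quot_map_coset g.quot_map_coset gf.quot_map_coset)
    qed simp
    then show "(THE \<Phi>. induced_map K X (I X) Z (I Z) (Comp C X Y Z g f) \<Phi>) =
        Comp (VA K M) (quot_alg (free_alg K X) (I X)) (quot_alg (free_alg K Y) (I Y))
          (quot_alg (free_alg K Z) (I Z)) (THE \<Phi>. induced_map K Y (I Y) Z (I Z) g \<Phi>)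
          (THE \<Phi>. induced_map K X (I X) Y (I Y) f \<Phi>)"
      by (simp add: The [OF f] The [OF f(2) Z g] The [OF f(1) Z gf] VA_def)
  qed
qed

text \<open>
  The second claim is stated for the unital vector space alone because it is also what turns
  \<open>I(\<ss>) \<inter> \<ss> = {0}\<close> into properness of \<open>I(\<ss>)\<close>.
\<close>

lemma va_ideal_proper:
  assumes "char_zero_field K" "unital_vector_space K V"
  shows "va_ideal K M V N \<noteq> carrier (free_alg K V)" "incl K V \<one>\<^bsub>V\<^esub> \<noteq> \<zero>\<^bsub>free_alg K V\<^esub>"
proof -
  interpret unital_vector_space K V by fact
  obtain J where J: "nideal K (free_alg K V) J" "va_relations_in K M V N J"
    "incl K V \<one>\<^bsub>V\<^esub> \<notin> J" "\<zero>\<^bsub>free_alg K V\<^esub> \<in> J"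
    by (rule exists_proper_va_ideal [OF assms(1)])
  then have "va_ideal K M V N \<subseteq> J"
    unfolding va_ideal_def by blast
  then show "va_ideal K M V N \<noteq> carrier (free_alg K V)"
    using J(3) incl_closed [OF one_carrier] by blast
  show "incl K V \<one>\<^bsub>V\<^esub> \<noteq> \<zero>\<^bsub>free_alg K V\<^esub>"
    using J(3,4) by metis
qed

theorem proposition5p4:
  fixes K :: "'k ring" and M :: int
  assumes "field K"
    and char_0: "\<And>n :: nat. n > 0 \<Longrightarrow> [n] \<cdot>\<^bsub>K\<^esub> \<one>\<^bsub>K\<^esub> \<noteq> \<zero>\<^bsub>K\<^esub>"
  shows
    "((\<forall>(V :: ('k, 'a) svec) V' \<phi>.
         V \<in> Ob (uVect K) \<longrightarrow> V' \<in> Ob (uVect K) \<longrightarrow> \<phi> \<in> Hom (uVect K) V V' \<longrightarrow>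
         (\<exists>!\<Phi>. induced_map K V (uVect_ideal K M V) V' (uVect_ideal K M V') \<phi> \<Phi>)) \<and>
      cat_functor (uVect K :: (('k, 'a) svec, 'a \<Rightarrow> 'a) cat) (VA K M)
        (uVect_V_ob K M) (uVect_V_hom K M)) \<and>
     (\<forall>N :: nat.
       (\<forall>S :: ('k, 'b) slie. souped_up_lie_algebra K S \<longrightarrow>
         SLA_ideal K M N S \<inter> incl K S ` carrier S = {\<zero>\<^bsub>free_alg K S\<^esub>}) \<longrightarrow>
       (\<forall>(S :: ('k, 'b) slie) S' \<phi>.
         S \<in> Ob (SLA K) \<longrightarrow> S' \<in> Ob (SLA K) \<longrightarrow> \<phi> \<in> Hom (SLA K) S S' \<longrightarrow>
         (\<exists>!\<Phi>. induced_map K S (SLA_ideal K M N S) S' (SLA_ideal K M N S') \<phi> \<Phi>)) \<and>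
       cat_functor (SLA K :: (('k, 'b) slie, 'b \<Rightarrow> 'b) cat) (VA K M)
         (SLA_V_ob K M N) (SLA_V_hom K M N))"
proof -
  have K: "char_zero_field K"
    using assms by (simp add: char_zero_field_def char_zero_field_axioms_def)
  have uVect_map: "unital_map K V V' \<phi>"
    if "V \<in> Ob (uVect K)" "V' \<in> Ob (uVect K)" "\<phi> \<in> Hom (uVect K) V V'"
    for V V' :: "('k, 'a) svec" and \<phi>
    using that by (simp add: uVect_def unital_map_def unital_map_axioms_def)
  have uVect_object: "nideal K (free_alg K V) (uVect_ideal K M V)"
    "vertex_algebra K M (quot_alg (free_alg K V) (uVect_ideal K M V))"
    if "V \<in> Ob (uVect K)" for V :: "('k, 'a) svec"
  proof -
    interpret unital_vector_space K V
      using that by (simp add: uVect_def)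
    show "nideal K (free_alg K V) (uVect_ideal K M V)"
      by (rule va_ideal_closed [OF K])
    then show "vertex_algebra K M (quot_alg (free_alg K V) (uVect_ideal K M V))"
      by (rule vertex_algebra_quotient)
        (rule graded_va_ideal [OF K] order_refl va_ideal_proper [OF K unital_vector_space_axioms])+
  qed
  have uVect_ideal: "free_map K V' \<phi> ` uVect_ideal K M V \<subseteq> uVect_ideal K M V'"
    if "V \<in> Ob (uVect K)" "V' \<in> Ob (uVect K)" "\<phi> \<in> Hom (uVect K) V V'"
    for V V' :: "('k, 'a) svec" and \<phi>
    by (rule unital_map.free_map_va_ideal [OF uVect_map [OF that] K]) simp
  have "cat_functor (uVect K :: (('k, 'a) svec, 'a \<Rightarrow> 'a) cat) (VA K M)
      (uVect_V_ob K M) (uVect_V_hom K M)"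
    using quotient_functor(2) [OF category_uVect [of K] _ _ uVect_object uVect_map uVect_ideal]
    unfolding uVect_V_ob_def [abs_def] uVect_V_hom_def [abs_def] by (simp add: uVect_def)
  moreover have "\<exists>!\<Phi>. induced_map K V (uVect_ideal K M V) V' (uVect_ideal K M V') \<phi> \<Phi>"
    if "V \<in> Ob (uVect K)" "V' \<in> Ob (uVect K)" "\<phi> \<in> Hom (uVect K) V V'"
    for V V' :: "('k, 'a) svec" and \<phi>
    using quotient_functor(1) [OF category_uVect [of K] _ _ uVect_object uVect_map uVect_ideal that]
    by (simp add: uVect_def)
  moreover have "(\<forall>(S :: ('k, 'b) slie) S' \<phi>.
         S \<in> Ob (SLA K) \<longrightarrow> S' \<in> Ob (SLA K) \<longrightarrow> \<phi> \<in> Hom (SLA K) S S' \<longrightarrow>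
         (\<exists>!\<Phi>. induced_map K S (SLA_ideal K M N S) S' (SLA_ideal K M N S') \<phi> \<Phi>)) \<and>
       cat_functor (SLA K :: (('k, 'b) slie, 'b \<Rightarrow> 'b) cat) (VA K M)
         (SLA_V_ob K M N) (SLA_V_hom K M N)"
    if trivial: "\<And>S :: ('k, 'b) slie. souped_up_lie_algebra K S \<Longrightarrow>
         SLA_ideal K M N S \<inter> incl K S ` carrier S = {\<zero>\<^bsub>free_alg K S\<^esub>}" for N :: nat
  proof -
    have sla_map: "sla_map K S S' \<phi>"
      if "S \<in> Ob (SLA K)" "S' \<in> Ob (SLA K)" "\<phi> \<in> Hom (SLA K) S S'"
      for S S' :: "('k, 'b) slie" and \<phi>
      using that
      by (auto simp: SLA_def sla_map_def sla_map_axioms_def unital_map_def unital_map_axioms_def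
          souped_up_lie_algebra_def)
    have object: "nideal K (free_alg K S) (SLA_ideal K M N S)"
      "vertex_algebra K M (quot_alg (free_alg K S) (SLA_ideal K M N S))"
      if "S \<in> Ob (SLA K)" for S :: "('k, 'b) slie"
    proof -
      interpret souped_up_lie_algebra K S
        using that by (simp add: SLA_def)
      show "nideal K (free_alg K S) (SLA_ideal K M N S)"
        by (rule sla_ideal_closed [OF K])
      moreover have "SLA_ideal K M N S \<noteq> carrier (free_alg K S)"
      proof
        assume "SLA_ideal K M N S = carrier (free_alg K S)"
        then have "incl K S \<one>\<^bsub>S\<^esub> \<in> SLA_ideal K M N S \<inter> incl K S ` carrier S"
          by simp
        then have "incl K S \<one>\<^bsub>S\<^esub> = \<zero>\<^bsub>free_alg K S\<^esub>"
          using trivial [OF souped_up_lie_algebra_axioms] by simp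
        then show False
          using va_ideal_proper(2) [OF K unital_vector_space_axioms] by simp
      qed
      ultimately show "vertex_algebra K M (quot_alg (free_alg K S) (SLA_ideal K M N S))"
        by (rule vertex_algebra_quotient [OF _ graded_sla_ideal [OF K] va_ideal_subset_sla_ideal])
    qed
    have ideal: "free_map K S' \<phi> ` SLA_ideal K M N S \<subseteq> SLA_ideal K M N S'"
      if "S \<in> Ob (SLA K)" "S' \<in> Ob (SLA K)" "\<phi> \<in> Hom (SLA K) S S'"
      for S S' :: "('k, 'b) slie" and \<phi>
      by (rule sla_map.free_map_sla_ideal [OF sla_map [OF that] K]) simp
    have map: "unital_map K S S' \<phi>"
      if "S \<in> Ob (SLA K)" "S' \<in> Ob (SLA K)" "\<phi> \<in> Hom (SLA K) S S'"
      for S S' :: "('k, 'b) slie" and \<phi>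
      using sla_map [OF that] by (rule sla_map.axioms)
    have "cat_functor (SLA K :: (('k, 'b) slie, 'b \<Rightarrow> 'b) cat) (VA K M)
        (SLA_V_ob K M N) (SLA_V_hom K M N)"
      using quotient_functor(2) [OF category_SLA [of K] _ _ object map ideal]
      unfolding SLA_V_ob_def [abs_def] SLA_V_hom_def [abs_def] by (simp add: SLA_def)
    moreover have "\<exists>!\<Phi>. induced_map K S (SLA_ideal K M N S) S' (SLA_ideal K M N S') \<phi> \<Phi>"
      if "S \<in> Ob (SLA K)" "S' \<in> Ob (SLA K)" "\<phi> \<in> Hom (SLA K) S S'"
      for S S' :: "('k, 'b) slie" and \<phi>
      using quotient_functor(1) [OF category_SLA [of K] _ _ object map ideal that]
      by (simp add: SLA_def)
    ultimately show ?thesis by blast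
  qed
  ultimately show ?thesis by blast
qed

end
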